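(* Let $(Q_1,\sigma_1),\ldots,(Q_\ell,\sigma_\ell)$ be quaternion algebras with arbitrary involution over $K$ (each $Q_i$ with centre $K$) and with common fixed field $F$, assumed formally real. Then the PS Conjecture holds for the tensor product $\bigotimes_{i=1}^{\ell}(Q_i,\sigma_i)$ (tensor product over $K$, with involution $\sigma_1\otimes\cdots\otimes\sigma_\ell$).
   Context: A quaternion algebra over $K$ is a central simple $K$-algebra of degree $2$ (not necessarily division). Let $(A,\sigma)$ be a (finite-dimensional) central simple algebra with centre $K$ and involution $\sigma$ (a ring anti-automorphism with $\sigma^2=\mathrm{id}$). Its fixed field is $F=\{x\in K:\sigma(x)=x\}$. The involution is of the first kind if $K=F$ and of the second kind (unitary) otherwise; in the latter case $[K:F]=2$ and $\sigma|_K$ is the non-trivial element of $\mathrm{Gal}(K/F)$. Let $\mathrm{Trd}:A\to F$ denote the reduced trace $\mathrm{Trd}_{A/F}$ if $\sigma$ is of the first kind, and the composition $\mathrm{Trd}_{K/F}\circ\mathrm{Trd}_{A/K}$ of the reduced trace with the trace of $K/F$ if $\sigma$ is of the second kind. Put $\mathrm{Sym}(A,\sigma)=\{a\in A:\sigma(a)=a\}$. An ordering $\leq_P$ of $F$ is a $\sigma$-ordering if $0\leq_P\mathrm{Trd}(\sigma(x)x)$ for all $x\in A$. An element $a\in\mathrm{Sym}(A,\sigma)$ is $\sigma$-positive with respect to a $\sigma$-ordering $\leq_P$ if $0\leq_P\mathrm{Trd}(\sigma(x)ax)$ for all $x\in A$; it is totally $\sigma$-positive if it is $\sigma$-positive with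 respect to all $\sigma$-orderings of $F$ (a vacuous condition if there are none). Hermitian squares in $(A,\sigma)$ are elements $\sigma(x)x$ with $x\in A$; sums are finite. "The PS Conjecture holds for $(A,\sigma)$" means: every totally $\sigma$-positive element of $A$ is a sum of hermitian squares in $(A,\sigma)$. *)

theory Defs
  imports
    "HOL-Algebra.Product_Groups"
    "HOL-Algebra.QuotRing"
    "HOL-Algebra.Algebraic_Closure_Type"
    "Jordan_Normal_Form.VS_Connect"
begin

section \<open>Central simple algebras\<close>

text \<open>
  An algebra over the field \<^typ>\<open>'k::field\<close> is a record of type
  \<^typ>\<open>('k, 'a) module\<close>, which carries a multiplication as well as a scalar action.
  The base field is embedded by \<open>k \<mapsto> k \<odot> \<one>\<close>. (The locale \<open>algebra\<close> of
  HOL-Algebra is not applicable here: it demands a commutative multiplication.)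
\<close>

definition k_algebra :: "('k::field, 'a, 'm) module_scheme \<Rightarrow> bool" where
  "k_algebra A \<longleftrightarrow> ring A \<and> vectorspace (class_ring :: 'k ring) A \<and>
     (\<forall>k. \<forall>x\<in>carrier A. \<forall>y\<in>carrier A.
        (k \<odot>\<^bsub>A\<^esub> x) \<otimes>\<^bsub>A\<^esub> y = k \<odot>\<^bsub>A\<^esub> (x \<otimes>\<^bsub>A\<^esub> y) \<and>
        x \<otimes>\<^bsub>A\<^esub> (k \<odot>\<^bsub>A\<^esub> y) = k \<odot>\<^bsub>A\<^esub> (x \<otimes>\<^bsub>A\<^esub> y))"

definition centre :: "('a, 'm) ring_scheme \<Rightarrow> 'a set" where
  "centre A = {z \<in> carrier A. \<forall>x\<in>carrier A. z \<otimes>\<^bsub>A\<^esub> x = x \<otimes>\<^bsub>A\<^esub> z}"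

definition simple_ring :: "('a, 'm) ring_scheme \<Rightarrow> bool" where
  "simple_ring A \<longleftrightarrow> ring A \<and> carrier A \<noteq> {\<zero>\<^bsub>A\<^esub>} \<and>
     (\<forall>I. ideal I A \<longrightarrow> I = {\<zero>\<^bsub>A\<^esub>} \<or> I = carrier A)"

definition central_simple_algebra :: "('k::field, 'a, 'm) module_scheme \<Rightarrow> bool" where
  "central_simple_algebra A \<longleftrightarrow>
     k_algebra A \<and> vectorspace.fin_dim (class_ring :: 'k ring) A \<and>
     centre A = range (\<lambda>k. k \<odot>\<^bsub>A\<^esub> \<one>\<^bsub>A\<^esub>) \<and> simple_ring A"

definition has_degree :: "('k::field, 'a, 'm) module_scheme \<Rightarrow> nat \<Rightarrow> bool" where
  "has_degree A n \<longleftrightarrow> vectorspace.dim (class_ring :: 'k ring) A = n\<^sup>2"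

definition quaternion_algebra :: "('k::field, 'a, 'm) module_scheme \<Rightarrow> bool" where
  "quaternion_algebra A \<longleftrightarrow> central_simple_algebra A \<and> has_degree A 2"

definition mat_trace :: "'b::comm_monoid_add mat \<Rightarrow> 'b" where
  "mat_trace M = (\<Sum>i<dim_row M. M $$ (i, i))"

text \<open>
  The reduced trace of a central simple algebra \<open>A\<close> of degree \<open>n\<close>: regard \<open>A\<close> as a subalgebra
  of \<open>M\<^sub>n(\<Omega>)\<close>, where \<open>\<Omega>\<close> is an algebraic closure of the base field; the trace of the image of an
  element then lies in the base field and does not depend on the chosen embedding.
\<close>

definition reduced_trace :: "('k::field, 'a, 'm) module_scheme \<Rightarrow> 'a \<Rightarrow> 'k" where
  "reduced_trace A a = (THE t. \<exists>n \<phi>. has_degree A n \<and>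
     \<phi> \<in> Ring.ring_hom A (ring_mat TYPE('k alg_closure) n ()) \<and>
     (\<forall>k. \<forall>x\<in>carrier A. \<phi> (k \<odot>\<^bsub>A\<^esub> x) = to_ac k \<cdot>\<^sub>m \<phi> x) \<and>
     to_ac t = mat_trace (\<phi> a))"


section \<open>Involutions\<close>

text \<open>An involution need not be linear over the base field.\<close>

definition involution :: "('a, 'm) ring_scheme \<Rightarrow> ('a \<Rightarrow> 'a) \<Rightarrow> bool" where
  "involution A \<sigma> \<longleftrightarrow> \<sigma> \<in> carrier A \<rightarrow> carrier A \<and> \<sigma> \<one>\<^bsub>A\<^esub> = \<one>\<^bsub>A\<^esub> \<and>
     (\<forall>x\<in>carrier A. \<forall>y\<in>carrier A. \<sigma> (x \<oplus>\<^bsub>A\<^esub> y) = \<sigma> x \<oplus>\<^bsub>A\<^esub> \<sigma> y \<and>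
                                   \<sigma> (x \<otimes>\<^bsub>A\<^esub> y) = \<sigma> y \<otimes>\<^bsub>A\<^esub> \<sigma> x) \<and>
     (\<forall>x\<in>carrier A. \<sigma> (\<sigma> x) = x)"

text \<open>The fixed field, viewed inside the base field by \<open>k \<mapsto> k \<odot> \<one>\<close>.\<close>

definition fixed_field :: "('k::field, 'a, 'm) module_scheme \<Rightarrow> ('a \<Rightarrow> 'a) \<Rightarrow> 'k set" where
  "fixed_field A \<sigma> = {k. \<sigma> (k \<odot>\<^bsub>A\<^esub> \<one>\<^bsub>A\<^esub>) = k \<odot>\<^bsub>A\<^esub> \<one>\<^bsub>A\<^esub>}"

definition first_kind :: "('k::field, 'a, 'm) module_scheme \<Rightarrow> ('a \<Rightarrow> 'a) \<Rightarrow> bool" where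
  "first_kind A \<sigma> \<longleftrightarrow> fixed_field A \<sigma> = UNIV"

text \<open>The restriction of \<open>\<sigma>\<close> to the centre, as a map on the base field.\<close>

definition centre_restriction ::
    "('k::field, 'a, 'm) module_scheme \<Rightarrow> ('a \<Rightarrow> 'a) \<Rightarrow> 'k \<Rightarrow> 'k" where
  "centre_restriction A \<sigma> k = (THE c. \<sigma> (k \<odot>\<^bsub>A\<^esub> \<one>\<^bsub>A\<^esub>) = c \<odot>\<^bsub>A\<^esub> \<one>\<^bsub>A\<^esub>)"

text \<open>
  The trace to the fixed field \<open>F\<close>. If \<open>\<sigma>\<close> is of the second kind then the base field \<open>K\<close> is
  quadratic over \<open>F\<close> and its Galois group consists of the identity and the restriction of \<open>\<sigma>\<close>,
  so that the trace of \<open>K/F\<close> is the sum of these two conjugates.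
\<close>

definition Trd :: "('k::field, 'a, 'm) module_scheme \<Rightarrow> ('a \<Rightarrow> 'a) \<Rightarrow> 'a \<Rightarrow> 'k" where
  "Trd A \<sigma> a =
     (if first_kind A \<sigma> then reduced_trace A a
      else reduced_trace A a + centre_restriction A \<sigma> (reduced_trace A a))"

definition Sym :: "('a, 'm) ring_scheme \<Rightarrow> ('a \<Rightarrow> 'a) \<Rightarrow> 'a set" where
  "Sym A \<sigma> = {a \<in> carrier A. \<sigma> a = a}"


section \<open>Orderings and positivity\<close>

definition formally_real :: "'k::field set \<Rightarrow> bool" where
  "formally_real F \<longleftrightarrow> \<not> (\<exists>xs. set xs \<subseteq> F \<and> (\<Sum>x\<leftarrow>xs. x\<^sup>2) = - 1)"

text \<open>An ordering of \<open>F\<close> is given by its set \<open>P\<close> of nonnegative elements.\<close>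

definition field_ordering :: "'k::field set \<Rightarrow> 'k set \<Rightarrow> bool" where
  "field_ordering F P \<longleftrightarrow> P \<subseteq> F \<and>
     (\<forall>x\<in>P. \<forall>y\<in>P. x + y \<in> P \<and> x * y \<in> P) \<and>
     (\<forall>x\<in>F. x \<in> P \<or> - x \<in> P) \<and>
     (\<forall>x. x \<in> P \<and> - x \<in> P \<longrightarrow> x = 0)"

definition ord_le :: "'k::field \<Rightarrow> 'k set \<Rightarrow> 'k \<Rightarrow> bool"
    (\<open>(_/ \<le>\<^bsub>_\<^esub> _)\<close> [51, 0, 51] 50) where
  "x \<le>\<^bsub>P\<^esub> y \<longleftrightarrow> y - x \<in> P"

definition sigma_ordering ::
    "('k::field, 'a, 'm) module_scheme \<Rightarrow> ('a \<Rightarrow> 'a) \<Rightarrow> 'k set \<Rightarrow> bool" where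
  "sigma_ordering A \<sigma> P \<longleftrightarrow> field_ordering (fixed_field A \<sigma>) P \<and>
     (\<forall>x\<in>carrier A. 0 \<le>\<^bsub>P\<^esub> Trd A \<sigma> (\<sigma> x \<otimes>\<^bsub>A\<^esub> x))"

definition sigma_positive ::
    "('k::field, 'a, 'm) module_scheme \<Rightarrow> ('a \<Rightarrow> 'a) \<Rightarrow> 'k set \<Rightarrow> 'a \<Rightarrow> bool" where
  "sigma_positive A \<sigma> P a \<longleftrightarrow>
     (\<forall>x\<in>carrier A. 0 \<le>\<^bsub>P\<^esub> Trd A \<sigma> (\<sigma> x \<otimes>\<^bsub>A\<^esub> a \<otimes>\<^bsub>A\<^esub> x))"

definition totally_sigma_positive ::
    "('k::field, 'a, 'm) module_scheme \<Rightarrow> ('a \<Rightarrow> 'a) \<Rightarrow> 'a \<Rightarrow> bool" where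
  "totally_sigma_positive A \<sigma> a \<longleftrightarrow> a \<in> Sym A \<sigma> \<and>
     (\<forall>P. sigma_ordering A \<sigma> P \<longrightarrow> sigma_positive A \<sigma> P a)"

definition sum_of_hermitian_squares ::
    "('a, 'm) ring_scheme \<Rightarrow> ('a \<Rightarrow> 'a) \<Rightarrow> 'a \<Rightarrow> bool" where
  "sum_of_hermitian_squares A \<sigma> a \<longleftrightarrow>
     (\<exists>(n::nat) x. (\<forall>i<n. x i \<in> carrier A) \<and>
        a = finsum A (\<lambda>i. \<sigma> (x i) \<otimes>\<^bsub>A\<^esub> x i) {..<n})"

definition PS_conjecture_holds ::
    "('k::field, 'a, 'm) module_scheme \<Rightarrow> ('a \<Rightarrow> 'a) \<Rightarrow> bool" where
  "PS_conjecture_holds A \<sigma> \<longleftrightarrow>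
     (\<forall>a. totally_sigma_positive A \<sigma> a \<longrightarrow> sum_of_hermitian_squares A \<sigma> a)"


section \<open>Tensor products\<close>

text \<open>
  The tensor product over \<open>K\<close> of a finite family of \<open>K\<close>-algebras is the free \<open>K\<close>-module on the
  set of tuples \<open>\<Prod> Q\<^sub>i\<close> modulo the multilinearity relations. Since multiplication of pure tensors
  is componentwise, the free module is the monoid algebra of the multiplicative monoid
  \<open>\<Prod> Q\<^sub>i\<close>, and the relations span an ideal of it.
\<close>

definition single :: "'g \<Rightarrow> 'k::field \<Rightarrow> 'g \<Rightarrow> 'k" where
  "single g c = (\<lambda>h. if h = g then c else 0)"

definition monoid_algebra :: "('g, 'm) monoid_scheme \<Rightarrow> ('g \<Rightarrow> 'k::field) ring" where
  "monoid_algebra M = \<lparr>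
     carrier = {f. {g. f g \<noteq> 0} \<subseteq> carrier M \<and> finite {g. f g \<noteq> 0}},
     monoid.mult = (\<lambda>f h g. \<Sum>(u, v) \<in> {(u, v). f u \<noteq> 0 \<and> h v \<noteq> 0 \<and> u \<otimes>\<^bsub>M\<^esub> v = g}. f u * h v),
     one = single \<one>\<^bsub>M\<^esub> 1,
     ring.zero = (\<lambda>g. 0),
     add = (\<lambda>f h g. f g + h g) \<rparr>"

definition tuple_algebra ::
    "nat set \<Rightarrow> (nat \<Rightarrow> ('k::field, 'q) module) \<Rightarrow> ((nat \<Rightarrow> 'q) \<Rightarrow> 'k) ring" where
  "tuple_algebra I Q = monoid_algebra (product_group I Q)"

definition multilinear_relations ::
    "nat set \<Rightarrow> (nat \<Rightarrow> ('k::field, 'q) module) \<Rightarrow> ((nat \<Rightarrow> 'q) \<Rightarrow> 'k) set" where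
  "multilinear_relations I Q =
     {(\<lambda>h. single (g(i := x \<oplus>\<^bsub>Q i\<^esub> y)) 1 h - single (g(i := x)) 1 h - single (g(i := y)) 1 h)
        | g i x y. g \<in> carrier (product_group I Q) \<and> i \<in> I \<and>
                   x \<in> carrier (Q i) \<and> y \<in> carrier (Q i)}
   \<union> {(\<lambda>h. single (g(i := k \<odot>\<^bsub>Q i\<^esub> x)) 1 h - single (g(i := x)) k h)
        | g i k x. g \<in> carrier (product_group I Q) \<and> i \<in> I \<and> x \<in> carrier (Q i)}"

definition tensor_ideal ::
    "nat set \<Rightarrow> (nat \<Rightarrow> ('k::field, 'q) module) \<Rightarrow> ((nat \<Rightarrow> 'q) \<Rightarrow> 'k) set" where
  "tensor_ideal I Q = genideal (tuple_algebra I Q) (multilinear_relations I Q)"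

definition tensor_algebra ::
    "nat set \<Rightarrow> (nat \<Rightarrow> ('k::field, 'q) module) \<Rightarrow> ('k, ((nat \<Rightarrow> 'q) \<Rightarrow> 'k) set) module" where
  "tensor_algebra I Q =
     (let R = tuple_algebra I Q; J = tensor_ideal I Q; T = R Quot J in
      \<lparr> carrier = carrier T,
        monoid.mult = monoid.mult T,
        one = one T,
        ring.zero = ring.zero T,
        add = add T,
        module.smult = (\<lambda>k c. (J +>\<^bsub>R\<^esub> single \<one>\<^bsub>product_group I Q\<^esub> k) \<otimes>\<^bsub>T\<^esub> c) \<rparr>)"

text \<open>
  The involution \<open>\<Otimes> \<sigma>\<^sub>i\<close> sends \<open>\<Sum> c\<^sub>g g\<close>, where the sum is over tuples \<open>g\<close>, to
  \<open>\<Sum> \<tau>(c\<^sub>g) \<sigma>(g)\<close>; here \<open>\<tau>\<close> is the common restriction of the \<open>\<sigma>\<^sub>i\<close> to the base field and \<open>\<sigma>\<close>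
  acts on tuples componentwise. As \<open>\<sigma>\<^sup>2 = id\<close>, the coefficient of the image at \<open>g\<close> is
  \<open>\<tau>\<close> applied to the coefficient of the argument at \<open>\<sigma>(g)\<close>. This map
  preserves the ideal of relations, so that the image of a coset under it is again a coset.
\<close>

definition common_restriction ::
    "nat set \<Rightarrow> (nat \<Rightarrow> ('k::field, 'q) module) \<Rightarrow> (nat \<Rightarrow> 'q \<Rightarrow> 'q) \<Rightarrow> 'k \<Rightarrow> 'k" where
  "common_restriction I Q \<sigma> k =
     (THE c. \<forall>i\<in>I. \<sigma> i (k \<odot>\<^bsub>Q i\<^esub> \<one>\<^bsub>Q i\<^esub>) = c \<odot>\<^bsub>Q i\<^esub> \<one>\<^bsub>Q i\<^esub>)"

definition tuple_star ::
    "nat set \<Rightarrow> (nat \<Rightarrow> ('k::field, 'q) module) \<Rightarrow> (nat \<Rightarrow> 'q \<Rightarrow> 'q) \<Rightarrow>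
     ((nat \<Rightarrow> 'q) \<Rightarrow> 'k) \<Rightarrow> (nat \<Rightarrow> 'q) \<Rightarrow> 'k" where
  "tuple_star I Q \<sigma> f =
     (\<lambda>g. if g \<in> carrier (product_group I Q)
          then common_restriction I Q \<sigma> (f (\<lambda>i\<in>I. \<sigma> i (g i))) else 0)"

definition tensor_involution ::
    "nat set \<Rightarrow> (nat \<Rightarrow> ('k::field, 'q) module) \<Rightarrow> (nat \<Rightarrow> 'q \<Rightarrow> 'q) \<Rightarrow>
     ((nat \<Rightarrow> 'q) \<Rightarrow> 'k) set \<Rightarrow> ((nat \<Rightarrow> 'q) \<Rightarrow> 'k) set" where
  "tensor_involution I Q \<sigma> c = tuple_star I Q \<sigma> ` c"

end

theory Submission
  imports Defs
begin

text \<open>Every factor has a basis \<open>1, u, v, uv\<close> whose members are symmetric or skew and have their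
  squares in \<open>F\<close>. Products of such bases give a \<open>K\<close>-basis \<open>(e\<^sub>g)\<close> of \<open>A\<close> with \<open>\<sigma>(e\<^sub>g) = \<plusminus>e\<^sub>g\<close>,
  \<open>w\<^sub>g = \<sigma>(e\<^sub>g) e\<^sub>g \<in> F\<close> nonzero, and orthogonal for the form \<open>Trd(\<sigma>(x) y)\<close>, the values of the reduced
  trace being forced by anticommutation. Expanding \<open>a e\<^sub>h\<close> in this basis for each of the \<open>N\<close> indices
  \<open>h\<close> yields \<open>N n a = \<Sum>\<^sub>g\<^sub>h M\<^sub>g\<^sub>h f\<^sub>g \<sigma>(f\<^sub>h)\<close> with \<open>f\<^sub>g = e\<^sub>g / w\<^sub>g\<close>, \<open>n\<close> the degree, and the hermitian
  matrix \<open>M\<^sub>g\<^sub>h = Trd(\<sigma>(e\<^sub>g) a e\<^sub>h)\<close>.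

  The elements of \<open>F\<close> that are sums of hermitian squares form a preordering \<open>H\<close>. If \<open>- 1 \<in> H\<close>, then
  \<open>4 a = (a + 1)\<^sup>2 - (a - 1)\<^sup>2\<close> settles the matter. Otherwise \<open>H\<close> is the intersection of the orderings
  containing it, all of which are \<open>\<sigma>\<close>-orderings, so that \<open>M\<close> takes values in \<open>H\<close>; completing squares
  writes \<open>M\<close> as \<open>\<Sum> h\<^sub>k v\<^sub>k v\<^sub>k\<^sup>*\<close> with \<open>h\<^sub>k \<in> H\<close>, and \<open>a\<close> is a sum of hermitian squares.\<close>

section \<open>Preorderings of fields\<close>

text \<open>Two circumstances shape the argument. Orderings produced from \<open>H\<close> must be
  shown to be \<sigma>-orderings before positivity of \<open>a\<close> can be applied to them. They
  are, because the form \<open>Trd(\<sigma>(x) x)\<close> is diagonal in the basis and each diagonal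
  entry is a positive integer times \<open>w\<^sub>g\<close>, which is itself a hermitian square. So
  the form takes its values in \<open>H\<close>. This is what quaternion factors contribute.
  Secondly, the factors may be split, so one cannot divide by their nonzero elements; that every
  element is quadratic has to come from simplicity and dimension four. The tensor product is a
  quotient by an ideal, where independence of the product basis is invisible; a Kronecker product of
  splittings over the algebraic closure makes it visible through traces. The reduced trace is a
  definite description over all matrix representations of the right degree. The anticommutation that
  makes the basis orthogonal also forces one and the same trace on all of them, so representations
  need not be compared up to conjugacy.\<close>

definition field_preordering :: "'k::field set \<Rightarrow> 'k set \<Rightarrow> bool" where
  "field_preordering F H \<longleftrightarrow> H \<subseteq> F \<and> (\<forall>x\<in>H. \<forall>y\<in>H. x + y \<in> H \<and> x * y \<in> H) \<and>
     (\<forall>x\<in>F. x\<^sup>2 \<in> H)"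

definition subfield_set :: "'k::field set \<Rightarrow> bool" where
  "subfield_set F \<longleftrightarrow> 1 \<in> F \<and> (\<forall>x\<in>F. \<forall>y\<in>F. x - y \<in> F \<and> x * y \<in> F) \<and> (\<forall>x\<in>F. inverse x \<in> F)"

lemma subfield_setD:
  assumes "subfield_set F"
  shows "1 \<in> F" "0 \<in> F" "x \<in> F \<Longrightarrow> y \<in> F \<Longrightarrow> x - y \<in> F" "x \<in> F \<Longrightarrow> - x \<in> F"
    "x \<in> F \<Longrightarrow> y \<in> F \<Longrightarrow> x + y \<in> F" "x \<in> F \<Longrightarrow> y \<in> F \<Longrightarrow> x * y \<in> F" "x \<in> F \<Longrightarrow> inverse x \<in> F"
    "x \<in> F \<Longrightarrow> y \<in> F \<Longrightarrow> x / y \<in> F"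
proof -
  have d: "\<And>x y. x \<in> F \<Longrightarrow> y \<in> F \<Longrightarrow> x - y \<in> F" and m: "\<And>x y. x \<in> F \<Longrightarrow> y \<in> F \<Longrightarrow> x * y \<in> F"
    and o: "1 \<in> F" and i: "\<And>x. x \<in> F \<Longrightarrow> inverse x \<in> F"
    using assms by (auto simp: subfield_set_def)
  have z: "0 \<in> F" using d[OF o o] by simp
  have n: "\<And>x. x \<in> F \<Longrightarrow> - x \<in> F" using d[OF z] by simp
  have a: "\<And>x y. x \<in> F \<Longrightarrow> y \<in> F \<Longrightarrow> x + y \<in> F" using d n by (metis diff_minus_eq_add)
  show "1 \<in> F" "0 \<in> F" "x \<in> F \<Longrightarrow> y \<in> F \<Longrightarrow> x - y \<in> F" "x \<in> F \<Longrightarrow> - x \<in> F"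
    "x \<in> F \<Longrightarrow> y \<in> F \<Longrightarrow> x + y \<in> F" "x \<in> F \<Longrightarrow> y \<in> F \<Longrightarrow> x * y \<in> F" "x \<in> F \<Longrightarrow> inverse x \<in> F"
    "x \<in> F \<Longrightarrow> y \<in> F \<Longrightarrow> x / y \<in> F"
    using d m o i z n a by (auto simp: divide_inverse)
qed

text \<open>\<open>1 / h\<close> is \<open>h\<close> times the square of
  \<open>1 / h\<close>.\<close>

lemma preordering_inverse:
  assumes F: "subfield_set F" and H: "field_preordering F H" and h: "h \<in> H"
  shows "inverse h \<in> H"
proof (cases "h = 0")
  case True then show ?thesis using h by simp
next
  case False
  have "inverse h \<in> F" using F H h by (auto simp: field_preordering_def subfield_setD)
  then have "h * (inverse h)\<^sup>2 \<in> H" using H h by (auto simp: field_preordering_def)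
  moreover have "h * (inverse h)\<^sup>2 = inverse h" using False by (simp add: power2_eq_square)
  ultimately show ?thesis by simp
qed

text \<open>If \<open>- 1 = p - x q\<close>, then \<open>x q = 1 + p\<close>; dividing by
  \<open>q\<close> puts \<open>x\<close> into \<open>H\<close>, while \<open>q = 0\<close> puts
  \<open>- 1\<close> there. Properness is a separate hypothesis because
  \<open>field_preordering\<close> also admits cones containing \<open>- 1\<close>, a case that is
  split off later.\<close>

lemma preordering_adjoin:
  assumes F: "subfield_set F" and H: "field_preordering F H" and m1: "- 1 \<notin> H"
    and x: "x \<in> F" "x \<notin> H"
  defines "H' \<equiv> {h - x * h' | h h'. h \<in> H \<and> h' \<in> H}"
  shows "field_preordering F H'" "H \<subseteq> H'" "- x \<in> H'" "- 1 \<notin> H'"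
proof -
  note Fs = subfield_setD[OF F]
  have HF: "H \<subseteq> F" and Ha: "\<And>a b. a \<in> H \<Longrightarrow> b \<in> H \<Longrightarrow> a + b \<in> H"
    and Hm: "\<And>a b. a \<in> H \<Longrightarrow> b \<in> H \<Longrightarrow> a * b \<in> H" and Hs: "\<And>a. a \<in> F \<Longrightarrow> a\<^sup>2 \<in> H"
    using H by (auto simp: field_preordering_def)
  have H0: "0 \<in> H" and H1: "1 \<in> H" using Hs[of 0] Hs[of 1] Fs by auto
  have I: "h \<in> H \<Longrightarrow> h' \<in> H \<Longrightarrow> y = h - x * h' \<Longrightarrow> y \<in> H'" for y h h'
    unfolding H'_def by blast
  show sub: "H \<subseteq> H'"
  proof
    fix h assume "h \<in> H" then show "h \<in> H'" using H0 by (intro I[of h 0]) auto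
  qed
  show "- x \<in> H'" using H0 H1 by (intro I[of 0 1]) auto
  show "field_preordering F H'"
    unfolding field_preordering_def
  proof (intro conjI ballI)
    show "H' \<subseteq> F" using HF x Fs(3,6) by (auto simp: H'_def subset_iff)
  next
    fix a b assume "a \<in> H'" "b \<in> H'"
    then obtain p q r s where e: "a = p - x * q" "b = r - x * s" "p \<in> H" "q \<in> H" "r \<in> H" "s \<in> H"
      unfolding H'_def by blast
    show "a + b \<in> H'" using e Ha by (intro I[of "p + r" "q + s"]) (auto simp: algebra_simps)
    \<comment> \<open>As \<open>x x\<close> is a square, the term \<open>x x q s\<close> of the
      product joins the summand without \<open>x\<close>.\<close>
    have "x * x \<in> H" using Hs[OF x(1)] by (simp add: power2_eq_square)
    then show "a * b \<in> H'" using e Ha Hm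
      by (intro I[of "p * r + x * x * (q * s)" "q * r + p * s"]) (auto simp: algebra_simps)
  next
    fix a assume "a \<in> F" then show "a\<^sup>2 \<in> H'" using Hs sub by blast
  qed
  show "- 1 \<notin> H'"
  proof
    assume "- 1 \<in> H'"
    then obtain p q where e: "- 1 = p - x * q" "p \<in> H" "q \<in> H" unfolding H'_def by blast
    then have xq: "x * q = 1 + p" by (simp add: algebra_simps)
    show False
    proof (cases "q = 0")
      case True then show False using e m1 by simp
    next
      case False
      then have "x = (1 + p) * inverse q" using xq by (simp add: field_simps)
      then show False using x(2) Hm Ha H1 e preordering_inverse[OF F H] by metis
    qed
  qed
qed

text \<open>A maximal proper preordering is an ordering. Zorn's lemma starts from
  \<open>H - x H\<close> rather than from \<open>H\<close>, so that \<open>- x\<close> lies in the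
  result; then \<open>x\<close> does not, being nonzero as \<open>0 \<in> H\<close>.\<close>

lemma artin_preordering:
  assumes F: "subfield_set F" and H: "field_preordering F H" and m1: "- 1 \<notin> H"
    and x: "x \<in> F" "x \<notin> H"
  obtains P where "field_ordering F P" "H \<subseteq> P" "x \<notin> P"
proof -
  note Fs = subfield_setD[OF F]
  obtain H' where H': "field_preordering F H'" "H \<subseteq> H'" "- x \<in> H'" "- 1 \<notin> H'"
    using preordering_adjoin[OF F H m1 x] by blast
  define PP where "PP = {P. field_preordering F P \<and> H' \<subseteq> P \<and> - 1 \<notin> P}"
  have "\<exists>M\<in>PP. \<forall>Y\<in>PP. M \<subseteq> Y \<longrightarrow> Y = M"
  proof (rule subset_Zorn_nonempty)
    show "PP \<noteq> {}" using H' by (auto simp: PP_def)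
    fix C assume C: "C \<noteq> {}" "subset.chain PP C"
    have CA: "C \<subseteq> PP" and lin: "\<And>a b. a \<in> C \<Longrightarrow> b \<in> C \<Longrightarrow> a \<subseteq> b \<or> b \<subseteq> a"
      using C(2) by (auto simp: subset.chain_def)
    have pre: "\<And>P. P \<in> C \<Longrightarrow> field_preordering F P" using CA by (auto simp: PP_def)
    have "field_preordering F (\<Union>C)"
      unfolding field_preordering_def
    proof (intro conjI ballI)
      have "P \<subseteq> F" if "P \<in> C" for P using pre[OF that] by (simp add: field_preordering_def)
      then show "\<Union>C \<subseteq> F" by (rule Union_least)
    next
      fix a b assume "a \<in> \<Union>C" "b \<in> \<Union>C"
      then obtain P Q where PQ: "P \<in> C" "a \<in> P" "Q \<in> C" "b \<in> Q" by blast
      obtain R where "R \<in> C" "a \<in> R" "b \<in> R" using lin[OF PQ(1,3)] PQ by blast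
      then show "a + b \<in> \<Union>C" "a * b \<in> \<Union>C" using pre[of R] by (auto simp: field_preordering_def)
    next
      fix a assume "a \<in> F" then show "a\<^sup>2 \<in> \<Union>C" using C(1) pre by (fastforce simp: field_preordering_def)
    qed
    then show "\<Union>C \<in> PP" using CA C(1) by (auto simp: PP_def)
  qed
  then obtain P where PP: "P \<in> PP" and max: "\<And>Y. Y \<in> PP \<Longrightarrow> P \<subseteq> Y \<Longrightarrow> Y = P" by metis
  have P: "field_preordering F P" "H' \<subseteq> P" "- 1 \<notin> P" using PP by (auto simp: PP_def)
  have tot: "a \<in> P \<or> - a \<in> P" if aF: "a \<in> F" for a
  proof (rule ccontr)
    assume n: "\<not> (a \<in> P \<or> - a \<in> P)"
    obtain P' where P': "field_preordering F P'" "P \<subseteq> P'" "- a \<in> P'" "- 1 \<notin> P'"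
      using preordering_adjoin[OF F P(1) P(3) aF] n by blast
    have "P' \<in> PP" using P' P by (auto simp: PP_def)
    then show False using max[OF _ P'(2)] P'(3) n by blast
  qed
  \<comment> \<open>Otherwise \<open>- a * inverse a = - 1\<close> would lie in
    \<open>P\<close>.\<close>
  have anti: "a = 0" if "a \<in> P" "- a \<in> P" for a
  proof (rule ccontr)
    assume "a \<noteq> 0"
    have "- a * inverse a \<in> P"
      using that P(1) preordering_inverse[OF F P(1) that(1)] by (auto simp: field_preordering_def)
    then show False using \<open>a \<noteq> 0\<close> P(3) by simp
  qed
  have "field_ordering F P"
    using P(1) tot anti by (auto simp: field_ordering_def field_preordering_def)
  moreover have "0 \<in> H" using H Fs(2) by (auto simp: field_preordering_def dest: bspec[of _ _ 0])
  then have "x \<notin> P" using anti[of x] H'(3) P(2) x(2) by auto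
  ultimately show thesis using that H'(2) P(2) by blast
qed

section \<open>Row-finite matrices\<close>

text \<open>Row-finite infinite matrices form a unital ring that is a type, so that all full matrix
  rings over a field embed into it; computations in a given algebra can then be carried out with
  the ring type classes.\<close>

typedef (overloaded) 'k rfm = "{f :: nat \<Rightarrow> nat \<Rightarrow> 'k::field. \<forall>i. finite {j. f i j \<noteq> 0}}"
  morphisms entry Rfm
  by (rule exI[of _ "\<lambda>i j. 0"]) simp

lemma row_finite_add:
  fixes f g :: "nat \<Rightarrow> nat \<Rightarrow> 'a::field"
  assumes "\<And>i. finite {j. f i j \<noteq> 0}" "\<And>i. finite {j. g i j \<noteq> 0}"
  shows "finite {j. f i j + g i j \<noteq> 0}"
  by (rule finite_subset[OF _ finite_UnI[OF assms[of i]]]) auto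

lemma row_finite_mult:
  fixes f g :: "nat \<Rightarrow> nat \<Rightarrow> 'a::field"
  assumes "\<And>i. finite {j. f i j \<noteq> 0}" "\<And>i. finite {j. g i j \<noteq> 0}"
  shows "finite {j. (\<Sum>k | f i k \<noteq> 0. f i k * g k j) \<noteq> 0}"
proof (rule finite_subset)
  show "{j. (\<Sum>k | f i k \<noteq> 0. f i k * g k j) \<noteq> 0} \<subseteq> (\<Union>k\<in>{k. f i k \<noteq> 0}. {j. g k j \<noteq> 0})"
  proof
    fix j assume "j \<in> {j. (\<Sum>k | f i k \<noteq> 0. f i k * g k j) \<noteq> 0}"
    then obtain k where "f i k \<noteq> 0" "f i k * g k j \<noteq> 0" by (auto elim!: sum.not_neutral_contains_not_neutral)
    then show "j \<in> (\<Union>k\<in>{k. f i k \<noteq> 0}. {j. g k j \<noteq> 0})" by auto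
  qed
qed (use assms in blast)

setup_lifting type_definition_rfm

lemma finite_row: "finite {j. entry f i j \<noteq> 0}" using entry[of f] by simp

lift_definition rfm_scalar :: "'k::field \<Rightarrow> 'k rfm" is "\<lambda>k i j. if i = j then k else 0"
  by (auto intro: finite_subset[of _ "{i}" for i])

instantiation rfm :: (field) ring_1
begin

lift_definition zero_rfm :: "'a rfm" is "\<lambda>i j. 0" by simp
lift_definition one_rfm :: "'a rfm" is "\<lambda>i j. if i = j then 1 else 0"
  by (auto intro: finite_subset[of _ "{i}" for i])
lift_definition plus_rfm :: "'a rfm \<Rightarrow> 'a rfm \<Rightarrow> 'a rfm" is "\<lambda>f g i j. f i j + g i j"
  by (auto intro!: row_finite_add)
lift_definition uminus_rfm :: "'a rfm \<Rightarrow> 'a rfm" is "\<lambda>f i j. - f i j" by simp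
definition minus_rfm :: "'a rfm \<Rightarrow> 'a rfm \<Rightarrow> 'a rfm" where "minus_rfm f g = f + - g"
lift_definition times_rfm :: "'a rfm \<Rightarrow> 'a rfm \<Rightarrow> 'a rfm"
  is "\<lambda>f g i j. \<Sum>k | f i k \<noteq> 0. f i k * g k j"
  by (auto intro!: row_finite_mult)

lemma entry_times:
  assumes "finite S" "{k. entry f i k \<noteq> 0} \<subseteq> S"
  shows "entry (f * g) i j = (\<Sum>k\<in>S. entry f i k * entry g k j)"
  unfolding times_rfm.rep_eq using assms by (intro sum.mono_neutral_left) auto

instance
proof
  fix a b c :: "'a rfm"
  show "a * b * c = a * (b * c)"
  proof (rule entry_inject[THEN iffD1], intro ext)
    fix i j
    \<comment> \<open>\<open>S\<close> and \<open>T\<close> hold the columns reached from row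
      \<open>i\<close> in one and in two steps. Over these finite index sets both bracketings become
      double sums that differ in their order.\<close>
    define S where "S = {k. entry a i k \<noteq> 0}"
    define T where "T = (\<Union>k\<in>S. {m. entry b k m \<noteq> 0})"
    have fS: "finite S" and fT: "finite T" by (auto simp: S_def T_def finite_row)
    have supp: "{k. entry (a * b) i k \<noteq> 0} \<subseteq> T"
    proof
      fix m assume "m \<in> {k. entry (a * b) i k \<noteq> 0}"
      then have "(\<Sum>k\<in>S. entry a i k * entry b k m) \<noteq> 0"
        using entry_times[OF fS, of a i b m] by (simp add: S_def)
      then obtain k where "k \<in> S" "entry a i k * entry b k m \<noteq> 0"
        by (rule sum.not_neutral_contains_not_neutral)
      then show "m \<in> T" by (auto simp: T_def)
    qed
    have "entry (a * b * c) i j = (\<Sum>m\<in>T. (\<Sum>k\<in>S. entry a i k * entry b k m) * entry c m j)"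
      using entry_times[OF fT supp] entry_times[OF fS, of a i b] by (simp add: S_def)
    also have "\<dots> = (\<Sum>k\<in>S. entry a i k * (\<Sum>m\<in>T. entry b k m * entry c m j))"
      by (simp add: sum_distrib_left sum_distrib_right mult.assoc) (rule sum.swap)
    also have "\<dots> = (\<Sum>k\<in>S. entry a i k * entry (b * c) k j)"
      by (intro sum.cong refl arg_cong2[of _ _ _ _ "(*)"] entry_times[symmetric] fT) (auto simp: T_def)
    also have "\<dots> = entry (a * (b * c)) i j"
      using entry_times[OF fS, of a i "b * c" j] by (simp add: S_def)
    finally show "entry (a * b * c) i j = entry (a * (b * c)) i j" .
  qed
  show "1 * a = a"
  proof (rule entry_inject[THEN iffD1], intro ext)
    fix i j show "entry (1 * a) i j = entry a i j"
      using entry_times[of "{i}" 1 i a j] by (auto simp: one_rfm.rep_eq)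
  qed
  show "a * 1 = a"
  proof (rule entry_inject[THEN iffD1], intro ext)
    fix i j
    show "entry (a * 1) i j = entry a i j"
      by (subst entry_times[of "insert j {k. entry a i k \<noteq> 0}" a i 1 j], auto simp: one_rfm.rep_eq finite_row if_distrib[of "\<lambda>x. _ * x"] sum.delta cong: if_cong)
  qed
  show "(a + b) * c = a * c + b * c"
  proof (rule entry_inject[THEN iffD1], intro ext)
    fix i j
    let ?S = "{k. entry a i k \<noteq> 0} \<union> {k. entry b i k \<noteq> 0}"
    have sup: "{k. entry (a + b) i k \<noteq> 0} \<subseteq> ?S" by (auto simp: plus_rfm.rep_eq)
    have "finite ?S" by (simp add: finite_row)
    then show "entry ((a + b) * c) i j = entry (a * c + b * c) i j"
      using entry_times[of ?S a i c j] entry_times[of ?S b i c j] entry_times[of ?S "a + b" i c j, OF _ sup]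
      by (auto simp: plus_rfm.rep_eq sum.distrib distrib_right)
  qed
  show "a * (b + c) = a * b + a * c"
    by (rule entry_inject[THEN iffD1], intro ext)
      (simp add: times_rfm.rep_eq plus_rfm.rep_eq sum.distrib distrib_left)
  show "(0::'a rfm) \<noteq> 1"
    by (metis one_neq_zero one_rfm.rep_eq zero_rfm.rep_eq)
qed (simp_all add: minus_rfm_def entry_inject[symmetric] plus_rfm.rep_eq zero_rfm.rep_eq
      uminus_rfm.rep_eq fun_eq_iff add.assoc add.commute)

end

lemma rfm_scalar_simps:
  "rfm_scalar 1 = 1" "rfm_scalar (a + b) = rfm_scalar a + rfm_scalar b"
  by (transfer; auto simp: fun_eq_iff)+

lemma entry_scalar_times: "entry (rfm_scalar k * x) i j = k * entry x i j"
  by (subst entry_times[of "{i}"]) (auto simp: rfm_scalar.rep_eq)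

lemma rfm_scalar_mult: "rfm_scalar (a * b) = rfm_scalar a * rfm_scalar b"
  by (rule entry_inject[THEN iffD1], intro ext) (simp add: entry_scalar_times rfm_scalar.rep_eq)

lemma rfm_scalar_commute: "rfm_scalar k * x = x * rfm_scalar k"
proof (rule entry_inject[THEN iffD1], intro ext)
  fix i j
  show "entry (rfm_scalar k * x) i j = entry (x * rfm_scalar k) i j"
    unfolding entry_scalar_times
    by (subst entry_times[of "insert j {m. entry x i m \<noteq> 0}" x i "rfm_scalar k" j], auto simp: rfm_scalar.rep_eq finite_row if_distrib[of "\<lambda>x. _ * x"] sum.delta mult.commute cong: if_cong)
qed

text \<open>Copies of \<open>M\<close> fill the whole diagonal, because a single block would send
  the identity matrix to an idempotent different from \<open>1\<close>.\<close>

definition block_rfm :: "nat \<Rightarrow> 'k::field mat \<Rightarrow> 'k rfm" where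
  "block_rfm n M = Rfm (\<lambda>i j. if i div n = j div n then M $$ (i mod n, j mod n) else 0)"

lemma div_eq_set: "n > 0 \<Longrightarrow> {j. i div n = j div n} = (\<lambda>k. (i div n) * n + k) ` {..<n}" for n i :: nat
proof (intro equalityI subsetI)
  fix j assume "n > 0" "j \<in> {j. i div n = j div n}"
  then have "j = (i div n) * n + j mod n" by (metis div_mult_mod_eq mem_Collect_eq)
  then show "j \<in> (\<lambda>k. (i div n) * n + k) ` {..<n}" using \<open>n > 0\<close> by (metis imageI lessThan_iff mod_less_divisor)
qed auto

lemma entry_block:
  assumes "n > 0"
  shows "entry (block_rfm n M) i j = (if i div n = j div n then M $$ (i mod n, j mod n) else 0)"
proof -
  have "finite {j. (if i div n = j div n then M $$ (i mod n, j mod n) else 0) \<noteq> 0}" for i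
    by (rule finite_subset[of _ "{j. i div n = j div n}"]) (auto split: if_splits, simp add: div_eq_set[OF assms])
  then show ?thesis by (simp add: block_rfm_def Rfm_inverse)
qed

lemma block_rfm_hom:
  assumes n: "n > 0" and A: "A \<in> carrier_mat n n" and B: "B \<in> carrier_mat n n"
  shows "block_rfm n (A + B) = block_rfm n A + block_rfm n B"
    "block_rfm n (A * B) = block_rfm n A * block_rfm n B"
    "block_rfm n (1\<^sub>m n) = (1 :: 'k::field rfm)"
    "block_rfm n (k \<cdot>\<^sub>m A) = rfm_scalar k * block_rfm n A"
    "block_rfm n A = block_rfm n B \<Longrightarrow> A = B"
proof -
  have lt: "i mod n < n" for i using n by simp
  show "block_rfm n (A + B) = block_rfm n A + block_rfm n B"
    using A B lt by (intro entry_inject[THEN iffD1] ext) (auto simp: entry_block[OF n] plus_rfm.rep_eq)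
  show "block_rfm n (1\<^sub>m n) = (1 :: 'k rfm)"
    using lt by (intro entry_inject[THEN iffD1] ext)
      (auto simp: entry_block[OF n] one_rfm.rep_eq, metis div_mult_mod_eq)
  show "block_rfm n (k \<cdot>\<^sub>m A) = rfm_scalar k * block_rfm n A"
    using A lt by (intro entry_inject[THEN iffD1] ext) (auto simp: entry_block[OF n] entry_scalar_times)
  show "block_rfm n (A * B) = block_rfm n A * block_rfm n B"
  proof (rule entry_inject[THEN iffD1], intro ext)
    fix i j
    have "entry (block_rfm n A * block_rfm n B) i j
      = (\<Sum>k\<in>{k. i div n = k div n}. entry (block_rfm n A) i k * entry (block_rfm n B) k j)"
      by (rule entry_times) (simp add: div_eq_set[OF n], auto simp: entry_block[OF n] split: if_splits)
    also have "\<dots> = (\<Sum>k<n. entry (block_rfm n A) i ((i div n) * n + k) * entry (block_rfm n B) ((i div n) * n + k) j)"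
      unfolding div_eq_set[OF n] by (subst sum.reindex) (auto simp: inj_on_def)
    also have "\<dots> = entry (block_rfm n (A * B)) i j"
      using A B lt by (auto simp: entry_block[OF n] scalar_prod_def lessThan_atLeast0)
    finally show "entry (block_rfm n (A * B)) i j = entry (block_rfm n A * block_rfm n B) i j" ..
  qed
  show "A = B" if e: "block_rfm n A = block_rfm n B"
  proof (rule eq_matI)
    fix i j assume "i < dim_row B" "j < dim_col B"
    then show "A $$ (i, j) = B $$ (i, j)"
      using arg_cong[OF e, of "\<lambda>f. entry f i j"] B by (auto simp: entry_block[OF n])
  qed (use A B in auto)
qed

section \<open>The structure of quaternion algebras\<close>

text \<open>Scalars commute with the whole ambient ring and not only with \<open>S\<close>, so that
  moving them around needs no membership conditions. Negatives in \<open>S\<close> come from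
  multiplication by the scalar \<open>- 1\<close>.\<close>

locale central_subalgebra =
  fixes S :: "'a::ring_1 set" and \<iota> :: "'k::field \<Rightarrow> 'a"
  assumes \<iota>_add: "\<iota> (a + b) = \<iota> a + \<iota> b"
    and \<iota>_mult: "\<iota> (a * b) = \<iota> a * \<iota> b"
    and \<iota>_one: "\<iota> 1 = 1"
    and \<iota>_commute: "\<iota> a * x = x * \<iota> a"
    and \<iota>_in: "\<iota> a \<in> S"
    and S_add: "x \<in> S \<Longrightarrow> y \<in> S \<Longrightarrow> x + y \<in> S"
    and S_mult: "x \<in> S \<Longrightarrow> y \<in> S \<Longrightarrow> x * y \<in> S"
    and two_neq_0: "(2::'k) \<noteq> 0"
begin

lemma \<iota>_0: "\<iota> 0 = 0" using \<iota>_add[of 0 0] by simp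
lemma \<iota>_minus: "\<iota> (- a) = - \<iota> a" using \<iota>_add[of a "- a"] by (simp add: \<iota>_0 eq_neg_iff_add_eq_0 add.commute)
lemma \<iota>_diff: "\<iota> (a - b) = \<iota> a - \<iota> b" using \<iota>_add[of a "- b"] by (simp add: \<iota>_minus)
lemma \<iota>_cancel: "a \<noteq> 0 \<Longrightarrow> \<iota> (inverse a) * (\<iota> a * x) = x"
  by (simp add: mult.assoc[symmetric] \<iota>_mult[symmetric] \<iota>_one)
lemma \<iota>_eq_0: "\<iota> a = 0 \<longleftrightarrow> a = 0"
  by (metis \<iota>_0 \<iota>_cancel mult_zero_left mult_zero_right zero_neq_one)
lemma \<iota>_inj: "\<iota> a = \<iota> b \<longleftrightarrow> a = b"
  using \<iota>_eq_0[of "a - b"] by (simp add: \<iota>_diff)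
lemma \<iota>_scale_0: "\<iota> a * x = 0 \<longleftrightarrow> a = 0 \<or> x = 0"
  by (metis \<iota>_0 \<iota>_cancel mult_zero_left mult_zero_right)
lemma \<iota>_left_commute: "x * (\<iota> a * y) = \<iota> a * (x * y)"
  by (simp add: \<iota>_commute[of a x] mult.assoc[symmetric])
lemma \<iota>_mult_left: "\<iota> (a * b) * x = \<iota> a * (\<iota> b * x)"
  by (simp add: \<iota>_mult mult.assoc)
lemma S_minus: "x \<in> S \<Longrightarrow> - x \<in> S"
  using S_mult[OF \<iota>_in[of "- 1"], of x] by (simp add: \<iota>_minus \<iota>_one)
lemma S_diff: "x \<in> S \<Longrightarrow> y \<in> S \<Longrightarrow> x - y \<in> S"
  using S_add[OF _ S_minus, of x y] by simp
lemma S_01: "0 \<in> S" "1 \<in> S" using \<iota>_in[of 0] \<iota>_in[of 1] by (simp_all add: \<iota>_0 \<iota>_one)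
lemmas S_closed = S_add S_mult S_minus S_diff S_01 \<iota>_in
lemma half: "a / 2 + a / 2 = (a :: 'k)" using two_neq_0 by (simp add: field_simps)
lemma two_\<iota>: "x + x = 0 \<Longrightarrow> x = (0::'a)"
  using \<iota>_scale_0[of 2 x] \<iota>_add[of 1 1] two_neq_0 by (simp add: \<iota>_one mult_2)

end

text \<open>\<open>s\<close> is constrained on \<open>S\<close> alone, which is all that can be said
  after transport along an embedding. That \<open>\<tau>\<close> is an involution of the field is
  derived from \<open>s\<close> and from injectivity of \<open>\<iota>\<close>.\<close>

locale involutive_subalgebra = central_subalgebra S \<iota>
  for S :: "'a::ring_1 set" and \<iota> :: "'k::field \<Rightarrow> 'a" +
  fixes s :: "'a \<Rightarrow> 'a" and \<tau> :: "'k \<Rightarrow> 'k"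
  assumes s_in: "x \<in> S \<Longrightarrow> s x \<in> S"
    and s_add: "x \<in> S \<Longrightarrow> y \<in> S \<Longrightarrow> s (x + y) = s x + s y"
    and s_mult: "x \<in> S \<Longrightarrow> y \<in> S \<Longrightarrow> s (x * y) = s y * s x"
    and s_s: "x \<in> S \<Longrightarrow> s (s x) = x"
    and s_\<iota>: "s (\<iota> k) = \<iota> (\<tau> k)"
begin

lemma s_0: "s 0 = 0" using s_add[of 0 0] S_01 by simp
lemma s_minus: "x \<in> S \<Longrightarrow> s (- x) = - s x"
  using s_add[of x "- x"] S_minus[of x] s_0 by (simp add: eq_neg_iff_add_eq_0 add.commute)
lemma s_diff: "x \<in> S \<Longrightarrow> y \<in> S \<Longrightarrow> s (x - y) = s x - s y"
  using s_add[of x "- y"] by (simp add: S_minus s_minus)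

lemma s_1: "s 1 = 1"
proof -
  have "s 1 * s (s 1) = s (s 1)" using s_mult[of "s 1" 1] S_01 s_in by simp
  then show ?thesis using s_s[of 1] S_01 by simp
qed

lemma \<tau>_simps: "\<tau> (a + b) = \<tau> a + \<tau> b" "\<tau> (a * b) = \<tau> a * \<tau> b" "\<tau> (\<tau> a) = a" "\<tau> 1 = 1" "\<tau> 0 = 0"
  "\<tau> (- a) = - \<tau> a" "\<tau> (a - b) = \<tau> a - \<tau> b"
proof -
  show add: "\<tau> (a + b) = \<tau> a + \<tau> b" for a b
    using s_add[of "\<iota> a" "\<iota> b"] \<iota>_in by (simp only: s_\<iota> \<iota>_add[symmetric] \<iota>_inj)
  show "\<tau> (a * b) = \<tau> a * \<tau> b"
    using s_mult[of "\<iota> a" "\<iota> b"] \<iota>_in by (simp only: s_\<iota> \<iota>_mult[symmetric] \<iota>_inj mult.commute)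
  show "\<tau> (\<tau> a) = a" using s_s[of "\<iota> a"] \<iota>_in by (simp only: s_\<iota> \<iota>_inj)
  show "\<tau> 1 = 1" using s_1 by (metis s_\<iota> \<iota>_inj \<iota>_one)
  show z: "\<tau> 0 = 0" using add[of 0 0] by (metis add.right_neutral add_left_cancel)
  show m: "\<tau> (- a) = - \<tau> a" for a using add[of a "- a"] z by (simp add: eq_neg_iff_add_eq_0 add.commute)
  show "\<tau> (a - b) = \<tau> a - \<tau> b" using add[of a "- b"] m by simp
qed

lemma \<tau>_inverse: "\<tau> (inverse a) = inverse (\<tau> a)"
proof (cases "a = 0")
  case False
  then have "\<tau> a * \<tau> (inverse a) = 1" using \<tau>_simps(2)[of a "inverse a"] \<tau>_simps(4) by simp
  then show ?thesis by (metis inverse_unique)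
qed (simp add: \<tau>_simps)

lemma \<tau>_sum: "\<tau> (sum f A) = (\<Sum>x\<in>A. \<tau> (f x))"
  by (induction A rule: infinite_finite_induct) (simp_all add: \<tau>_simps)

lemma \<iota>_sum: "\<iota> (sum f A) = (\<Sum>x\<in>A. \<iota> (f x))"
  by (induction A rule: infinite_finite_induct) (simp_all add: \<iota>_0 \<iota>_add)

lemma S_sum: "(\<And>x. x \<in> A \<Longrightarrow> f x \<in> S) \<Longrightarrow> sum f A \<in> S"
  by (induction A rule: infinite_finite_induct) (simp_all add: S_01 S_add)

lemma s_sum: "(\<And>x. x \<in> A \<Longrightarrow> f x \<in> S) \<Longrightarrow> s (sum f A) = (\<Sum>x\<in>A. s (f x))"
  by (induction A rule: infinite_finite_induct) (simp_all add: s_0 s_add S_sum)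

lemma s_scale: "y \<in> S \<Longrightarrow> s (\<iota> k * y) = \<iota> (\<tau> k) * s y"
  using s_mult[of "\<iota> k" y] \<iota>_in s_\<iota> \<iota>_commute by simp

definition fixed :: "'k set" where "fixed = {k. \<tau> k = k}"

lemma subfield_fixed: "subfield_set fixed"
  by (auto simp: subfield_set_def fixed_def \<tau>_simps \<tau>_inverse)

lemma norm_fixed: "\<tau> a * a \<in> fixed" by (simp add: fixed_def \<tau>_simps mult.commute)

end

text \<open>The hypotheses on \<open>S\<close> say that it is a central simple algebra of dimension four, with \<open>dim\<close>
  and \<open>dim_ex\<close> expressing the dimension by means of families of four elements.\<close>

locale quaternion_subalgebra = central_subalgebra +
  assumes centre: "z \<in> S \<Longrightarrow> (\<And>x. x \<in> S \<Longrightarrow> z * x = x * z) \<Longrightarrow> z \<in> range \<iota>"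
    and simple: "I \<subseteq> S \<Longrightarrow> (\<And>x y. x \<in> I \<Longrightarrow> y \<in> I \<Longrightarrow> x + y \<in> I) \<Longrightarrow>
      (\<And>x y. x \<in> S \<Longrightarrow> y \<in> I \<Longrightarrow> x * y \<in> I) \<Longrightarrow>
      (\<And>x y. x \<in> S \<Longrightarrow> y \<in> I \<Longrightarrow> y * x \<in> I) \<Longrightarrow> z \<in> I \<Longrightarrow> z \<noteq> 0 \<Longrightarrow> 1 \<in> I"
    and dim: "x1 \<in> S \<Longrightarrow> x2 \<in> S \<Longrightarrow> x3 \<in> S \<Longrightarrow> x4 \<in> S \<Longrightarrow>
      (\<And>a b c d. \<iota> a * x1 + \<iota> b * x2 + \<iota> c * x3 + \<iota> d * x4 = 0 \<Longrightarrow> a = 0 \<and> b = 0 \<and> c = 0 \<and> d = 0) \<Longrightarrow>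
      y \<in> S \<Longrightarrow> \<exists>a b c d. y = \<iota> a * x1 + \<iota> b * x2 + \<iota> c * x3 + \<iota> d * x4"
    and dim_ex: "\<exists>x\<in>S. x \<notin> range \<iota>"
begin

section \<open>Every element is quadratic over the centre\<close>

text \<open>The span of \<open>1, x, x x\<close>. It is used for a hypothetical \<open>x\<close>
  without quadratic equation, where it has dimension three and thus codimension one in
  \<open>S\<close>.\<close>

definition C :: "'a \<Rightarrow> 'a set" where
  "C x = {\<iota> a + \<iota> b * x + \<iota> c * (x * x) | a b c. True}"

lemma CI: "y = \<iota> a + \<iota> b * x + \<iota> c * (x * x) \<Longrightarrow> y \<in> C x"
  unfolding C_def by blast

lemma C_commute: "y \<in> C x \<Longrightarrow> y * x = x * y"
  unfolding C_def by (auto simp: algebra_simps \<iota>_left_commute \<iota>_commute)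

text \<open>Such elements do not exist; the predicate carries the proof by contradiction that ends
  in \<open>ex_quad\<close>.\<close>

definition nonquad :: "'a \<Rightarrow> bool" where
  "nonquad x \<longleftrightarrow> x \<in> S \<and> \<not> (\<exists>p q. x * x = \<iota> p * x + \<iota> q)"

text \<open>A relation with \<open>c \<noteq> 0\<close> is a quadratic equation for
  \<open>x\<close>. One with \<open>c = 0\<close> and \<open>b \<noteq> 0\<close> makes
  \<open>x\<close> a scalar, and scalars satisfy quadratic equations too.\<close>

lemma nonquad_indep:
  assumes "nonquad x" and e: "\<iota> a + \<iota> b * x + \<iota> c * (x * x) = 0"
  shows "a = 0 \<and> b = 0 \<and> c = 0"
proof -
  have c: "c = 0"
  proof (rule ccontr)
    assume c: "c \<noteq> 0"
    have "\<iota> c * (x * x) = - \<iota> a - \<iota> b * x" using e by (simp add: algebra_simps eq_neg_iff_add_eq_0)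
    then have "\<iota> (inverse c) * (\<iota> c * (x * x)) = \<iota> (- (inverse c * b)) * x + \<iota> (- (inverse c * a))"
      by (simp add: \<iota>_minus \<iota>_mult right_diff_distrib mult.assoc)
    then show False using assms(1) unfolding nonquad_def \<iota>_cancel[OF c] by blast
  qed
  have b: "b = 0"
  proof (rule ccontr)
    assume b: "b \<noteq> 0"
    have "\<iota> b * x = - \<iota> a" using e c by (simp add: \<iota>_0 eq_neg_iff_add_eq_0 add.commute)
    then have x: "x = \<iota> (- (inverse b * a))"
      using \<iota>_cancel[OF b, of x] by (simp add: \<iota>_minus \<iota>_mult)
    have "x * x = \<iota> 0 * x + \<iota> ((- (inverse b * a)) * (- (inverse b * a)))"
      unfolding \<iota>_mult x by (simp add: \<iota>_0 \<iota>_mult \<iota>_minus)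
    then show False using assms(1) unfolding nonquad_def by blast
  qed
  show ?thesis using e b c by (simp add: \<iota>_0 \<iota>_eq_0)
qed

lemma nonquad_span:
  assumes nq: "nonquad x" and y: "y \<in> S" "y \<notin> C x" and w: "w \<in> S"
  shows "\<exists>a b c d. w = \<iota> a + \<iota> b * x + \<iota> c * (x * x) + \<iota> d * y"
proof -
  have x: "x \<in> S" using nq by (simp add: nonquad_def)
  have "\<exists>a b c d. w = \<iota> a * 1 + \<iota> b * x + \<iota> c * (x * x) + \<iota> d * y"
  proof (rule dim)
    fix a b c d assume e: "\<iota> a * 1 + \<iota> b * x + \<iota> c * (x * x) + \<iota> d * y = 0"
    have d: "d = 0"
    proof (rule ccontr)
      assume d: "d \<noteq> 0"
      have "\<iota> d * y = - \<iota> a - \<iota> b * x - \<iota> c * (x * x)"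
        using e by (simp add: algebra_simps eq_neg_iff_add_eq_0)
      then have "\<iota> (inverse d) * (\<iota> d * y) = \<iota> (- (inverse d * a)) + \<iota> (- (inverse d * b)) * x
          + \<iota> (- (inverse d * c)) * (x * x)"
        by (simp add: \<iota>_minus \<iota>_mult right_diff_distrib mult.assoc)
      then show False using y(2) unfolding \<iota>_cancel[OF d] by (blast intro: CI)
    qed
    then show "a = 0 \<and> b = 0 \<and> c = 0 \<and> d = 0" using nonquad_indep[OF nq, of a b c] e by (simp add: \<iota>_0)
  qed (use x y w S_closed in auto)
  then show ?thesis by simp
qed

text \<open>The commutator \<open>z\<close> of \<open>x\<close> and \<open>y\<close> satisfies
  \<open>x z = 0\<close> and \<open>z x = \<beta> z\<close>. Hence \<open>z\<close>,
  \<open>y z\<close>, \<open>z y\<close> and \<open>y z y\<close> span a two-sided ideal, which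
  contains \<open>1\<close> by simplicity. Left multiplication by \<open>x\<close> maps this ideal
  into the plane spanned by \<open>z\<close> and \<open>z y\<close>. So \<open>x\<close>,
  \<open>x x\<close> and, after division by \<open>\<gamma>\<close>, also \<open>1\<close> lie in
  that plane, although they are independent.\<close>

lemma nonquad_absurd:
  assumes nq: "nonquad x" and y: "y \<in> S" "y \<notin> C x" and xy: "x * y \<in> C x"
  shows False
proof -
  have x: "x \<in> S" using nq by (simp add: nonquad_def)
  note span = nonquad_span[OF nq y]
  obtain \<gamma> \<delta> \<epsilon> where xyc: "x * y = \<iota> \<gamma> + \<iota> \<delta> * x + \<iota> \<epsilon> * (x * x)" using xy unfolding C_def by blast
  obtain p q r \<beta> where yx: "y * x = \<iota> p + \<iota> q * x + \<iota> r * (x * x) + \<iota> \<beta> * y"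
    using span[of "y * x"] x y S_mult by blast
  obtain p' q' r' \<beta>' where yy: "y * y = \<iota> p' + \<iota> q' * x + \<iota> r' * (x * x) + \<iota> \<beta>' * y"
    using span[of "y * y"] y S_mult by blast
  define z where "z = x * y - y * x"
  have zS: "z \<in> S" unfolding z_def using x y S_closed by auto
  have xz: "x * z = 0"
    using C_commute[OF xy] by (simp add: z_def algebra_simps)
  have zx: "z * x = \<iota> \<beta> * z"
  proof -
    define c2 where "c2 = y * x - \<iota> \<beta> * y"
    have "c2 \<in> C x" using yx by (intro CI[of _ p q _ r]) (simp add: c2_def)
    then have "c2 * x = x * c2" by (rule C_commute)
    then show ?thesis by (simp add: c2_def z_def algebra_simps \<iota>_left_commute)
  qed
  \<comment> \<open>If \<open>z = 0\<close>, then \<open>x\<close> commutes with the spanning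
    elements \<open>1, x, x x, y\<close>, so it is central and therefore a scalar.\<close>
  have z0: "z \<noteq> 0"
  proof
    assume "z = 0"
    then have c: "x * y = y * x" by (simp add: z_def)
    have "x \<in> range \<iota>"
    proof (rule centre[OF x])
      fix w assume "w \<in> S"
      then obtain a b c' d where "w = \<iota> a + \<iota> b * x + \<iota> c' * (x * x) + \<iota> d * y" using span by blast
      then show "x * w = w * x" using c
        by (simp add: distrib_left distrib_right \<iota>_left_commute \<iota>_commute[symmetric] mult.assoc)
    qed
    then obtain k where "x = \<iota> k" by blast
    then show False using nonquad_indep[OF nq, of "- k" 1 0] by (simp add: \<iota>_0 \<iota>_one \<iota>_minus)
  qed
  have xyz: "x * (y * z) = \<iota> \<gamma> * z"
    by (simp add: mult.assoc[symmetric] xyc) (simp add: algebra_simps mult.assoc xz)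
  have yyz: "y * (y * z) = \<iota> p' * z + \<iota> \<beta>' * (y * z)"
    by (simp add: mult.assoc[symmetric] yy) (simp add: algebra_simps mult.assoc xz)
  have zxx: "z * (x * x) = \<iota> (\<beta> * \<beta>) * z"
    by (simp add: mult.assoc[symmetric] zx \<iota>_mult) (simp add: mult.assoc zx)
  have zyx: "z * (y * x) = \<iota> (p + q * \<beta> + r * (\<beta> * \<beta>)) * z + \<iota> \<beta> * (z * y)"
    by (simp add: yx distrib_left distrib_right \<iota>_left_commute[of z] zx zxx \<iota>_add \<iota>_mult_left \<iota>_commute[of _ z, symmetric])
  have zyy: "z * (y * y) = \<iota> (p' + q' * \<beta> + r' * (\<beta> * \<beta>)) * z + \<iota> \<beta>' * (z * y)"
    by (simp add: yy distrib_left distrib_right \<iota>_left_commute[of z] zx zxx \<iota>_add \<iota>_mult_left \<iota>_commute[of _ z, symmetric])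
  define I where "I = {\<iota> a * z + \<iota> b * (y * z) + \<iota> c * (z * y) + \<iota> d * (y * (z * y)) | a b c d. True}"
  have II: "w = \<iota> a * z + \<iota> b * (y * z) + \<iota> c * (z * y) + \<iota> d * (y * (z * y)) \<Longrightarrow> w \<in> I" for a b c d w
    unfolding I_def by blast
  have Iadd: "v + w \<in> I" if vw: "v \<in> I" "w \<in> I" for v w
  proof -
    obtain a b c d a' b' c' d' where
      "v = \<iota> a * z + \<iota> b * (y * z) + \<iota> c * (z * y) + \<iota> d * (y * (z * y))"
      "w = \<iota> a' * z + \<iota> b' * (y * z) + \<iota> c' * (z * y) + \<iota> d' * (y * (z * y))" using vw unfolding I_def by blast
    then show ?thesis by (intro II[of _ "a + a'" "b + b'" "c + c'" "d + d'"]) (simp add: \<iota>_add algebra_simps)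
  qed
  have Isc: "\<iota> k * v \<in> I" if "v \<in> I" for k v
  proof -
    obtain a b c d where "v = \<iota> a * z + \<iota> b * (y * z) + \<iota> c * (z * y) + \<iota> d * (y * (z * y))"
      using \<open>v \<in> I\<close> unfolding I_def by blast
    then show ?thesis by (intro II[of _ "k * a" "k * b" "k * c" "k * d"]) (simp add: \<iota>_mult_left distrib_left)
  qed
  \<comment> \<open>Of the four generators \<open>x\<close> kills \<open>z\<close> and
    \<open>z y\<close>, and it sends \<open>y z\<close> and \<open>y z y\<close> to
    \<open>\<gamma> z\<close> and \<open>\<gamma> z y\<close>.\<close>
  have xI: "\<exists>b d. x * v = \<iota> (\<gamma> * b) * z + \<iota> (\<gamma> * d) * (z * y)" if "v \<in> I" for v
  proof -
    obtain a b c d where v: "v = \<iota> a * z + \<iota> b * (y * z) + \<iota> c * (z * y) + \<iota> d * (y * (z * y))"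
      using \<open>v \<in> I\<close> unfolding I_def by blast
    have "x * (z * y) = 0" "x * (y * (z * y)) = \<iota> \<gamma> * (z * y)"
      using xz xyz by (metis mult.assoc mult_zero_left)+
    then show ?thesis using v
      by (intro exI[of _ b] exI[of _ d]) (simp add: distrib_left \<iota>_left_commute[of x] xz xyz \<iota>_mult_left mult.commute[of \<gamma>])
  qed
  have xI': "x * v \<in> I" if "v \<in> I" for v
  proof -
    obtain b d where "x * v = \<iota> (\<gamma> * b) * z + \<iota> (\<gamma> * d) * (z * y)" using xI[OF \<open>v \<in> I\<close>] by blast
    then show ?thesis by (intro II[of _ "\<gamma> * b" 0 "\<gamma> * d" 0]) (simp add: \<iota>_0)
  qed
  have yI: "y * v \<in> I" if "v \<in> I" for v
  proof -
    obtain a b c d where v: "v = \<iota> a * z + \<iota> b * (y * z) + \<iota> c * (z * y) + \<iota> d * (y * (z * y))"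
      using \<open>v \<in> I\<close> unfolding I_def by blast
    have "y * (y * (z * y)) = \<iota> p' * (z * y) + \<iota> \<beta>' * (y * (z * y))"
      using arg_cong[OF yyz, of "\<lambda>t. t * y"] by (simp add: mult.assoc distrib_right)
    then show ?thesis using v yyz
      by (intro II[of _ "b * p'" "a + b * \<beta>'" "d * p'" "c + d * \<beta>'"])
        (simp add: distrib_left distrib_right \<iota>_left_commute[of y] \<iota>_mult_left \<iota>_add mult.assoc add_ac)
  qed
  have Ix: "v * x \<in> I" if "v \<in> I" for v
  proof -
    obtain a b c d where v: "v = \<iota> a * z + \<iota> b * (y * z) + \<iota> c * (z * y) + \<iota> d * (y * (z * y))"
      using \<open>v \<in> I\<close> unfolding I_def by blast
    let ?t = "p + q * \<beta> + r * (\<beta> * \<beta>)"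
    show ?thesis using v zyx
      by (intro II[of _ "a * \<beta> + c * ?t" "b * \<beta> + d * ?t" "c * \<beta>" "d * \<beta>"])
        (simp add: distrib_left distrib_right \<iota>_left_commute[of y] \<iota>_mult_left \<iota>_add mult.assoc add_ac zx)
  qed
  have Iy: "v * y \<in> I" if "v \<in> I" for v
  proof -
    obtain a b c d where v: "v = \<iota> a * z + \<iota> b * (y * z) + \<iota> c * (z * y) + \<iota> d * (y * (z * y))"
      using \<open>v \<in> I\<close> unfolding I_def by blast
    let ?t = "p' + q' * \<beta> + r' * (\<beta> * \<beta>)"
    show ?thesis using v zyy
      by (intro II[of _ "c * ?t" "d * ?t" "a + c * \<beta>'" "b + d * \<beta>'"])
        (simp add: distrib_left distrib_right \<iota>_left_commute[of y] \<iota>_mult_left \<iota>_add mult.assoc add_ac)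
  qed
  have one: "1 \<in> I"
  proof (rule simple[of I z])
    show "I \<subseteq> S" using zS y S_closed by (auto simp: I_def)
    show "z \<in> I" by (intro II[of _ 1 0 0 0]) (simp add: \<iota>_0 \<iota>_one)
    show "w * v \<in> I" "v * w \<in> I" if "w \<in> S" "v \<in> I" for v w
    proof -
      obtain a b c d where w: "w = \<iota> a + \<iota> b * x + \<iota> c * (x * x) + \<iota> d * y" using span[OF \<open>w \<in> S\<close>] by blast
      have "w * v = \<iota> a * v + \<iota> b * (x * v) + \<iota> c * (x * (x * v)) + \<iota> d * (y * v)"
        by (simp add: w distrib_right mult.assoc)
      then show "w * v \<in> I" using that Iadd Isc xI' yI by auto
      have "v * w = \<iota> a * v + \<iota> b * (v * x) + \<iota> c * ((v * x) * x) + \<iota> d * (v * y)"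
        by (simp add: w distrib_left mult.assoc \<iota>_left_commute[of v] \<iota>_commute[of _ v, symmetric])
      then show "v * w \<in> I" using that Iadd Isc Ix Iy by auto
    qed
  qed (use Iadd z0 in auto)
  obtain b1 d1 where e1: "x = \<iota> (\<gamma> * b1) * z + \<iota> (\<gamma> * d1) * (z * y)" using xI[OF one] by auto
  have "x \<in> I" "y \<in> I" using xI'[OF one] yI[OF one] by simp_all
  then obtain b2 d2 b3 d3 where e2: "x * x = \<iota> (\<gamma> * b2) * z + \<iota> (\<gamma> * d2) * (z * y)"
    and e3: "x * y = \<iota> (\<gamma> * b3) * z + \<iota> (\<gamma> * d3) * (z * y)" using xI by blast
  have "\<gamma> \<noteq> 0"
  proof
    assume "\<gamma> = 0"
    then have "x = 0" using e1 by (simp add: \<iota>_0)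
    then show False using nonquad_indep[OF nq, of 0 1 0] by (simp add: \<iota>_0)
  qed
  \<comment> \<open>\<open>x\<close>, \<open>x x\<close> and \<open>x y\<close> are values of left
    multiplication by \<open>x\<close> on the ideal, with a factor \<open>\<gamma>\<close> in their
    coordinates. Isolating the constant term of \<open>x y\<close> and cancelling
    \<open>\<gamma>\<close> puts \<open>1\<close> into the plane.\<close>
  have "\<iota> \<gamma> = x * y - \<iota> \<delta> * x - \<iota> \<epsilon> * (x * x)" by (simp add: xyc)
  also have "\<dots> = \<iota> \<gamma> * (\<iota> (b3 - \<delta> * b1 - \<epsilon> * b2) * z + \<iota> (d3 - \<delta> * d1 - \<epsilon> * d2) * (z * y))"
    unfolding e3 e2 by (subst e1) (simp add: \<iota>_diff distrib_left right_diff_distrib left_diff_distrib \<iota>_mult_left[symmetric] mult.commute[of \<gamma>] mult.assoc)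
  finally have "1 = \<iota> (b3 - \<delta> * b1 - \<epsilon> * b2) * z + \<iota> (d3 - \<delta> * d1 - \<epsilon> * d2) * (z * y)"
    using \<iota>_cancel[OF \<open>\<gamma> \<noteq> 0\<close>] by (metis mult.right_neutral)
  then obtain m n where e0: "1 = \<iota> m * z + \<iota> n * (z * y)" by blast
  define b d b' d' where "b = \<gamma> * b1" "d = \<gamma> * d1" "b' = \<gamma> * b2" "d' = \<gamma> * d2"
  note E1 = e1[folded this] and E2 = e2[folded this]
  \<comment> \<open>Three vectors in a plane are related through the 2 by 2 minors of their
    coordinates, here \<open>(m, n)\<close>, \<open>(b, d)\<close> and \<open>(b', d')\<close> for
    \<open>1\<close>, \<open>x\<close> and \<open>x x\<close>.\<close>
  have "\<iota> (b * d' - b' * d) + \<iota> (b' * n - m * d') * x + \<iota> (m * d - b * n) * (x * x)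
     = \<iota> (b * d' - b' * d) * 1 + \<iota> (b' * n - m * d') * x + \<iota> (m * d - b * n) * (x * x)" by simp
  also have "\<dots> = \<iota> (b * d' - b' * d) * (\<iota> m * z + \<iota> n * (z * y))
     + \<iota> (b' * n - m * d') * (\<iota> b * z + \<iota> d * (z * y))
     + \<iota> (m * d - b * n) * (\<iota> b' * z + \<iota> d' * (z * y))"
    using e0 E1 E2 by metis
  also have "\<dots> = \<iota> ((b * d' - b' * d) * m + (b' * n - m * d') * b + (m * d - b * n) * b') * z
     + \<iota> ((b * d' - b' * d) * n + (b' * n - m * d') * d + (m * d - b * n) * d') * (z * y)"
    by (simp only: \<iota>_add \<iota>_mult distrib_left distrib_right mult.assoc add_ac)
  also have "\<dots> = 0" by (simp add: algebra_simps \<iota>_0)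
  finally have "m * d = b * n" using nonquad_indep[OF nq] by fastforce
  \<comment> \<open>With the minor of \<open>1\<close> and \<open>x\<close> equal to zero,
    eliminating one coordinate at a time gives relations between \<open>1\<close> and
    \<open>x\<close> alone. They force \<open>d = n = 0\<close> and then \<open>m = 0\<close>, so
    that \<open>1 = 0\<close>.\<close>
  have "\<iota> d + \<iota> (- n) * x + \<iota> 0 * (x * x) = \<iota> d * 1 + \<iota> (- n) * x" by (simp add: \<iota>_0)
  also have "\<dots> = \<iota> d * (\<iota> m * z + \<iota> n * (z * y)) + \<iota> (- n) * (\<iota> b * z + \<iota> d * (z * y))"
    using e0 E1 by metis
  also have "\<dots> = \<iota> (d * m - n * b) * z + \<iota> (d * n - n * d) * (z * y)"
    by (simp add: \<iota>_mult_left[symmetric] distrib_left \<iota>_diff left_diff_distrib \<iota>_minus mult.commute[of n d] \<iota>_0)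
  also have "\<dots> = 0" using \<open>m * d = b * n\<close> by (simp add: algebra_simps \<iota>_0)
  finally have dn: "d = 0" "n = 0" using nonquad_indep[OF nq, of d "- n" 0] by auto
  have "\<iota> b + \<iota> (- m) * x + \<iota> 0 * (x * x) = \<iota> b * 1 + \<iota> (- m) * x" by (simp add: \<iota>_0)
  also have "\<dots> = \<iota> b * (\<iota> m * z + \<iota> n * (z * y)) + \<iota> (- m) * (\<iota> b * z + \<iota> d * (z * y))"
    using e0 E1 by metis
  also have "\<dots> = \<iota> (b * m - m * b) * z" unfolding dn \<iota>_0
    by (simp add: \<iota>_mult_left[symmetric] distrib_left \<iota>_diff left_diff_distrib \<iota>_minus \<iota>_0 mult.commute[of m b])
  also have "\<dots> = 0" by (simp add: algebra_simps \<iota>_0)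
  finally have "m = 0" using nonquad_indep[OF nq, of b "- m" 0] by auto
  then show False using e0 dn by (simp add: \<iota>_0)
qed

lemma C_shift:
  assumes "v \<in> C (x + \<iota> d)" shows "v \<in> C x"
proof -
  obtain e f g where v: "v = \<iota> e + \<iota> f * (x + \<iota> d) + \<iota> g * ((x + \<iota> d) * (x + \<iota> d))"
    using assms unfolding C_def by blast
  show ?thesis unfolding v
    by (intro CI[of _ "e + f * d + g * (d * d)" "f + g * d + g * d" _ g])
      (simp only: distrib_left distrib_right \<iota>_add \<iota>_mult \<iota>_commute[of d x, symmetric] mult.assoc add_ac)
qed

text \<open>A nonquadratic \<open>x\<close> is not central, and any \<open>y\<close> not commuting
  with it lies outside \<open>C x\<close>. In \<open>x y\<close> the coefficient \<open>d\<close> of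
  \<open>y\<close> is removed by replacing \<open>x\<close> with \<open>x - d\<close>; this shift
  changes neither \<open>C x\<close> nor the absence of a quadratic equation, and
  \<open>nonquad_absurd\<close> applies.\<close>

lemma ex_quad:
  assumes x: "x \<in> S"
  obtains p q where "x * x = \<iota> p * x + \<iota> q"
proof (rule ccontr)
  assume "\<not> thesis"
  then have nq: "nonquad x" using x that by (auto simp: nonquad_def)
  have key: "\<exists>y\<in>S. y \<notin> C x \<and> \<not> y * x = x * y"
  proof (rule ccontr)
    assume "\<not> ?thesis"
    then have "x \<in> range \<iota>" using C_commute by (intro centre[OF x]) metis
    then obtain k where "x = \<iota> k" by blast
    then show False using nonquad_indep[OF nq, of "- k" 1 0] by (simp add: \<iota>_0 \<iota>_one \<iota>_minus)
  qed
  then obtain y where y: "y \<in> S" "y \<notin> C x" "y * x \<noteq> x * y" by blast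
  obtain a b c d where xy: "x * y = \<iota> a + \<iota> b * x + \<iota> c * (x * x) + \<iota> d * y"
    using nonquad_span[OF nq y(1,2), of "x * y"] x y S_mult by blast
  define x' where "x' = x - \<iota> d"
  have "v \<in> C x'" if "v \<in> C x" for v
    using that C_shift[of v x' d] by (simp add: x'_def)
  note C' = this
  have C'': "v \<in> C x" if "v \<in> C x'" for v
    using that C_shift[of v x "- d"] by (simp add: x'_def \<iota>_minus)
  have "nonquad x'"
  proof -
    have "\<nexists>p q. x' * x' = \<iota> p * x' + \<iota> q"
    proof
      assume "\<exists>p q. x' * x' = \<iota> p * x' + \<iota> q"
      then obtain p q where "x' * x' = \<iota> p * x' + \<iota> q" by blast
      then have "x * x = \<iota> (p + d + d) * x + \<iota> (q - p * d - d * d)"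
        by (simp only: x'_def right_diff_distrib left_diff_distrib \<iota>_diff \<iota>_add \<iota>_mult
          distrib_right \<iota>_commute[of d x, symmetric] mult.assoc) (simp add: algebra_simps)
      then show False using nq unfolding nonquad_def by blast
    qed
    then show ?thesis using x S_closed by (auto simp: nonquad_def x'_def)
  qed
  moreover have "y \<notin> C x'" using C'' y by blast
  moreover have "x' * y \<in> C x'"
    by (rule C', rule CI[of _ a b _ c]) (simp add: x'_def left_diff_distrib xy)
  ultimately show False using nonquad_absurd y by blast
qed

section \<open>Pure quaternions and their anticommutators\<close>

text \<open>The quaternions of trace zero, described without a trace. The last clause excludes
  nonzero scalars, whose squares are scalars as well.\<close>

definition pure :: "'a \<Rightarrow> bool" where
  "pure x \<longleftrightarrow> x \<in> S \<and> x * x \<in> range \<iota> \<and> (x \<in> range \<iota> \<longrightarrow> x = 0)"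

lemma pure_0: "pure 0" using \<iota>_0 S_closed by (auto simp: pure_def intro!: range_eqI[of _ _ 0])

text \<open>Completing the square in \<open>x x = p x + q\<close>, which uses characteristic
  different from two. If the remainder is a scalar it is absorbed into \<open>k\<close>.\<close>

lemma pure_decomp:
  assumes x: "x \<in> S"
  obtains k x0 where "x = \<iota> k + x0" "pure x0"
proof -
  obtain p q where pq: "x * x = \<iota> p * x + \<iota> q" using ex_quad[OF x] by blast
  define h where "h = p / 2"
  define x0 where "x0 = x - \<iota> h"
  have "\<iota> p * x = \<iota> h * x + \<iota> h * x" by (metis h_def half \<iota>_add distrib_right)
  then have sq: "x0 * x0 = \<iota> (q + h * h)"
    unfolding x0_def
    by (simp add: right_diff_distrib left_diff_distrib \<iota>_add \<iota>_mult \<iota>_commute[of h x, symmetric] pq)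
  show thesis
  proof (cases "x0 \<in> range \<iota>")
    case True
    then obtain k where "x0 = \<iota> k" by blast
    then have "x = \<iota> (h + k) + 0" by (simp add: \<iota>_add x0_def algebra_simps)
    then show ?thesis using that pure_0 by blast
  next
    case False
    then have "pure x0" using sq x S_closed by (auto simp: pure_def x0_def)
    moreover have "x = \<iota> h + x0" by (simp add: x0_def)
    ultimately show ?thesis using that by blast
  qed
qed

lemma pure_scale: "pure x \<Longrightarrow> pure (\<iota> k * x)"
proof -
  assume p: "pure x"
  then obtain m where m: "x * x = \<iota> m" by (auto simp: pure_def)
  have "(\<iota> k * x) * (\<iota> k * x) = \<iota> (k * k * m)"
    by (simp add: \<iota>_mult m \<iota>_left_commute[of x] mult.assoc)
  moreover have "\<iota> k * x = 0" if "\<iota> k * x \<in> range \<iota>"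
  proof (cases "k = 0")
    case False
    obtain n where "\<iota> k * x = \<iota> n" using \<open>\<iota> k * x \<in> range \<iota>\<close> by blast
    then have "x = \<iota> (inverse k * n)" using \<iota>_cancel[OF False, of x] by (simp add: \<iota>_mult)
    then show ?thesis using p by (auto simp: pure_def)
  qed (simp add: \<iota>_0)
  ultimately show ?thesis using p S_closed by (auto simp: pure_def)
qed

text \<open>Up to known scalars, \<open>x y + y x\<close> is the square of \<open>x + y\<close> and
  also the negative of the square of \<open>x - y\<close>; by \<open>ex_quad\<close> both squares
  are linear in their arguments. If \<open>y\<close> is no combination of \<open>x\<close> and
  \<open>1\<close>, comparison kills the linear terms. In the remaining case purity forces
  \<open>y\<close> to be a multiple of \<open>x\<close>.\<close>

lemma pure_anticommutator:
  assumes x: "pure x" and y: "pure y"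
  obtains k where "x * y + y * x = \<iota> k"
proof -
  obtain m n where m: "x * x = \<iota> m" and n: "y * y = \<iota> n" using x y by (auto simp: pure_def)
  have S: "x \<in> S" "y \<in> S" using x y by (auto simp: pure_def)
  show thesis
  proof (cases "\<exists>a b. y = \<iota> a * x + \<iota> b")
    case True
    then obtain a b where ab: "y = \<iota> a * x + \<iota> b" by blast
    have yy: "y * y = \<iota> (a * a * m + b * b) + \<iota> (2 * a * b) * x"
    proof -
      have "y * y = \<iota> a * (\<iota> a * (x * x)) + \<iota> b * \<iota> b + (\<iota> a * (\<iota> b * x) + \<iota> b * (\<iota> a * x))"
        unfolding ab by (simp only: distrib_left distrib_right mult.assoc \<iota>_left_commute[of x] \<iota>_commute[of _ x, symmetric] add_ac)
      also have "\<dots> = \<iota> (a * a * m + b * b + 0) + \<iota> (a * b + b * a) * x"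
        by (simp only: m \<iota>_add \<iota>_mult distrib_right mult.assoc \<iota>_0 add_0_right)
      also have "a * b + b * a = 2 * a * b" by simp
      finally show ?thesis by simp
    qed
    show thesis
    proof (cases "x = 0 \<or> a = 0")
      case True
      then have "y = \<iota> b" using ab by (auto simp: \<iota>_0)
      then have "y = 0" using y by (auto simp: pure_def)
      then show thesis using that[of 0] by (simp add: \<iota>_0)
    next
      case False
      have "b = 0"
      proof (rule ccontr)
        assume "b \<noteq> 0"
        then have nz: "2 * a * b \<noteq> 0" using False two_neq_0 by simp
        have "\<iota> (2 * a * b) * x = \<iota> (n - (a * a * m + b * b))" using yy n by (simp add: \<iota>_diff)
        then have "\<iota> (2 * a * b) * x \<in> range \<iota>" by blast
        then have "\<iota> (2 * a * b) * x = 0" using pure_scale[OF x] by (auto simp: pure_def)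
        then show False using nz False unfolding \<iota>_scale_0 by blast
      qed
      then have "x * y + y * x = \<iota> a * \<iota> m + \<iota> a * \<iota> m"
        by (simp add: ab \<iota>_0 \<iota>_left_commute[of x] mult.assoc m)
      then have "x * y + y * x = \<iota> (a * m + a * m)" by (simp only: \<iota>_add \<iota>_mult)
      then show thesis using that by blast
    qed
  next
    case False
    define s where "s = x * y + y * x"
    obtain p q where p: "(x + y) * (x + y) = \<iota> p * (x + y) + \<iota> q" using ex_quad[OF S_add[OF S]] .
    obtain p' q' where p': "(x - y) * (x - y) = \<iota> p' * (x - y) + \<iota> q'" using ex_quad[OF S_diff[OF S]] .
    have "s = (x + y) * (x + y) - x * x - y * y" by (simp add: s_def distrib_left distrib_right)
    then have s1: "s = \<iota> p * x + \<iota> p * y + \<iota> (q - m - n)"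
      unfolding p m n by (simp add: \<iota>_diff distrib_left)
    have "- s = (x - y) * (x - y) - x * x - y * y"
      by (simp add: s_def right_diff_distrib left_diff_distrib)
    then have s2: "- s = \<iota> p' * x - \<iota> p' * y + \<iota> (q' - m - n)"
      unfolding p' m n by (simp add: \<iota>_diff right_diff_distrib)
    define r r' where "r = q - m - n" and "r' = q' - m - n"
    note s1 = s1[folded r_def] and s2 = s2[folded r'_def]
    \<comment> \<open>The sum of the two expressions for \<open>s\<close> and \<open>- s\<close>,
      solved for \<open>y\<close>. Since \<open>y\<close> is independent of \<open>x\<close> and
      \<open>1\<close>, its coefficient \<open>p - p'\<close> vanishes.\<close>
    have e: "\<iota> (p - p') * y = \<iota> (- (p + p')) * x + \<iota> (- (r + r'))"
    proof -
      have "\<iota> (p - p') * y - (\<iota> (- (p + p')) * x + \<iota> (- (r + r')))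
        = (\<iota> p * x + \<iota> p * y + \<iota> r) + (\<iota> p' * x - \<iota> p' * y + \<iota> r')"
        by (simp add: \<iota>_add \<iota>_diff \<iota>_minus left_diff_distrib distrib_right)
      also have "\<dots> = 0" using s1 s2 by (metis right_minus)
      finally show ?thesis by simp
    qed
    have pp: "p = p'"
    proof (rule ccontr)
      assume "p \<noteq> p'"
      then have nz: "p - p' \<noteq> 0" by simp
      have "y = \<iota> (inverse (p - p') * (- (p + p'))) * x + \<iota> (inverse (p - p') * (- (r + r')))"
        using \<iota>_cancel[OF nz, of y] unfolding e by (simp only: \<iota>_mult distrib_left mult.assoc)
      then show False using False by blast
    qed
    have "\<iota> (p + p) * x = \<iota> (- (r + r'))"
      using e unfolding pp by (simp add: \<iota>_0 \<iota>_minus)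
    then have px: "\<iota> (p + p) * x = 0" using pure_scale[OF x, of "p + p"] by (auto simp: pure_def)
    show thesis
    proof (cases "x = 0")
      case True
      then show thesis using that[of 0] by (simp add: \<iota>_0)
    next
      case x0: False
      have "p + p = 0" using px x0 unfolding \<iota>_scale_0 by blast
      then have "2 * p = 0" by (simp only: mult_2)
      then have "p = 0" using two_neq_0 by simp
      then show thesis using s1 that unfolding s_def by (simp add: \<iota>_0)
    qed
  qed
qed

end

context quaternion_subalgebra
begin

text \<open>The anticommutator is a scalar, hence so is the square of the sum. If the sum is a
  scalar \<open>j\<close>, squaring \<open>y = j - x\<close> shows that \<open>2 j x\<close> is a
  scalar, so \<open>j = 0\<close> or \<open>x = 0\<close>.\<close>

lemma pure_add:
  assumes x: "pure x" and y: "pure y"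
  shows "pure (x + y)"
proof -
  obtain m n where m: "x * x = \<iota> m" and n: "y * y = \<iota> n" using x y by (auto simp: pure_def)
  obtain k where k: "x * y + y * x = \<iota> k" using pure_anticommutator[OF x y] .
  have "(x + y) * (x + y) = \<iota> m + (x * y + y * x) + \<iota> n"
    by (simp add: distrib_left distrib_right m n add_ac)
  then have sq: "(x + y) * (x + y) = \<iota> (m + k + n)" unfolding k by (simp add: \<iota>_add)
  have "x + y = 0" if "x + y \<in> range \<iota>"
  proof -
    obtain j where j: "x + y = \<iota> j" using \<open>x + y \<in> range \<iota>\<close> by blast
    then have yj: "y = \<iota> j - x" by (simp add: algebra_simps)
    have "\<iota> n = \<iota> j * \<iota> j - \<iota> j * x - \<iota> j * x + \<iota> m"
      unfolding n[symmetric] m[symmetric] yj by (simp add: algebra_simps \<iota>_commute[of j x, symmetric])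
    then have "\<iota> (j + j) * x = \<iota> (j * j + m - n)"
      by (simp only: \<iota>_add \<iota>_diff \<iota>_mult distrib_right) (simp add: algebra_simps)
    then have "\<iota> (j + j) * x = 0" using pure_scale[OF x, of "j + j"] by (auto simp: pure_def)
    then consider "j + j = 0" | "x = 0" unfolding \<iota>_scale_0 by blast
    then show ?thesis
    proof cases
      case 1
      then have "2 * j = 0" by (simp only: mult_2)
      then show ?thesis using j two_neq_0 by (simp add: \<iota>_0)
    next
      case 2
      then show ?thesis using y j by (auto simp: pure_def)
    qed
  qed
  then show ?thesis using sq x y S_closed by (auto simp: pure_def)
qed

lemma pure_square: "pure x \<Longrightarrow> \<exists>m. x * x = \<iota> m" by (auto simp: pure_def)
lemma pure_in: "pure x \<Longrightarrow> x \<in> S" by (simp add: pure_def)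

text \<open>If \<open>x\<close> anticommutes with all pure elements, then in particular
  \<open>x x = 0\<close>, and the left ideal \<open>S x\<close> is two-sided because
  \<open>x\<close> moves past pure elements up to sign. By simplicity \<open>1 = q x\<close>, and
  multiplying by \<open>x\<close> gives \<open>x = q x x = 0\<close>.\<close>

lemma pure_nondegenerate:
  assumes x: "pure x" and x0: "x \<noteq> 0"
  obtains y where "pure y" "x * y + y * x \<noteq> 0"
proof (rule ccontr)
  assume "\<not> thesis"
  then have anti: "\<And>y. pure y \<Longrightarrow> x * y + y * x = 0" using that by blast
  have xx: "x * x = 0" using two_\<iota>[OF anti[OF x]] .
  define I where "I = {q * x | q. q \<in> S}"
  have "1 \<in> I"
  proof (rule simple[of I x])
    show "I \<subseteq> S" using pure_in[OF x] S_closed by (auto simp: I_def)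
    show "u + v \<in> I" if "u \<in> I" "v \<in> I" for u v
      using that S_add unfolding I_def by (auto simp: distrib_right[symmetric])
    show "q * v \<in> I" if qv: "q \<in> S" "v \<in> I" for q v
      using qv S_mult unfolding I_def by (auto simp: mult.assoc[symmetric])
    show "v * q \<in> I" if qv: "q \<in> S" "v \<in> I" for q v
    proof -
      obtain p where p: "p \<in> S" "v = p * x" using qv unfolding I_def by blast
      obtain k q0 where q: "q = \<iota> k + q0" "pure q0" using pure_decomp[OF qv(1)] .
      have "x * q0 = - (q0 * x)" using anti[OF q(2)] by (simp add: eq_neg_iff_add_eq_0)
      then have "v * q = (p * (\<iota> k - q0)) * x"
        by (simp add: p(2) q(1) distrib_left right_diff_distrib left_diff_distrib mult.assoc \<iota>_commute[of k x, symmetric])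
      moreover have "p * (\<iota> k - q0) \<in> S" by (intro S_mult p(1) S_diff \<iota>_in pure_in[OF q(2)])
      ultimately show ?thesis unfolding I_def by blast
    qed
    show "x \<in> I" using S_01 unfolding I_def by (auto intro: exI[of _ 1])
  qed (rule x0)
  then obtain q where "1 = q * x" unfolding I_def by blast
  then have "x = q * x * x" by simp
  also have "\<dots> = 0" by (simp add: mult.assoc xx)
  finally show False using x0 by simp
qed

end

section \<open>Quaternion bases adapted to the involution\<close>

locale involutive_quaternion = quaternion_subalgebra S \<iota> + involutive_subalgebra S \<iota> s \<tau>
  for S :: "'a::ring_1 set" and \<iota> :: "'k::field \<Rightarrow> 'a" and s :: "'a \<Rightarrow> 'a" and \<tau> :: "'k \<Rightarrow> 'k"
begin

lemma s_pure: assumes x: "pure x" shows "pure (s x)"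
proof -
  obtain m where m: "x * x = \<iota> m" using pure_square[OF x] by blast
  have "s x * s x = \<iota> (\<tau> m)" using s_mult[of x x] pure_in[OF x] m s_\<iota> by simp
  moreover have "s x = 0" if r: "s x \<in> range \<iota>"
  proof -
    obtain k where k: "s x = \<iota> k" using r by blast
    then have "x = \<iota> (\<tau> k)" using s_s[OF pure_in[OF x]] s_\<iota> by metis
    then have "x = 0" using x by (auto simp: pure_def)
    then show ?thesis by (simp add: s_0)
  qed
  ultimately show ?thesis using s_in[OF pure_in[OF x]] by (auto simp: pure_def)
qed

lemma half_sum: "x = \<iota> (1 / 2) * (x + y) + \<iota> (1 / 2) * (x - y)"
proof -
  have "\<iota> (1 / 2) * (x + y) + \<iota> (1 / 2) * (x - y) = \<iota> (1 / 2 + 1 / 2) * x"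
    by (simp only: \<iota>_add distrib_left distrib_right right_diff_distrib) simp
  then show ?thesis by (simp only: half \<iota>_one mult_1_left)
qed

text \<open>Split an anisotropic \<open>z\<close> into its symmetric part \<open>p\<close> and its
  skew part \<open>q\<close>. If both have square zero, then \<open>k = p q + q p\<close> equals
  \<open>z z\<close> and satisfies \<open>\<tau> k = - k\<close>, which happens for nontrivial
  \<open>\<tau>\<close> only; then \<open>p + k q\<close> is symmetric with square
  \<open>k k\<close>. The space \<open>E\<close> is general because the lemma serves for all pure
  elements and again for an orthogonal complement.\<close>

lemma ex_eigenvector:
  assumes Ep: "\<And>x. x \<in> E \<Longrightarrow> pure x" and Eadd: "\<And>x y. x \<in> E \<Longrightarrow> y \<in> E \<Longrightarrow> x + y \<in> E"
    and Esc: "\<And>x k. x \<in> E \<Longrightarrow> \<iota> k * x \<in> E" and Es: "\<And>x. x \<in> E \<Longrightarrow> s x \<in> E"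
    and xy: "x \<in> E" "y \<in> E" "x * y + y * x \<noteq> 0"
  obtains e where "e \<in> E" "e * e \<noteq> 0" "s e = e \<or> s e = - e"
proof -
  \<comment> \<open>Polarisation: if \<open>x\<close> and \<open>y\<close> have square zero, the
    square of \<open>x + y\<close> is their anticommutator.\<close>
  obtain z where z: "z \<in> E" "z * z \<noteq> 0"
  proof (cases "x * x = 0 \<and> y * y = 0")
    case True
    then have "(x + y) * (x + y) = x * y + y * x" by (simp add: distrib_left distrib_right)
    then show ?thesis using that[of "x + y"] xy Eadd by simp
  qed (use that xy in blast)
  define h where "h = (1 / 2 :: 'k)"
  have Eneg: "- v \<in> E" if "v \<in> E" for v using Esc[OF that, of "- 1"] by (simp add: \<iota>_minus \<iota>_one)
  have \<tau>h: "\<tau> h = h"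
  proof -
    have "\<iota> (\<tau> h) + \<iota> (\<tau> h) = s (\<iota> h + \<iota> h)" using s_add \<iota>_in s_\<iota> by simp
    also have "\<iota> h + \<iota> h = 1" unfolding h_def \<iota>_add[symmetric] half by (simp add: \<iota>_one)
    also have "s 1 = 1"
    proof -
      have "s 1 * s (s 1) = s (s 1)" using s_mult[of "s 1" 1] S_01 s_in by simp
      then show ?thesis using s_s[of 1] S_01 by simp
    qed
    also have "1 = \<iota> h + \<iota> h" unfolding h_def \<iota>_add[symmetric] half by (simp add: \<iota>_one)
    finally have "(\<iota> (\<tau> h) - \<iota> h) + (\<iota> (\<tau> h) - \<iota> h) = 0" by (simp add: algebra_simps)
    then have "\<iota> (\<tau> h) - \<iota> h = 0" by (rule two_\<iota>)
    then have "\<iota> (\<tau> h) = \<iota> h" by simp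
    then show ?thesis by (simp add: \<iota>_inj)
  qed
  define p q where "p = \<iota> h * (z + s z)" and "q = \<iota> h * (z - s z)"
  have zS: "z \<in> S" "s z \<in> S" using pure_in[OF Ep] z s_in by auto
  have szh: "s (\<iota> h * v) = \<iota> h * s v" if "v \<in> S" for v
    using s_mult[of "\<iota> h" v] that \<iota>_in s_\<iota> \<tau>h \<iota>_commute by simp
  have p: "p \<in> E" "s p = p" using z Eadd Esc Es zS S_closed
    by (auto simp: p_def szh s_add s_s add.commute)
  have q: "q \<in> E" "s q = - q"
    using Esc[OF Eadd[OF z(1) Eneg[OF Es[OF z(1)]]], of h] zS S_closed
    by (auto simp: q_def szh s_diff s_s right_diff_distrib)
  have pS: "p \<in> S" "q \<in> S" using p q Ep pure_in by auto
  have zpq: "z = p + q" unfolding p_def q_def h_def by (rule half_sum)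
  show thesis
  proof (cases "p * p = 0 \<and> q * q = 0")
    case True
    obtain k where k: "p * q + q * p = \<iota> k" using pure_anticommutator p q Ep by metis
    have "z * z = \<iota> k" using True unfolding zpq k[symmetric] by (simp add: distrib_left distrib_right)
    then have k0: "k \<noteq> 0" using z by (auto simp: \<iota>_0)
    have "\<iota> (\<tau> k) = s (p * q + q * p)" unfolding k s_\<iota> ..
    also have "\<dots> = - (p * q + q * p)"
      using pS p q S_closed by (simp add: s_add s_mult)
    finally have \<tau>k: "\<iota> (\<tau> k) = - \<iota> k" unfolding k .
    \<comment> \<open>As \<open>\<tau> k = - k\<close>, multiplication by \<open>k\<close> turns the
      skew \<open>q\<close> into a symmetric element.\<close>
    define e where "e = p + \<iota> k * q"
    have "s (\<iota> k * q) = \<iota> k * q"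
      using s_mult[of "\<iota> k" q] pS \<iota>_in s_\<iota> q \<tau>k \<iota>_commute[of k q] by simp
    then have "s e = e" using p pS S_closed by (simp add: e_def s_add)
    moreover have "e * e = \<iota> k * (p * q + q * p)"
    proof -
      have "e * e = p * p + \<iota> k * (p * q) + \<iota> k * (q * p) + \<iota> k * (\<iota> k * (q * q))"
        unfolding e_def by (simp only: distrib_left distrib_right mult.assoc \<iota>_left_commute[of p] \<iota>_left_commute[of q] add_ac)
      then show ?thesis using True by (simp add: distrib_left)
    qed
    then have "e * e \<noteq> 0" unfolding k using k0 by (simp add: \<iota>_scale_0 \<iota>_eq_0)
    moreover have "e \<in> E" unfolding e_def using p q Eadd Esc by auto
    ultimately show ?thesis using that by blast
  qed (use that p q in blast)
qed

lemma \<tau>_square: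
  assumes "e \<in> S" "s e = e \<or> s e = - e" "e * e = \<iota> c"
  shows "\<tau> c = c"
  using s_mult[of e e] assms s_\<iota>[of c] \<iota>_inj by auto

text \<open>The form \<open>x y + y x\<close> on pure elements is nondegenerate, so there is an
  eigenvector \<open>u\<close> with nonzero square. Its orthogonal complement \<open>E\<close> is
  stable under \<open>s\<close> because \<open>s u\<close> is \<open>u\<close> or
  \<open>- u\<close>, and the form on it is again not identically zero; an eigenvector
  \<open>v\<close> in \<open>E\<close> anticommutes with \<open>u\<close>. Squares of eigenvectors
  are symmetric, hence \<open>c\<close> and \<open>d\<close> are fixed by
  \<open>\<tau>\<close>.\<close>

theorem ex_quaternion_basis:
  obtains u v c d where "u \<in> S" "v \<in> S" "u * u = \<iota> c" "v * v = \<iota> d" "u * v = - (v * u)"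
    "c \<noteq> 0" "d \<noteq> 0" "\<tau> c = c" "\<tau> d = d" "s u = u \<or> s u = - u" "s v = v \<or> s v = - v"
proof -
  obtain x0 where x0: "x0 \<in> S" "x0 \<notin> range \<iota>" using dim_ex by blast
  obtain k x where x: "x0 = \<iota> k + x" "pure x" using pure_decomp[OF x0(1)] .
  have "x \<noteq> 0" using x x0 by auto
  then obtain y where y: "pure y" "x * y + y * x \<noteq> 0" using pure_nondegenerate[OF x(2)] by blast
  obtain u where u: "pure u" "u * u \<noteq> 0" "s u = u \<or> s u = - u"
    using ex_eigenvector[of "Collect pure" x y] x y pure_add pure_scale s_pure by auto
  obtain c where c: "u * u = \<iota> c" using pure_square[OF u(1)] by blast
  have c0: "c \<noteq> 0" using u(2) c by (auto simp: \<iota>_0)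
  note uS = pure_in[OF u(1)]
  define E where "E = {v. pure v \<and> u * v + v * u = 0}"
  \<comment> \<open>Orthogonal projection along \<open>u\<close>. The coefficient is the
    anticommutator with \<open>u\<close> divided by \<open>2 c\<close>, the anticommutator of
    \<open>u\<close> with itself.\<close>
  have proj: "\<exists>t v. y = \<iota> t * u + v \<and> v \<in> E" if py: "pure y" for y
  proof -
    obtain k where k: "u * y + y * u = \<iota> k" using pure_anticommutator[OF u(1) py] by blast
    define t where "t = k / (c + c)"
    have cc: "c + c \<noteq> 0" using c0 two_neq_0 by (metis mult_2 mult_eq_0_iff)
    define v where "v = y + \<iota> (- t) * u"
    have "pure v" unfolding v_def by (intro pure_add py pure_scale u(1))
    moreover have "u * v + v * u = (u * y + y * u) + (\<iota> (- t) * (u * u) + \<iota> (- t) * (u * u))"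
      unfolding v_def by (simp only: distrib_left distrib_right mult.assoc \<iota>_left_commute[of u] add_ac)
    then have "u * v + v * u = \<iota> (k + (- t * c + - t * c))" unfolding k c by (simp only: \<iota>_add \<iota>_mult)
    moreover have "k + (- t * c + - t * c) = 0" using cc by (simp add: t_def field_simps)
    ultimately have "v \<in> E" by (simp add: E_def \<iota>_0)
    moreover have "y = \<iota> t * u + v" by (simp add: v_def \<iota>_minus)
    ultimately show ?thesis by blast
  qed
  have Ep: "\<And>v. v \<in> E \<Longrightarrow> pure v" by (simp add: E_def)
  have "\<exists>w\<in>E. w \<noteq> 0"
  proof (rule ccontr)
    \<comment> \<open>With \<open>E = 0\<close> every element is a combination of \<open>1\<close>
      and \<open>u\<close>, so \<open>u\<close> would be central.\<close>
    assume n: "\<not> (\<exists>w\<in>E. w \<noteq> 0)"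
    have "u \<in> range \<iota>"
    proof (rule centre[OF uS])
      fix w assume "w \<in> S"
      then obtain k y where w: "w = \<iota> k + y" "pure y" using pure_decomp by blast
      obtain t v where tv: "y = \<iota> t * u + v" "v \<in> E" using proj[OF w(2)] by blast
      then have "w = \<iota> k + \<iota> t * u" using n w by simp
      then show "u * w = w * u"
        by (simp add: distrib_left distrib_right mult.assoc \<iota>_left_commute[of u] \<iota>_commute[of k u])
    qed
    then show False using u by (auto simp: pure_def)
  qed
  then obtain w where w: "w \<in> E" "w \<noteq> 0" by blast
  obtain y' where y': "pure y'" "w * y' + y' * w \<noteq> 0" using pure_nondegenerate[OF Ep[OF w(1)] w(2)] by blast
  obtain t w' where w': "y' = \<iota> t * u + w'" "w' \<in> E" using proj[OF y'(1)] by blast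
  \<comment> \<open>\<open>w\<close> is orthogonal to \<open>u\<close>, so the pairing with
    \<open>y'\<close> is the pairing with its component \<open>w'\<close> in
    \<open>E\<close>.\<close>
  have "w * y' + y' * w = \<iota> t * (u * w + w * u) + (w * w' + w' * w)"
    unfolding w'(1) by (simp only: distrib_left distrib_right mult.assoc \<iota>_left_commute[of w] add_ac)
  then have ww': "w * w' + w' * w \<noteq> 0" using y'(2) w(1) by (simp add: E_def)
  obtain v where v: "v \<in> E" "v * v \<noteq> 0" "s v = v \<or> s v = - v"
  proof (rule ex_eigenvector[OF _ _ _ _ w(1) w'(2) ww'])
    show "pure z" if "z \<in> E" for z using Ep that .
    show "y + z \<in> E" if yz: "y \<in> E" "z \<in> E" for y z
    proof -
      have "u * (y + z) + (y + z) * u = (u * y + y * u) + (u * z + z * u)"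
        by (simp add: distrib_left distrib_right add_ac)
      then show ?thesis using yz pure_add by (simp add: E_def)
    qed
    show "\<iota> k * z \<in> E" if z: "z \<in> E" for z k
    proof -
      have "u * (\<iota> k * z) + (\<iota> k * z) * u = \<iota> k * (u * z + z * u)"
        by (simp only: distrib_left \<iota>_left_commute[of u] mult.assoc)
      then show ?thesis using z pure_scale by (simp add: E_def)
    qed
    show "s z \<in> E" if z: "z \<in> E" for z
    proof -
      have zS: "z \<in> S" using z pure_in by (simp add: E_def)
      have "s (u * z + z * u) = s z * s u + s u * s z" using zS uS S_closed by (simp add: s_add s_mult)
      then have "s z * s u + s u * s z = 0" using z by (simp add: E_def s_0)
      moreover have "s z * s u + s u * s z = u * s z + s z * u
          \<or> s z * s u + s u * s z = - (u * s z + s z * u)"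
        using u(3) by (elim disjE) simp_all
      ultimately have "u * s z + s z * u = 0" by (metis neg_equal_0_iff_equal)
      then show ?thesis using z s_pure by (simp add: E_def)
    qed
  qed
  obtain d where d: "v * v = \<iota> d" using pure_square[OF Ep[OF v(1)]] by blast
  note vS = pure_in[OF Ep[OF v(1)]]
  have d0: "d \<noteq> 0" using v(2) d by (auto simp: \<iota>_0)
  have "u * v = - (v * u)" using v(1) by (simp add: E_def eq_neg_iff_add_eq_0)
  then show thesis
    using that[OF uS vS c d _ c0 d0 \<tau>_square[OF uS u(3) c] \<tau>_square[OF vS v(3) d] u(3) v(3)] by blast
qed

end

section \<open>The cone of hermitian squares\<close>

context involutive_subalgebra
begin

text \<open>An inductive cone instead of indexed sums: closure properties become inductions, and
  indexed sums are needed at the very end only, when elements of the cone are carried back to the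
  algebra.\<close>

inductive_set HS :: "'a set" where
  zero: "0 \<in> HS"
| add_square: "y \<in> HS \<Longrightarrow> x \<in> S \<Longrightarrow> y + s x * x \<in> HS"

definition H :: "'k set" where "H = {k. \<iota> k \<in> HS}"

lemma HS_in: "y \<in> HS \<Longrightarrow> y \<in> S"
  by (induction rule: HS.induct) (auto intro: S_closed s_in)

lemma HS_sym: "y \<in> HS \<Longrightarrow> s y = y"
  by (induction rule: HS.induct) (simp_all add: s_0 s_add s_mult s_in s_s HS_in S_mult)

lemma HS_add: "y \<in> HS \<Longrightarrow> x \<in> HS \<Longrightarrow> x + y \<in> HS"
  by (induction rule: HS.induct) (auto simp: add.assoc[symmetric] intro: HS.intros)

lemma HS_square: "x \<in> S \<Longrightarrow> s x * x \<in> HS"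
  using HS.add_square[OF HS.zero] by simp

lemma HS_conj: "y \<in> HS \<Longrightarrow> x \<in> S \<Longrightarrow> s x * y * x \<in> HS"
proof (induction rule: HS.induct)
  case (add_square y z)
  have "s x * (y + s z * z) * x = s x * y * x + s (z * x) * (z * x)"
    using add_square by (simp add: s_mult distrib_left distrib_right mult.assoc)
  then show ?case using add_square by (metis HS.add_square S_mult)
qed (simp add: HS.zero)

text \<open>Scalars are central, so \<open>h s(x) x = s(x) h x\<close>, and the cone is stable under
  the map \<open>y \<mapsto> s(x) y x\<close>.\<close>

lemma HS_scale: "y \<in> HS \<Longrightarrow> h \<in> H \<Longrightarrow> \<iota> h * y \<in> HS"
proof (induction rule: HS.induct)
  case (add_square y x)
  have "\<iota> h * (s x * x) = s x * \<iota> h * x" using \<iota>_commute[of h "s x"] by (simp only: mult.assoc[symmetric])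
  then have "\<iota> h * (s x * x) \<in> HS" using HS_conj[of "\<iota> h" x] add_square by (simp add: H_def)
  then show ?case using add_square HS_add by (simp add: distrib_left)
qed (simp add: HS.zero)

lemma H_norm: "\<tau> a * a \<in> H"
  using HS_square[of "\<iota> a"] by (simp add: \<iota>_in s_\<iota> H_def \<iota>_mult)

lemma preordering_H: "field_preordering fixed H"
  unfolding field_preordering_def
proof (intro conjI ballI)
  show "H \<subseteq> fixed"
  proof
    fix k assume "k \<in> H"
    then have "s (\<iota> k) = \<iota> k" using HS_sym by (simp add: H_def)
    then show "k \<in> fixed" by (simp add: s_\<iota> \<iota>_inj fixed_def)
  qed
  show "x + y \<in> H" "x * y \<in> H" if "x \<in> H" "y \<in> H" for x y
    using that HS_add HS_scale by (auto simp: H_def \<iota>_add \<iota>_mult)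
  show "x\<^sup>2 \<in> H" if "x \<in> fixed" for x
    using H_norm[of x] that by (simp add: fixed_def power2_eq_square)
qed

lemma H_sum: "(\<And>x. x \<in> A \<Longrightarrow> f x \<in> H) \<Longrightarrow> sum f A \<in> H"
  by (induction A rule: infinite_finite_induct)
    (use HS.zero preordering_H in \<open>auto simp: H_def \<iota>_0 field_preordering_def\<close>)

lemma H_of_nat: "of_nat n \<in> H"
proof (induction n)
  case (Suc n)
  have "1 \<in> H" using H_norm[of 1] by (simp add: \<tau>_simps)
  then show ?case using Suc preordering_H by (auto simp: field_preordering_def)
qed (use HS.zero in \<open>simp add: H_def \<iota>_0\<close>)

lemma sym_in_HS_if_minus_one:
  assumes "- 1 \<in> H" and a: "a \<in> S" "s a = a"
  shows "a \<in> HS"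
proof -
  define h where "h = (1 / 2 :: 'k)"
  have hh: "h + h = 1" unfolding h_def by (rule half)
  have 2: "\<tau> h = h"
  proof -
    have "2 * \<tau> h = 2 * h" using \<tau>_simps(1)[of h h] \<tau>_simps(4) by (simp only: hh mult_2)
    then show ?thesis using two_neq_0 by simp
  qed
  \<comment> \<open>The factor one half is built in, so that \<open>x + y = a\<close> and
    \<open>x - y = 1\<close>. Both elements are symmetric, hence their squares are hermitian
    squares.\<close>
  define x y where "x = \<iota> h * (a + 1)" and "y = \<iota> h * (a - 1)"
  have xy: "x \<in> S" "y \<in> S" "s x = x" "s y = y"
    unfolding x_def y_def using a S_closed by (simp_all add: s_scale 2 s_add s_diff s_1)
  have "x * x + - (y * y) = (x + y) * (x - y)"
  proof -
    have "x * y = y * x" unfolding x_def y_def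
      by (simp only: distrib_left distrib_right right_diff_distrib left_diff_distrib mult.assoc
          \<iota>_left_commute[of a] mult_1_left mult_1_right \<iota>_commute[of h a, symmetric]) simp
    then show ?thesis by (simp add: algebra_simps)
  qed
  also have "x + y = \<iota> h * a + \<iota> h * a" by (simp add: x_def y_def distrib_left right_diff_distrib)
  also have "\<dots> = \<iota> (h + h) * a" by (simp only: \<iota>_add distrib_right)
  also have "\<dots> = a" by (simp add: hh \<iota>_one)
  also have "x - y = \<iota> h + \<iota> h" by (simp add: x_def y_def distrib_left right_diff_distrib)
  also have "\<dots> = 1" by (simp only: \<iota>_add[symmetric] hh \<iota>_one)
  finally have "a = \<iota> (- 1) * (s y * y) + s x * x" using xy by (simp add: \<iota>_minus \<iota>_one)
  then show ?thesis using HS.add_square[OF HS_scale[OF HS_square[OF xy(2)] assms(1)] xy(1)] by simp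
qed

section \<open>Diagonalisation of hermitian forms\<close>

definition sesq :: "('i \<Rightarrow> 'i \<Rightarrow> 'k) \<Rightarrow> 'i set \<Rightarrow> ('i \<Rightarrow> 'k) \<Rightarrow> ('i \<Rightarrow> 'k) \<Rightarrow> 'k" where
  "sesq M I x y = (\<Sum>i\<in>I. \<Sum>j\<in>I. \<tau> (x i) * M i j * y j)"

definition pt :: "'i \<Rightarrow> 'i \<Rightarrow> 'k" where "pt i = (\<lambda>j. if j = i then 1 else 0)"

text \<open>Shifting one coordinate by \<open>c\<close> turns the value of the form into a
  polynomial in \<open>c\<close> and \<open>\<tau> c\<close>. A suitable \<open>c\<close> exploits
  positivity both for a vanishing pivot and for an invertible one.\<close>

lemma sesq_update:
  assumes "finite I" "i \<in> I"
  shows "sesq M I (\<lambda>j. x j + c * pt i j) (\<lambda>j. x j + c * pt i j)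
    = sesq M I x x + c * (\<Sum>j\<in>I. \<tau> (x j) * M j i) + \<tau> c * (\<Sum>j\<in>I. M i j * x j) + \<tau> c * c * M i i"
proof -
  have \<tau>p: "\<tau> (pt i j) = pt i j" for j by (simp add: pt_def \<tau>_simps)
  have d: "(\<Sum>j\<in>I. pt i j * f j) = f i" for f :: "_ \<Rightarrow> 'k"
    using assms by (simp add: pt_def if_distrib[of "\<lambda>x. x * _"] sum.delta cong: if_cong)
  have e: "\<tau> (x k + c * pt i k) * M k j * (x j + c * pt i j)
    = \<tau> (x k) * M k j * x j + pt i j * (c * (\<tau> (x k) * M k j)) + pt i k * (\<tau> c * (M k j * x j))
      + pt i k * (pt i j * (\<tau> c * c * M k j))" for k j
    by (simp add: \<tau>_simps \<tau>p algebra_simps)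
  show ?thesis unfolding sesq_def e
    by (simp add: sum.distrib sum_distrib_left[symmetric] d)
qed

text \<open>Completing squares: at each step one pivot is removed from the set \<open>J\<close> of active indices. A
  zero pivot forces its row to vanish, as otherwise the form would represent \<open>- 1\<close>.\<close>

lemma hermitian_form_in_HS:
  fixes M :: "'i \<Rightarrow> 'i \<Rightarrow> 'k"
  assumes I: "finite I" and m1: "- 1 \<notin> H" and f: "\<And>i. i \<in> I \<Longrightarrow> f i \<in> S"
    and J: "finite J" "J \<subseteq> I"
    and herm: "\<And>i j. M j i = \<tau> (M i j)"
    and supp: "\<And>i j. M i j \<noteq> 0 \<Longrightarrow> i \<in> J"
    and psd: "\<And>x. sesq M I x x \<in> H"
  shows "(\<Sum>i\<in>I. \<Sum>j\<in>I. \<iota> (M i j) * (f i * s (f j))) \<in> HS"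
  using J herm supp psd
proof (induction J arbitrary: M rule: finite_induct)
  case empty
  then have "M i j = 0" for i j by blast
  then show ?case by (simp add: \<iota>_0 HS.zero)
next
  case (insert i0 J)
  have i0: "i0 \<in> I" and JI: "J \<subseteq> I" using insert.prems(1) by auto
  note herm = insert.prems(2) and supp = insert.prems(3) and psd = insert.prems(4)
  note H = preordering_H[unfolded field_preordering_def]
  note Fs = subfield_setD[OF subfield_fixed]
  define a where "a = M i0 i0"
  have psd': "sesq M I x x + c * (\<Sum>j\<in>I. \<tau> (x j) * M j i0) + \<tau> c * (\<Sum>j\<in>I. M i0 j * x j) + \<tau> c * c * a \<in> H" for x c
    using psd[of "\<lambda>j. x j + c * pt i0 j"] sesq_update[OF I i0, of M x c] by (simp add: a_def)
  have aH: "a \<in> H" using psd'[of "\<lambda>_. 0" 1] by (simp add: sesq_def \<tau>_simps)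
  have \<tau>L: "(\<Sum>j\<in>I. \<tau> (x j) * M j i0) = \<tau> (\<Sum>j\<in>I. M i0 j * x j)" for x
    unfolding \<tau>_sum by (intro sum.cong refl) (metis \<tau>_simps(2) herm mult.commute)
  show ?case
  proof (cases "a = 0")
    case True
    have zero: "M i0 j = 0" if j: "j \<in> I" for j
    proof (rule ccontr)
      assume m: "M i0 j \<noteq> 0"
      define m where "m = M i0 j"
      define N where "N = \<tau> m * m"
      have N0: "N \<noteq> 0" using m \<tau>_simps(3)[of m] \<tau>_simps(5) unfolding N_def m_def by (metis mult_eq_0_iff)
      \<comment> \<open>With a vanishing pivot, shifting the coordinate \<open>i0\<close> of
        \<open>pt j\<close> by \<open>r m\<close> adds \<open>2 N r\<close> to the value. This
        \<open>r\<close> makes the value \<open>- 1\<close>.\<close>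
      define r where "r = (- 1 - sesq M I (pt j) (pt j)) / (2 * N)"
      have NF: "N \<in> fixed" unfolding N_def by (rule norm_fixed)
      have "sesq M I (pt j) (pt j) \<in> fixed" using psd H by blast
      moreover have "2 * N \<in> fixed" unfolding mult_2 by (intro Fs(5) NF)
      ultimately have "r \<in> fixed" unfolding r_def by (intro Fs(8) Fs(3) Fs(4) Fs(1))
      then have rF: "\<tau> r = r" by (simp add: fixed_def)
      have L: "(\<Sum>k\<in>I. M i0 k * pt j k) = m"
        using I j by (simp add: pt_def m_def if_distrib[of "\<lambda>x. _ * x"] sum.delta cong: if_cong)
      have "sesq M I (pt j) (pt j) + ((r * m) * \<tau> m + \<tau> (r * m) * m) \<in> H"
        using psd'[of "pt j" "r * m"] unfolding \<tau>L L True by (simp add: add.assoc)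
      also have "(r * m) * \<tau> m + \<tau> (r * m) * m = r * (2 * N)"
        by (simp add: \<tau>_simps rF N_def algebra_simps)
      also have "\<dots> = - 1 - sesq M I (pt j) (pt j)"
        using N0 two_neq_0 by (simp add: r_def)
      finally show False using m1 by simp
    qed
    show ?thesis
    proof (rule insert.IH[OF JI herm _ psd])
      fix i j assume M: "M i j \<noteq> 0"
      show "i \<in> J"
      proof (rule ccontr)
        assume "i \<notin> J"
        then have "i = i0" using supp[OF M] by blast
        \<comment> \<open>Hermitian symmetry carries the support condition from rows to columns; so
          \<open>j\<close> lies in \<open>I\<close> and \<open>zero\<close> applies to it.\<close>
        have "M j i \<noteq> 0" using M herm[of j i] by (metis \<tau>_simps(3,5) herm)
        then have "j \<in> I" using supp i0 JI by blast
        then show False using zero M \<open>i = i0\<close> by blast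
      qed
    qed
  next
    case False
    \<comment> \<open>The Schur complement of the pivot.\<close>
    define M' where "M' = (\<lambda>i j. M i j - M i i0 * M i0 j * inverse a)"
    have \<tau>a: "\<tau> (inverse a) = inverse a" using herm[of i0 i0] by (simp add: \<tau>_inverse a_def)
    have IH: "(\<Sum>i\<in>I. \<Sum>j\<in>I. \<iota> (M' i j) * (f i * s (f j))) \<in> HS"
    proof (rule insert.IH[OF JI])
      show herm': "M' j i = \<tau> (M' i j)" for i j
      proof -
        have t: "\<tau> (M i j) = M j i" "\<tau> (M i i0) = M i0 i" "\<tau> (M i0 j) = M j i0" by (rule herm[symmetric])+
        show ?thesis unfolding M'_def by (simp add: \<tau>_simps \<tau>a t mult.commute)
      qed
      show "i \<in> J" if M': "M' i j \<noteq> 0" for i j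
      proof -
        have "M i j \<noteq> 0 \<or> M i i0 \<noteq> 0" using M' by (auto simp: M'_def)
        then have "i \<in> insert i0 J" using supp by blast
        moreover have "i \<noteq> i0"
        proof
          assume "i = i0"
          then have "M' i j = 0" using False by (simp add: M'_def a_def[symmetric])
          then show False using M' by blast
        qed
        ultimately show ?thesis by blast
      qed
      fix x
      define L where "L = (\<Sum>j\<in>I. M i0 j * x j)"
      \<comment> \<open>At this \<open>c\<close> the completed square vanishes, so the value of
        \<open>M\<close> at the shifted vector is the value of the Schur complement at
        \<open>x\<close>.\<close>
      define c where "c = - L * inverse a"
      have "sesq M' I x x = sesq M I x x - (\<Sum>j\<in>I. \<tau> (x j) * M j i0) * L * inverse a"
        unfolding sesq_def M'_def L_def
        by (simp add: sum_product sum_subtractf algebra_simps sum_distrib_left)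
      also have "\<dots> = sesq M I x x + c * (\<Sum>j\<in>I. \<tau> (x j) * M j i0) + \<tau> c * L + \<tau> c * c * a"
        unfolding \<tau>L L_def[symmetric] c_def using False by (simp add: \<tau>_simps \<tau>a field_simps)
      also have "\<dots> \<in> H" unfolding L_def by (rule psd')
      finally show "sesq M' I x x \<in> H" .
    qed
    \<comment> \<open>The pivot column as an element of \<open>S\<close>. The rank one part removed
      from \<open>M\<close> contributes \<open>y s(y) / a\<close>, which is the hermitian square of
      \<open>s y\<close> scaled by an element of \<open>H\<close>.\<close>
    define y where "y = (\<Sum>i\<in>I. \<iota> (M i i0) * f i)"
    have yS: "y \<in> S" unfolding y_def using f by (auto intro!: S_sum S_closed)
    have "s y = (\<Sum>j\<in>I. \<iota> (M i0 j) * s (f j))"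
      unfolding y_def using f
      by (subst s_sum) (auto intro!: sum.cong S_closed simp: s_scale herm[of i0, symmetric])
    then have "y * s y = (\<Sum>i\<in>I. \<Sum>j\<in>I. (\<iota> (M i i0) * f i) * (\<iota> (M i0 j) * s (f j)))"
      unfolding y_def by (simp only: sum_product)
    also have "\<dots> = (\<Sum>i\<in>I. \<Sum>j\<in>I. \<iota> (M i i0 * M i0 j) * (f i * s (f j)))"
      by (intro sum.cong refl) (metis \<iota>_left_commute \<iota>_mult mult.assoc)
    finally have "\<iota> (inverse a) * (y * s y)
        = (\<Sum>i\<in>I. \<Sum>j\<in>I. \<iota> (M i i0 * M i0 j * inverse a) * (f i * s (f j)))"
      by (simp only: sum_distrib_left \<iota>_mult_left[symmetric] mult.commute[of _ "inverse a"])
    then have "(\<Sum>i\<in>I. \<Sum>j\<in>I. \<iota> (M i j) * (f i * s (f j)))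
        = \<iota> (inverse a) * (y * s y) + (\<Sum>i\<in>I. \<Sum>j\<in>I. \<iota> (M' i j) * (f i * s (f j)))"
      by (simp add: sum.distrib[symmetric] distrib_right[symmetric] \<iota>_add[symmetric] M'_def)
    moreover have "\<iota> (inverse a) * (y * s y) \<in> HS"
      using HS_scale[OF HS_square[OF s_in[OF yS]]] preordering_inverse[OF subfield_fixed preordering_H aH]
      by (simp add: s_s yS)
    ultimately show ?thesis using IH HS_add by simp
  qed
qed

end

text \<open>An \<open>S\<close> with a basis which is orthogonal for the involution trace form and consists of
  similitudes; \<open>c\<close> plays the role of the reduced trace, \<open>n\<close> that of the degree.\<close>

locale diagonal_trace_algebra = involutive_subalgebra S \<iota> s \<tau>
  for S :: "'a::ring_1 set" and \<iota> :: "'k::field \<Rightarrow> 'a" and s :: "'a \<Rightarrow> 'a" and \<tau> :: "'k \<Rightarrow> 'k" +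
  fixes G :: "'g set" and e :: "'g \<Rightarrow> 'a" and w :: "'g \<Rightarrow> 'k" and c :: "'a \<Rightarrow> 'k" and n :: nat
  assumes G: "finite G" and card_G: "of_nat (card G) \<noteq> (0 :: 'k)" and n: "of_nat n \<noteq> (0 :: 'k)"
    and e_in: "g \<in> G \<Longrightarrow> e g \<in> S"
    and w: "g \<in> G \<Longrightarrow> w g \<noteq> 0" "g \<in> G \<Longrightarrow> \<tau> (w g) = w g"
    and e_sim: "g \<in> G \<Longrightarrow> s (e g) * e g = \<iota> (w g)" "g \<in> G \<Longrightarrow> e g * s (e g) = \<iota> (w g)"
    and span: "y \<in> S \<Longrightarrow> \<exists>k. y = (\<Sum>g\<in>G. \<iota> (k g) * e g)"
    and c_add: "x \<in> S \<Longrightarrow> y \<in> S \<Longrightarrow> c (x + y) = c x + c y"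
    and c_scale: "x \<in> S \<Longrightarrow> c (\<iota> k * x) = k * c x"
    and c_e: "g \<in> G \<Longrightarrow> h \<in> G \<Longrightarrow> c (s (e g) * e h) = (if g = h then of_nat n * w g else 0)"
    and c_s: "x \<in> S \<Longrightarrow> c (s x) = \<tau> (c x)"
begin

lemma c_0: "c 0 = 0" using c_add[OF S_01(1) S_01(1)] by (metis add.right_neutral add_left_cancel)

lemma c_sum: "(\<And>x. x \<in> A \<Longrightarrow> f x \<in> S) \<Longrightarrow> c (sum f A) = (\<Sum>x\<in>A. c (f x))"
  by (induction A rule: infinite_finite_induct) (simp_all add: c_0 c_add S_sum)

text \<open>Pairing \<open>y\<close> with \<open>e g\<close> isolates one coefficient, multiplied by
  \<open>n w g\<close>. The integer stays on the left-hand side and is divided out at the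
  end.\<close>

lemma expansion:
  assumes y: "y \<in> S"
  shows "\<iota> (of_nat n) * y = (\<Sum>g\<in>G. \<iota> (c (s (e g) * y) / w g) * e g)"
proof -
  obtain k where k: "y = (\<Sum>g\<in>G. \<iota> (k g) * e g)" using span[OF y] by blast
  have "c (s (e g) * y) = of_nat n * w g * k g" if g: "g \<in> G" for g
  proof -
    have "s (e g) * y = (\<Sum>h\<in>G. \<iota> (k h) * (s (e g) * e h))"
      by (simp add: k sum_distrib_left \<iota>_left_commute[of "s (e g)"])
    then have "c (s (e g) * y) = (\<Sum>h\<in>G. k h * (if g = h then of_nat n * w g else 0))"
      using g by (simp add: c_sum c_scale c_e e_in s_in S_mult \<iota>_in)
    then show ?thesis using g G by (simp add: if_distrib[of "\<lambda>x. _ * x"] sum.delta mult.commute cong: if_cong)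
  qed
  then have "(\<Sum>g\<in>G. \<iota> (c (s (e g) * y) / w g) * e g) = (\<Sum>g\<in>G. \<iota> (of_nat n * k g) * e g)"
    using w by (intro sum.cong) auto
  then show ?thesis by (simp add: k sum_distrib_left \<iota>_mult_left)
qed

lemma c_form:
  assumes a: "a \<in> S"
  shows "c (s (\<Sum>g\<in>G. \<iota> (x g) * e g) * a * (\<Sum>g\<in>G. \<iota> (x g) * e g))
    = sesq (\<lambda>g h. c (s (e g) * a * e h)) G x x"
proof -
  have s: "s (\<Sum>g\<in>G. \<iota> (x g) * e g) = (\<Sum>g\<in>G. \<iota> (\<tau> (x g)) * s (e g))"
    by (subst s_sum) (auto intro!: S_mult \<iota>_in e_in sum.cong simp: s_scale e_in)
  have "s (\<Sum>g\<in>G. \<iota> (x g) * e g) * a * (\<Sum>g\<in>G. \<iota> (x g) * e g)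
    = (\<Sum>g\<in>G. \<Sum>h\<in>G. (\<iota> (\<tau> (x g)) * s (e g) * a) * (\<iota> (x h) * e h))"
    unfolding s sum_distrib_right[where r = a] sum_product ..
  also have "\<dots> = (\<Sum>g\<in>G. \<Sum>h\<in>G. \<iota> (\<tau> (x g) * x h) * (s (e g) * a * e h))"
    by (intro sum.cong refl) (metis \<iota>_left_commute \<iota>_mult_left mult.assoc)
  finally show ?thesis
    using a by (simp add: c_sum c_scale e_in s_in S_mult \<iota>_in S_sum sesq_def mult_ac)
qed

theorem positive_in_HS:
  assumes a: "a \<in> S" "s a = a"
    and pos: "\<And>P x. field_ordering fixed P \<Longrightarrow> (\<And>x. x \<in> S \<Longrightarrow> c (s x * x) \<in> P) \<Longrightarrow> x \<in> S
      \<Longrightarrow> c (s x * a * x) \<in> P"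
  shows "a \<in> HS"
proof (cases "- 1 \<in> H")
  case True
  then show ?thesis using sym_in_HS_if_minus_one a by blast
next
  case False
  note H = preordering_H[unfolded field_preordering_def]
  have wH: "w g \<in> H" if "g \<in> G" for g
    using HS_square[OF e_in[OF that]] e_sim(1)[OF that] by (simp add: H_def)
  \<comment> \<open>The form is diagonal with entries \<open>n w g\<close> from \<open>H\<close>,
    and the norms \<open>\<tau> k * k\<close> lie in \<open>H\<close> too. Hence any ordering above
    \<open>H\<close> meets the side condition of \<open>pos\<close>.\<close>
  have psd1: "c (s x * x) \<in> H" if x: "x \<in> S" for x
  proof -
    obtain k where k: "x = (\<Sum>g\<in>G. \<iota> (k g) * e g)" using span[OF x] by blast
    have "c (s x * x) = sesq (\<lambda>g h. c (s (e g) * 1 * e h)) G k k"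
      using c_form[of 1 k] S_01 by (simp add: k)
    also have "\<dots> = (\<Sum>g\<in>G. \<tau> (k g) * k g * (of_nat n * w g))"
      unfolding sesq_def using G
      by (intro sum.cong refl) (simp add: c_e if_distrib[of "\<lambda>x. _ * x"] if_distrib[of "\<lambda>x. x * _"] sum.delta mult_ac cong: if_cong)
    also have "\<dots> \<in> H" using H H_norm H_of_nat wH by (intro H_sum) blast
    finally show ?thesis .
  qed
  have psd: "c (s x * a * x) \<in> H" if x: "x \<in> S" for x
  proof (rule ccontr)
    assume n: "c (s x * a * x) \<notin> H"
    have "s (s x * a * x) = s x * a * x" using a x by (simp add: s_mult s_in s_s S_mult mult.assoc)
    then have "c (s x * a * x) \<in> fixed" using c_s[of "s x * a * x"] a x
      by (simp add: fixed_def s_in S_mult)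
    then obtain P where P: "field_ordering fixed P" "H \<subseteq> P" "c (s x * a * x) \<notin> P"
      using artin_preordering[OF subfield_fixed preordering_H False _ n] by blast
    then show False using pos[OF P(1) _ x] psd1 by blast
  qed
  define f where "f g = \<iota> (inverse (w g)) * e g" for g
  \<comment> \<open>Cut off outside \<open>G\<close>, since \<open>hermitian_form_in_HS\<close> asks
    for hermitian symmetry and support at all indices.\<close>
  define M where "M g h = (if g \<in> G \<and> h \<in> G then c (s (e g) * a * e h) else 0)" for g h
  have sesqM: "sesq M G x x = sesq (\<lambda>g h. c (s (e g) * a * e h)) G x x" for x
    unfolding sesq_def M_def by (intro sum.cong refl) auto
  have fS: "f g \<in> S" if "g \<in> G" for g using that by (simp add: f_def S_mult \<iota>_in e_in)
  have "(\<Sum>g\<in>G. \<Sum>h\<in>G. \<iota> (M g h) * (f g * s (f h))) \<in> HS"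
  proof (rule hermitian_form_in_HS[OF G False fS G subset_refl])
    show "M h g = \<tau> (M g h)" for g h
    proof (cases "g \<in> G \<and> h \<in> G")
      case True
      have "s (s (e g) * a * e h) = s (e h) * a * e g"
        using True a by (simp add: s_mult s_in s_s e_in S_mult mult.assoc)
      then show ?thesis using True a c_s[of "s (e g) * a * e h"] by (simp add: M_def s_in e_in S_mult)
    qed (auto simp: M_def \<tau>_simps)
    show "g \<in> G" if "M g h \<noteq> 0" for g h using that by (auto simp: M_def split: if_splits)
    show "sesq M G x x \<in> H" for x
      unfolding sesqM c_form[OF a(1), symmetric] by (rule psd) (auto intro!: S_sum S_mult \<iota>_in e_in)
  qed
  also have "(\<Sum>g\<in>G. \<Sum>h\<in>G. \<iota> (M g h) * (f g * s (f h)))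
      = (\<Sum>h\<in>G. \<Sum>g\<in>G. \<iota> (M g h) * (f g * s (f h)))" by (rule sum.swap)
  also have "\<dots> = (\<Sum>h\<in>G. \<iota> (of_nat n) * a)"
  proof (intro sum.cong refl)
    \<comment> \<open>For fixed \<open>h\<close> the sum over \<open>g\<close> is the expansion of
      \<open>a e h\<close>. The right factor \<open>s (e h) / w h\<close> inverts
      \<open>e h\<close>, so each \<open>h\<close> contributes the same element
      \<open>n a\<close>.\<close>
    fix h assume h: "h \<in> G"
    have "s (f h) = \<iota> (inverse (w h)) * s (e h)"
      using h w by (simp add: f_def s_scale e_in \<tau>_inverse)
    then have "(\<Sum>g\<in>G. \<iota> (M g h) * (f g * s (f h)))
       = (\<Sum>g\<in>G. \<iota> (M g h / w g) * e g) * (\<iota> (inverse (w h)) * s (e h))"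
      by (simp add: sum_distrib_right f_def \<iota>_mult divide_inverse mult.assoc)
    also have "(\<Sum>g\<in>G. \<iota> (M g h / w g) * e g) = \<iota> (of_nat n) * (a * e h)"
      using expansion[of "a * e h"] h a by (simp add: S_mult e_in M_def mult.assoc)
    also have "\<iota> (of_nat n) * (a * e h) * (\<iota> (inverse (w h)) * s (e h))
       = \<iota> (inverse (w h)) * (\<iota> (of_nat n) * (a * (e h * s (e h))))"
      by (metis \<iota>_left_commute mult.assoc)
    also have "\<dots> = \<iota> (inverse (w h)) * (\<iota> (w h) * (\<iota> (of_nat n) * a))"
      unfolding e_sim(2)[OF h] by (metis \<iota>_commute mult.assoc)
    also have "\<dots> = \<iota> (of_nat n) * a" using w(1)[OF h] by (rule \<iota>_cancel)
    finally show "(\<Sum>g\<in>G. \<iota> (M g h) * (f g * s (f h))) = \<iota> (of_nat n) * a" .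
  qed
  also have "\<dots> = \<iota> (of_nat (card G) * of_nat n) * a"
    using \<iota>_sum[of "\<lambda>_. of_nat n" G] by (simp add: sum_distrib_right[symmetric] del: sum_constant) simp
  finally have r: "\<iota> (of_nat (card G) * of_nat n) * a \<in> HS" .
  \<comment> \<open>Natural numbers are sums of squares, so the factor in front of \<open>a\<close>
    can be cancelled within the cone.\<close>
  have "inverse (of_nat (card G) * of_nat n) \<in> H"
    using preordering_inverse[OF subfield_fixed preordering_H] H H_of_nat by blast
  from HS_scale[OF r this] show ?thesis
    using card_G n by (subst (asm) \<iota>_cancel) auto
qed

end

section \<open>Monoid algebras\<close>

text \<open>Evaluation of a finitely supported function along a family of maps on coefficients.
  Coordinates and matrix entries are of this kind, so ring identities and homomorphisms out of the
  monoid algebra are both checked on evaluations.\<close>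

definition ev :: "('g \<Rightarrow> 'k::zero \<Rightarrow> 'b::comm_monoid_add) \<Rightarrow> ('g \<Rightarrow> 'k) \<Rightarrow> 'b" where
  "ev T f = (\<Sum>g | f g \<noteq> 0. T g (f g))"

definition fin_supp :: "('g \<Rightarrow> 'k::zero) \<Rightarrow> bool" where
  "fin_supp f \<longleftrightarrow> finite {g. f g \<noteq> 0}"

text \<open>Additivity without linearity leaves room for families twisted by the involution of the
  coefficient field, as needed in \<open>ev_star\<close>.\<close>

definition additive_family :: "('g \<Rightarrow> 'k::ab_group_add \<Rightarrow> 'b::ab_group_add) \<Rightarrow> bool" where
  "additive_family T \<longleftrightarrow> (\<forall>g x y. T g (x + y) = T g x + T g y)"

lemma additive_familyD:
  assumes "additive_family T"
  shows "T g (x + y) = T g x + T g y" "T g 0 = 0" "T g (- x) = - T g x" "T g (x - y) = T g x - T g y"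
    "T g (sum f A) = (\<Sum>a\<in>A. T g (f a))"
proof -
  have add: "T g (x + y) = T g x + T g y" for x y using assms by (simp add: additive_family_def)
  show "T g (x + y) = T g x + T g y" by (rule add)
  show z: "T g 0 = 0" using add[of 0 0] by (metis add.right_neutral add_left_cancel)
  show m: "T g (- x) = - T g x" for x using add[of x "- x"] z by (simp add: eq_neg_iff_add_eq_0 add.commute)
  show "T g (x - y) = T g x - T g y" using add[of x "- y"] m by simp
  show "T g (sum f A) = (\<Sum>a\<in>A. T g (f a))"
    by (induction A rule: infinite_finite_induct) (simp_all add: z add)
qed

lemma additive_familyI:
  "(\<And>g x y. T g (x + y) = T g x + T g y) \<Longrightarrow> additive_family T"
  by (simp add: additive_family_def)

lemma ev_superset:
  assumes "additive_family T" "finite A" "{g. f g \<noteq> 0} \<subseteq> A"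
  shows "ev T f = (\<Sum>g\<in>A. T g (f g))"
  unfolding ev_def using assms by (intro sum.mono_neutral_left) (auto simp: additive_familyD)

lemma ev_cong: "(\<And>g. f g \<noteq> 0 \<Longrightarrow> T g (f g) = T' g (f g)) \<Longrightarrow> ev T f = ev T' f"
  unfolding ev_def by (intro sum.cong) auto

lemma fin_supp_simps:
  assumes "fin_supp f" "fin_supp (h :: 'g \<Rightarrow> 'k::ab_group_add)"
  shows "fin_supp (\<lambda>g. f g + h g)" "fin_supp (\<lambda>g. f g - h g)" "fin_supp (\<lambda>g. - f g)"
proof -
  have "finite ({g. f g \<noteq> 0} \<union> {g. h g \<noteq> 0})" using assms by (simp add: fin_supp_def)
  then show "fin_supp (\<lambda>g. f g + h g)" "fin_supp (\<lambda>g. f g - h g)"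
    unfolding fin_supp_def by (rule finite_subset[rotated], auto)+
  show "fin_supp (\<lambda>g. - f g)" using assms(1) by (simp add: fin_supp_def)
qed

lemma ev_add:
  assumes T: "additive_family T" and f: "fin_supp f" "fin_supp h"
  shows "ev T (\<lambda>g. f g + h g) = ev T f + ev T h"
proof -
  let ?A = "{g. f g \<noteq> 0} \<union> {g. h g \<noteq> 0}"
  have A: "finite ?A" using f by (simp add: fin_supp_def)
  have sub: "{g. f g + h g \<noteq> 0} \<subseteq> ?A" by auto
  show ?thesis
    using ev_superset[OF T A, of f] ev_superset[OF T A, of h] ev_superset[OF T A sub]
    by (auto simp: additive_familyD[OF T] sum.distrib)
qed

lemma ev_minus:
  assumes T: "additive_family T"
  shows "ev T (\<lambda>g. - f g) = - ev T f"
  by (simp add: ev_def additive_familyD[OF T] sum_negf)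

lemma ev_diff:
  assumes T: "additive_family T" and f: "fin_supp f" "fin_supp h"
  shows "ev T (\<lambda>g. f g - h g) = ev T f - ev T h"
  using ev_add[OF T f(1) fin_supp_simps(3)[OF f(2) f(2)]] ev_minus[OF T, of h] by simp

lemma ev_single:
  assumes T: "additive_family T"
  shows "ev T (single g c) = T g c"
proof -
  have "{h. single g c h \<noteq> 0} \<subseteq> {g}" by (auto simp: single_def)
  then show ?thesis using ev_superset[OF T, of "{g}" "single g c"] by (simp add: single_def)
qed

lemma fin_supp_single: "fin_supp (single g c)"
  unfolding fin_supp_def single_def by (rule finite_subset[of _ "{g}"]) auto

lemma ev_add_fun: "ev (\<lambda>g c. T g c + T' g c) f = ev T f + ev T' f"
  by (simp add: ev_def sum.distrib)

lemma ev_swap: "ev (\<lambda>g c. ev (\<lambda>h d. T g c h d) k) f = ev (\<lambda>h d. ev (\<lambda>g c. T g c h d) f) k"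
  unfolding ev_def by (rule sum.swap)

lemma ev_ext:
  fixes f h :: "'g \<Rightarrow> 'k::ab_group_add"
  assumes "fin_supp f" "fin_supp h" "\<And>T :: 'g \<Rightarrow> 'k \<Rightarrow> 'k. additive_family T \<Longrightarrow> ev T f = ev T h"
  shows "f = h"
proof (rule ext)
  fix x :: 'g
  define T where "T = (\<lambda>g (c::'k). if g = x then c else 0)"
  have T: "additive_family T" by (simp add: T_def additive_family_def)
  have "ev T f = f x" if "fin_supp f" for f
    using ev_superset[OF T, of "insert x {g. f g \<noteq> 0}" f] that
    by (auto simp: T_def sum.delta fin_supp_def)
  then show "f x = h x" using assms(3)[OF T] assms(1,2) by simp
qed

section \<open>The monoid algebra as a ring\<close>

locale monoid_ring = monoid M for M :: "('g, 'm) monoid_scheme" (structure) +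
  fixes R :: "('g \<Rightarrow> 'k::field) ring"
  defines "R \<equiv> monoid_algebra M"
begin

lemma R_simps: "carrier R = {f. {g. f g \<noteq> 0} \<subseteq> carrier M \<and> fin_supp f}"
  "\<one>\<^bsub>R\<^esub> = single \<one> 1" "\<zero>\<^bsub>R\<^esub> = (\<lambda>g. 0)" "f \<oplus>\<^bsub>R\<^esub> h = (\<lambda>g. f g + h g)"
  by (simp_all add: R_def monoid_algebra_def fin_supp_def)

lemma R_carrierD: "f \<in> carrier R \<Longrightarrow> fin_supp f" "f \<in> carrier R \<Longrightarrow> f g \<noteq> 0 \<Longrightarrow> g \<in> carrier M"
  by (auto simp: R_simps)

lemma mult_eq: "(f \<otimes>\<^bsub>R\<^esub> h) g = ev (\<lambda>u c. ev (\<lambda>v d. if u \<otimes> v = g then c * d else 0) h) f"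
  if f: "fin_supp f" and h: "fin_supp h"
proof -
  let ?A = "{u. f u \<noteq> 0}" and ?B = "{v. h v \<noteq> 0}"
  have "(f \<otimes>\<^bsub>R\<^esub> h) g = (\<Sum>(u, v)\<in>{(u, v). f u \<noteq> 0 \<and> h v \<noteq> 0 \<and> u \<otimes> v = g}. f u * h v)"
    by (simp add: R_def monoid_algebra_def)
  also have "\<dots> = (\<Sum>(u, v)\<in>?A \<times> ?B. if u \<otimes> v = g then f u * h v else 0)"
    using f h by (intro sum.mono_neutral_cong_left) (auto simp: fin_supp_def split: if_splits)
  finally show ?thesis by (simp add: ev_def sum.cartesian_product)
qed

lemma supp_mult:
  assumes f: "fin_supp f" and h: "fin_supp h"
  shows "{g. (f \<otimes>\<^bsub>R\<^esub> h) g \<noteq> 0} \<subseteq> (\<lambda>(u, v). u \<otimes> v) ` ({u. f u \<noteq> 0} \<times> {v. h v \<noteq> 0})"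
proof
  fix g assume "g \<in> {g. (f \<otimes>\<^bsub>R\<^esub> h) g \<noteq> 0}"
  then have "(\<Sum>(u, v)\<in>{(u, v). f u \<noteq> 0 \<and> h v \<noteq> 0 \<and> u \<otimes> v = g}. f u * h v) \<noteq> 0"
    by (simp add: R_def monoid_algebra_def)
  then obtain p where "p \<in> {(u, v). f u \<noteq> 0 \<and> h v \<noteq> 0 \<and> u \<otimes> v = g}"
    by (rule sum.not_neutral_contains_not_neutral)
  then show "g \<in> (\<lambda>(u, v). u \<otimes> v) ` ({u. f u \<noteq> 0} \<times> {v. h v \<noteq> 0})" by force
qed

lemma fin_supp_mult: "fin_supp f \<Longrightarrow> fin_supp h \<Longrightarrow> fin_supp (f \<otimes>\<^bsub>R\<^esub> h)"
  unfolding fin_supp_def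
  by (rule finite_subset[OF supp_mult]) (auto simp: fin_supp_def)

lemma mult_closed: "f \<in> carrier R \<Longrightarrow> h \<in> carrier R \<Longrightarrow> f \<otimes>\<^bsub>R\<^esub> h \<in> carrier R"
  using supp_mult[of f h] fin_supp_mult[of f h] by (fastforce simp: R_simps)

text \<open>Both sides sum over pairs of support elements; the left side groups the pairs by their
  product. This trades convolution for an iterated evaluation, after which the ring axioms follow
  from those of the monoid and the field.\<close>

lemma ev_mult:
  assumes T: "additive_family T" and f: "fin_supp f" and h: "fin_supp h"
  shows "ev T (f \<otimes>\<^bsub>R\<^esub> h) = ev (\<lambda>u c. ev (\<lambda>v d. T (u \<otimes> v) (c * d)) h) f"
proof -
  let ?A = "{u. f u \<noteq> 0}" and ?B = "{v. h v \<noteq> 0}"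
  let ?W = "(\<lambda>(u, v). u \<otimes> v) ` (?A \<times> ?B)"
  have W: "finite ?W" using f h by (auto simp: fin_supp_def)
  have "ev T (f \<otimes>\<^bsub>R\<^esub> h) = (\<Sum>g\<in>?W. T g ((f \<otimes>\<^bsub>R\<^esub> h) g))"
    by (rule ev_superset[OF T W supp_mult[OF f h]])
  also have "\<dots> = (\<Sum>g\<in>?W. \<Sum>u\<in>?A. \<Sum>v\<in>?B. if u \<otimes> v = g then T g (f u * h v) else 0)"
    by (intro sum.cong refl)
      (simp add: mult_eq[OF f h] ev_def additive_familyD[OF T] if_distrib[of "T _"] cong: if_cong)
  also have "\<dots> = (\<Sum>u\<in>?A. \<Sum>g\<in>?W. \<Sum>v\<in>?B. if u \<otimes> v = g then T g (f u * h v) else 0)"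
    by (rule sum.swap)
  also have "\<dots> = (\<Sum>u\<in>?A. \<Sum>v\<in>?B. \<Sum>g\<in>?W. if u \<otimes> v = g then T g (f u * h v) else 0)"
    by (rule sum.cong[OF refl]) (rule sum.swap)
  also have "\<dots> = (\<Sum>u\<in>?A. \<Sum>v\<in>?B. T (u \<otimes> v) (f u * h v))"
    by (rule sum.cong[OF refl], rule sum.cong[OF refl]) (subst sum.delta'[OF W], force)
  finally show ?thesis by (simp add: ev_def)
qed

lemma additive_left: "additive_family T \<Longrightarrow> additive_family (\<lambda>u c. ev (\<lambda>v d. T (u \<otimes> v) (c * d)) x)"
  for T :: "'g \<Rightarrow> 'k \<Rightarrow> 'b::ab_group_add"
  by (rule additive_familyI) (simp add: distrib_right additive_familyD(1) ev_add_fun)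

lemma additive_right: "additive_family T \<Longrightarrow> additive_family (\<lambda>v d. T (u \<otimes> v) (c * d))"
  for c :: 'k and T :: "'g \<Rightarrow> 'k \<Rightarrow> 'b::ab_group_add"
  by (rule additive_familyI) (simp add: distrib_left additive_familyD(1))

lemma R_eqI:
  assumes "f \<in> carrier R" "h \<in> carrier R"
    "\<And>T :: 'g \<Rightarrow> 'k \<Rightarrow> 'k. additive_family T \<Longrightarrow> ev T f = ev T h"
  shows "f = h"
  using assms ev_ext R_carrierD by metis

lemma single_in: "g \<in> carrier M \<Longrightarrow> single g c \<in> carrier R"
  by (auto simp: R_simps fin_supp_single) (auto simp: single_def split: if_splits)

lemma minus_in: "f \<in> carrier R \<Longrightarrow> (\<lambda>g. - f g) \<in> carrier R"
  by (auto simp: R_simps fin_supp_def)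

lemma ring_R: "ring R"
proof (intro ringI abelian_groupI monoidI)
  show "x \<oplus>\<^bsub>R\<^esub> y \<in> carrier R" if "x \<in> carrier R" "y \<in> carrier R" for x y
  proof -
    have "g \<in> carrier M" if "x g + y g \<noteq> 0" for g
      using that R_carrierD(2)[OF \<open>x \<in> carrier R\<close>, of g] R_carrierD(2)[OF \<open>y \<in> carrier R\<close>, of g]
      by (cases "x g = 0") auto
    then show ?thesis using that fin_supp_simps(1)[of x y] by (auto simp: R_simps)
  qed
  show "\<exists>y\<in>carrier R. y \<oplus>\<^bsub>R\<^esub> x = \<zero>\<^bsub>R\<^esub>" if "x \<in> carrier R" for x
    by (rule bexI[OF _ minus_in[OF that]]) (simp add: R_simps)
  show "x \<otimes>\<^bsub>R\<^esub> y \<in> carrier R" if "x \<in> carrier R" "y \<in> carrier R" for x y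
    using mult_closed that .
  show one: "\<one>\<^bsub>R\<^esub> \<in> carrier R" by (simp add: R_simps(2) single_in)
  show "\<zero>\<^bsub>R\<^esub> \<in> carrier R" by (simp add: R_simps fin_supp_def)
  show "x \<otimes>\<^bsub>R\<^esub> y \<otimes>\<^bsub>R\<^esub> z = x \<otimes>\<^bsub>R\<^esub> (y \<otimes>\<^bsub>R\<^esub> z)"
    if xyz: "x \<in> carrier R" "y \<in> carrier R" "z \<in> carrier R" for x y z
  proof (rule R_eqI)
    fix T :: "'g \<Rightarrow> 'k \<Rightarrow> 'k" assume T: "additive_family T"
    note fs = R_carrierD(1)[OF xyz(1)] R_carrierD(1)[OF xyz(2)] R_carrierD(1)[OF xyz(3)]
    note 1 = additive_left[OF T]
    note 2 = additive_right[OF T]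
    have "ev T (x \<otimes>\<^bsub>R\<^esub> y \<otimes>\<^bsub>R\<^esub> z) = ev (\<lambda>u c. ev (\<lambda>v d. ev (\<lambda>w e. T (u \<otimes> v \<otimes> w) (c * d * e)) z) y) x"
      by (simp add: ev_mult[OF T fin_supp_mult[OF fs(1,2)] fs(3)] ev_mult[OF 1 fs(1,2)])
    also have "\<dots> = ev (\<lambda>u c. ev (\<lambda>v d. ev (\<lambda>w e. T (u \<otimes> (v \<otimes> w)) (c * (d * e))) z) y) x"
      using xyz by (intro ev_cong) (simp add: R_carrierD m_assoc mult.assoc)
    also have "\<dots> = ev T (x \<otimes>\<^bsub>R\<^esub> (y \<otimes>\<^bsub>R\<^esub> z))"
      by (simp add: ev_mult[OF T fs(1) fin_supp_mult[OF fs(2,3)]] ev_mult[OF 2 fs(2,3)])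
    finally show "ev T (x \<otimes>\<^bsub>R\<^esub> y \<otimes>\<^bsub>R\<^esub> z) = ev T (x \<otimes>\<^bsub>R\<^esub> (y \<otimes>\<^bsub>R\<^esub> z))" .
  qed (use xyz mult_closed in auto)
  show "\<one>\<^bsub>R\<^esub> \<otimes>\<^bsub>R\<^esub> x = x" "x \<otimes>\<^bsub>R\<^esub> \<one>\<^bsub>R\<^esub> = x" if x: "x \<in> carrier R" for x
  proof -
    show "\<one>\<^bsub>R\<^esub> \<otimes>\<^bsub>R\<^esub> x = x"
    proof (rule R_eqI)
      fix T :: "'g \<Rightarrow> 'k \<Rightarrow> 'k" assume T: "additive_family T"
      note 1 = additive_left[OF T]
      show "ev T (\<one>\<^bsub>R\<^esub> \<otimes>\<^bsub>R\<^esub> x) = ev T x"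
        unfolding R_simps(2) ev_mult[OF T fin_supp_single R_carrierD(1)[OF x]] ev_single[OF 1]
        using x by (intro ev_cong) (simp add: R_carrierD)
    qed (use x one mult_closed in auto)
    show "x \<otimes>\<^bsub>R\<^esub> \<one>\<^bsub>R\<^esub> = x"
    proof (rule R_eqI)
      fix T :: "'g \<Rightarrow> 'k \<Rightarrow> 'k" assume T: "additive_family T"
      note 1 = additive_right[OF T]
      show "ev T (x \<otimes>\<^bsub>R\<^esub> \<one>\<^bsub>R\<^esub>) = ev T x"
        unfolding R_simps(2) ev_mult[OF T R_carrierD(1)[OF x] fin_supp_single] ev_single[OF 1]
        using x by (intro ev_cong) (simp add: R_carrierD)
    qed (use x one mult_closed in auto)
  qed
  show "(x \<oplus>\<^bsub>R\<^esub> y) \<otimes>\<^bsub>R\<^esub> z = x \<otimes>\<^bsub>R\<^esub> z \<oplus>\<^bsub>R\<^esub> y \<otimes>\<^bsub>R\<^esub> z"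
    "z \<otimes>\<^bsub>R\<^esub> (x \<oplus>\<^bsub>R\<^esub> y) = z \<otimes>\<^bsub>R\<^esub> x \<oplus>\<^bsub>R\<^esub> z \<otimes>\<^bsub>R\<^esub> y"
    if xyz: "x \<in> carrier R" "y \<in> carrier R" "z \<in> carrier R" for x y z
  proof -
    note fs = R_carrierD(1)[OF xyz(1)] R_carrierD(1)[OF xyz(2)] R_carrierD(1)[OF xyz(3)]
    note fa = fin_supp_simps(1)[OF fs(1,2)]
    have T: "additive_family (\<lambda>g' c. if g' = g then c else (0::'k))" for g :: 'g
      by (simp add: additive_family_def)
    note 1 = additive_left[OF T] and 2 = additive_right[OF T]
    show "(x \<oplus>\<^bsub>R\<^esub> y) \<otimes>\<^bsub>R\<^esub> z = x \<otimes>\<^bsub>R\<^esub> z \<oplus>\<^bsub>R\<^esub> y \<otimes>\<^bsub>R\<^esub> z"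
      by (simp add: R_simps(4) fun_eq_iff mult_eq[OF fa fs(3)] mult_eq[OF fs(1,3)] mult_eq[OF fs(2,3)] ev_add[OF 1 fs(1,2)])
    show "z \<otimes>\<^bsub>R\<^esub> (x \<oplus>\<^bsub>R\<^esub> y) = z \<otimes>\<^bsub>R\<^esub> x \<oplus>\<^bsub>R\<^esub> z \<otimes>\<^bsub>R\<^esub> y"
      by (simp add: R_simps(4) fun_eq_iff mult_eq[OF fs(3) fa] mult_eq[OF fs(3,1)] mult_eq[OF fs(3,2)] ev_add[OF 2 fs(1,2)] ev_add_fun)
  qed
qed (simp_all add: R_simps add_ac)

lemma single_mult: "g \<in> carrier M \<Longrightarrow> h \<in> carrier M \<Longrightarrow> single g c \<otimes>\<^bsub>R\<^esub> single h d = single (g \<otimes> h) (c * d)"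
proof (rule R_eqI)
  fix T :: "'g \<Rightarrow> 'k \<Rightarrow> 'k" assume T: "additive_family T"
  note 1 = additive_left[OF T]
  note 2 = additive_right[OF T]
  show "ev T (single g c \<otimes>\<^bsub>R\<^esub> single h d) = ev T (single (g \<otimes> h) (c * d))"
    unfolding ev_mult[OF T fin_supp_single fin_supp_single] ev_single[OF 1]
    unfolding ev_single[OF 2] ev_single[OF T] ..
qed (auto intro: mult_closed single_in)

lemma scalar_central:
  assumes x: "x \<in> carrier R"
  shows "single \<one> c \<otimes>\<^bsub>R\<^esub> x = (\<lambda>g. c * x g)" "x \<otimes>\<^bsub>R\<^esub> single \<one> c = (\<lambda>g. c * x g)"
proof -
  have cx: "(\<lambda>g. c * x g) \<in> carrier R" using x by (cases "c = 0") (auto simp: R_simps fin_supp_def)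
  note fx = R_carrierD(1)[OF x] R_carrierD(1)[OF cx]
  have ev_scale: "ev T (\<lambda>g. c * x g) = ev (\<lambda>g d. T g (c * d)) x" if T: "additive_family T"
    for T :: "'g \<Rightarrow> 'k \<Rightarrow> 'k"
    using ev_superset[OF T, of "{g. x g \<noteq> 0}" "\<lambda>g. c * x g"] fx(1) by (auto simp: fin_supp_def ev_def)
  show "single \<one> c \<otimes>\<^bsub>R\<^esub> x = (\<lambda>g. c * x g)"
  proof (rule R_eqI)
    fix T :: "'g \<Rightarrow> 'k \<Rightarrow> 'k" assume T: "additive_family T"
    note 1 = additive_left[OF T]
    show "ev T (single \<one> c \<otimes>\<^bsub>R\<^esub> x) = ev T (\<lambda>g. c * x g)"
      unfolding ev_mult[OF T fin_supp_single fx(1)] ev_single[OF 1] ev_scale[OF T]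
      using x by (intro ev_cong) (simp add: R_carrierD)
  qed (use x cx in \<open>auto intro: mult_closed single_in\<close>)
  show "x \<otimes>\<^bsub>R\<^esub> single \<one> c = (\<lambda>g. c * x g)"
  proof (rule R_eqI)
    fix T :: "'g \<Rightarrow> 'k \<Rightarrow> 'k" assume T: "additive_family T"
    note 1 = additive_right[OF T]
    show "ev T (x \<otimes>\<^bsub>R\<^esub> single \<one> c) = ev T (\<lambda>g. c * x g)"
      unfolding ev_mult[OF T fx(1) fin_supp_single] ev_single[OF 1] ev_scale[OF T]
      using x by (intro ev_cong) (simp add: R_carrierD mult.commute)
  qed (use x cx in \<open>auto intro: mult_closed single_in\<close>)
qed

end

section \<open>Algebras over a field\<close>

locale kalg = ring A for A :: "('k::field, 'a, 'm) module_scheme" (structure) +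
  assumes kalg: "k_algebra A"
begin

lemma vs: "vectorspace (class_ring :: 'k ring) A"
  and smult_mult: "x \<in> carrier A \<Longrightarrow> y \<in> carrier A \<Longrightarrow> (k \<odot> x) \<otimes> y = k \<odot> (x \<otimes> y)"
    "x \<in> carrier A \<Longrightarrow> y \<in> carrier A \<Longrightarrow> x \<otimes> (k \<odot> y) = k \<odot> (x \<otimes> y)"
  using kalg by (auto simp: k_algebra_def)

lemma mod: "Module.module (class_ring :: 'k ring) A"
  using vs by (simp add: vectorspace_def)

lemma smult_simps:
  "x \<in> carrier A \<Longrightarrow> k \<odot> x \<in> carrier A"
  "x \<in> carrier A \<Longrightarrow> (a + b) \<odot> x = a \<odot> x \<oplus> b \<odot> x"
  "x \<in> carrier A \<Longrightarrow> y \<in> carrier A \<Longrightarrow> k \<odot> (x \<oplus> y) = k \<odot> x \<oplus> k \<odot> y"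
  "x \<in> carrier A \<Longrightarrow> (a * b) \<odot> x = a \<odot> (b \<odot> x)"
  "x \<in> carrier A \<Longrightarrow> 1 \<odot> x = x"
  using mod by (auto simp: Module.module_def module_axioms_def)

lemma smult_zero:
  shows "x \<in> carrier A \<Longrightarrow> 0 \<odot> x = \<zero>" "k \<odot> \<zero> = \<zero>" "x \<in> carrier A \<Longrightarrow> (- k) \<odot> x = \<ominus> (k \<odot> x)"
proof -
  have 0: "0 \<odot> x = \<zero>" if "x \<in> carrier A" for x
    using smult_simps(2)[OF that, of 0 0] that smult_simps(1)[OF that, of 0]
    by (metis add.right_neutral add.r_cancel_one')
  show "x \<in> carrier A \<Longrightarrow> 0 \<odot> x = \<zero>" by (rule 0)
  show "k \<odot> \<zero> = \<zero>" using smult_simps(4)[of \<zero> k 0] 0[of \<zero>] by simp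
  show "(- k) \<odot> x = \<ominus> (k \<odot> x)" if x: "x \<in> carrier A"
    using smult_simps(2)[OF x, of "- k" k] 0[OF x] smult_simps(1)[OF x]
    by (intro minus_equality[symmetric]) auto
qed

section \<open>Coordinates and bases\<close>

text \<open>Indexed families are used rather than sets of vectors: the product basis is indexed by
  functions, and injectivity of a basis becomes a consequence of independence in
  \<open>indep_inj\<close>.\<close>

definition comb :: "('i \<Rightarrow> 'a) \<Rightarrow> 'i set \<Rightarrow> ('i \<Rightarrow> 'k) \<Rightarrow> 'a" where
  "comb b I k = (\<Oplus>i\<in>I. k i \<odot> b i)"

lemma comb_closed: "b \<in> I \<rightarrow> carrier A \<Longrightarrow> comb b I k \<in> carrier A"
  unfolding comb_def by (auto simp: Pi_iff intro!: finsum_closed smult_simps)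

lemma comb_add:
  assumes "b \<in> I \<rightarrow> carrier A"
  shows "comb b I (\<lambda>i. k i + k' i) = comb b I k \<oplus> comb b I k'"
proof -
  have "comb b I (\<lambda>i. k i + k' i) = (\<Oplus>i\<in>I. k i \<odot> b i \<oplus> k' i \<odot> b i)"
    unfolding comb_def using assms by (intro finsum_cong') (auto simp: Pi_iff smult_simps)
  also have "\<dots> = comb b I k \<oplus> comb b I k'"
    unfolding comb_def using assms by (intro finsum_addf) (auto simp: Pi_iff smult_simps)
  finally show ?thesis .
qed

lemma finsum_hom:
  fixes h :: "'a \<Rightarrow> 'b::comm_monoid_add"
  assumes "finite I" "f \<in> I \<rightarrow> carrier A" "h \<zero> = 0"
    "\<And>x y. x \<in> carrier A \<Longrightarrow> y \<in> carrier A \<Longrightarrow> h (x \<oplus> y) = h x + h y"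
  shows "h (finsum A f I) = (\<Sum>i\<in>I. h (f i))"
  using assms(1,2)
proof (induction I rule: finite_induct)
  case (insert i I)
  then show ?case using finsum_closed[of f I] by (simp add: assms(4))
qed (simp add: assms(3))

lemma finsum_endo:
  assumes "finite I" "f \<in> I \<rightarrow> carrier A" "h \<in> carrier A \<rightarrow> carrier A" "h \<zero> = \<zero>"
    "\<And>x y. x \<in> carrier A \<Longrightarrow> y \<in> carrier A \<Longrightarrow> h (x \<oplus> y) = h x \<oplus> h y"
  shows "h (finsum A f I) = (\<Oplus>i\<in>I. h (f i))"
  using assms(1,2)
proof (induction I rule: finite_induct)
  case (insert i I)
  then have "(\<lambda>i. h (f i)) \<in> I \<rightarrow> carrier A" "h (f i) \<in> carrier A" using assms(3) by auto
  then show ?case using insert finsum_closed[of f I] by (simp add: assms(5))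
qed (simp add: assms(4))

lemma comb_smult:
  assumes "finite I" "b \<in> I \<rightarrow> carrier A"
  shows "c \<odot> comb b I k = comb b I (\<lambda>i. c * k i)"
proof -
  have "c \<odot> comb b I k = (\<Oplus>i\<in>I. c \<odot> (k i \<odot> b i))"
    unfolding comb_def using assms
    by (intro finsum_endo) (auto simp: Pi_iff smult_simps smult_zero)
  also have "\<dots> = comb b I (\<lambda>i. c * k i)"
    unfolding comb_def using assms by (intro finsum_cong') (auto simp: Pi_iff smult_simps)
  finally show ?thesis .
qed

lemma comb_unit:
  assumes "finite I" "b \<in> I \<rightarrow> carrier A" "i \<in> I"
  shows "b i = comb b I (\<lambda>j. if j = i then 1 else 0)"
proof -
  have "comb b I (\<lambda>j. if j = i then 1 else 0) = (\<Oplus>j\<in>I. if i = j then b j else \<zero>)"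
    unfolding comb_def using assms by (intro finsum_cong') (auto simp: Pi_iff smult_simps smult_zero)
  also have "\<dots> = b i" using finsum_singleton[of i I b] assms by simp
  finally show ?thesis by simp
qed

definition spans :: "('i \<Rightarrow> 'a) \<Rightarrow> 'i set \<Rightarrow> bool" where
  "spans b I \<longleftrightarrow> b \<in> I \<rightarrow> carrier A \<and> (\<forall>x\<in>carrier A. \<exists>k. x = comb b I k)"

definition indep :: "('i \<Rightarrow> 'a) \<Rightarrow> 'i set \<Rightarrow> bool" where
  "indep b I \<longleftrightarrow> b \<in> I \<rightarrow> carrier A \<and> (\<forall>k. comb b I k = \<zero> \<longrightarrow> (\<forall>i\<in>I. k i = 0))"

lemma indep_unique:
  assumes "finite I" "indep b I" "comb b I k = comb b I k'" "i \<in> I"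
  shows "k i = k' i"
proof -
  have b: "b \<in> I \<rightarrow> carrier A" using assms(2) by (simp add: indep_def)
  have "comb b I (\<lambda>i. - 1 * k' i) = \<ominus> comb b I k'"
    unfolding comb_smult[OF assms(1) b, symmetric]
    using smult_zero(3)[OF comb_closed[OF b], of 1] smult_simps(5) comb_closed[OF b] by auto
  then have "comb b I (\<lambda>i. k i + - 1 * k' i) = \<zero>"
    unfolding comb_add[OF b] assms(3) using comb_closed[OF b] r_neg by auto
  then have "k i + - 1 * k' i = 0" using assms(2,4) unfolding indep_def by blast
  then show ?thesis by simp
qed

lemma comb_lincomb:
  assumes "finite I" "b \<in> I \<rightarrow> carrier A" "inj_on b I"
  shows "module.lincomb A a (b ` I) = comb b I (\<lambda>i. a (b i))"
proof -
  have "finsum A (\<lambda>v. a v \<odot> v) (b ` I) = finsum A (\<lambda>i. a (b i) \<odot> b i) I"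
    using assms by (intro finsum_reindex) (auto simp: Pi_iff smult_simps)
  then show ?thesis by (simp add: LinearCombinations.module.lincomb_def[OF mod] comb_def)
qed

lemma indep_inj:
  assumes "finite I" "indep b I"
  shows "inj_on b I"
proof (rule inj_onI)
  fix i j assume ij: "i \<in> I" "j \<in> I" "b i = b j"
  have b: "b \<in> I \<rightarrow> carrier A" using assms(2) by (simp add: indep_def)
  have "(if i = i then 1 else 0) = (if i = j then 1 else (0::'k))"
    by (rule indep_unique[OF assms _ ij(1)]) (simp add: comb_unit[OF assms(1) b, symmetric] ij)
  then show "i = j" by (simp split: if_splits)
qed

lemma indep_lin_indpt:
  assumes "finite I" "indep b I"
  shows "\<not> module.lin_dep class_ring A (b ` I)"
proof (rule LinearCombinations.module.finite_lin_indpt2[OF mod])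
  have b: "b \<in> I \<rightarrow> carrier A" using assms(2) by (simp add: indep_def)
  show "finite (b ` I)" "b ` I \<subseteq> carrier A" using assms(1) b by auto
  show "\<forall>v\<in>b ` I. a v = \<zero>\<^bsub>class_ring\<^esub>" if "module.lincomb A a (b ` I) = \<zero>" for a
    using that assms(2) unfolding comb_lincomb[OF assms(1) b indep_inj[OF assms]] indep_def by auto
qed

lemma basis_dim:
  assumes "finite I" "spans b I" "indep b I"
  shows "vectorspace.dim class_ring A = card I"
proof -
  have b: "b \<in> I \<rightarrow> carrier A" using assms(2) by (simp add: spans_def)
  note inj = indep_inj[OF assms(1,3)]
  have span: "LinearCombinations.module.span class_ring A (b ` I) = carrier A"
  proof (intro equalityI subsetI)
    fix x assume "x \<in> LinearCombinations.module.span class_ring A (b ` I)"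
    then obtain a where "x = module.lincomb A a (b ` I)"
      using LinearCombinations.module.finite_in_span[OF mod] assms(1) b by (metis finite_imageI image_subset_iff_funcset)
    then show "x \<in> carrier A" using comb_lincomb[OF assms(1) b inj] comb_closed[OF b] by simp
  next
    fix x assume "x \<in> carrier A"
    then obtain k where k: "x = comb b I k" using assms(2) unfolding spans_def by blast
    have "comb b I k = comb b I (\<lambda>i. (k \<circ> the_inv_into I b) (b i))"
      unfolding comb_def using b by (intro finsum_cong') (auto simp: Pi_iff the_inv_into_f_f[OF inj] smult_simps)
    then have "x = module.lincomb A (k \<circ> the_inv_into I b) (b ` I)"
      unfolding k comb_lincomb[OF assms(1) b inj] .
    then show "x \<in> LinearCombinations.module.span class_ring A (b ` I)"
      using LinearCombinations.module.finite_span[OF mod, of "b ` I"] assms(1) b by (auto simp: image_subset_iff_funcset)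
  qed
  have bas: "vectorspace.basis class_ring A (b ` I)"
    using indep_lin_indpt[OF assms(1,3)] span b by (simp add: vectorspace.basis_def[OF vs] image_subset_iff_funcset)
  then show ?thesis
    using vectorspace.dim_basis[OF vs _ bas] assms(1) inj by (simp add: card_image)
qed

lemma ex_basis:
  assumes fd: "vectorspace.fin_dim class_ring A"
  obtains b where "spans b {..<vectorspace.dim class_ring A}" "indep b {..<vectorspace.dim class_ring A}"
proof -
  let ?n = "vectorspace.dim class_ring A"
  obtain B where B: "finite B" "vectorspace.basis class_ring A B"
    using vectorspace.finite_basis_exists[OF vs fd] by blast
  have n: "card B = ?n" using vectorspace.dim_basis[OF vs B] by simp
  note B' = B(2)[unfolded vectorspace.basis_def[OF vs]]
  obtain b where b: "bij_betw b {..<?n} B"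
    using ex_bij_betw_nat_finite[OF B(1)] n by (auto simp: atLeast0LessThan)
  have bc: "b \<in> {..<?n} \<rightarrow> carrier A" and im: "b ` {..<?n} = B" and inj: "inj_on b {..<?n}"
    using b B' by (auto simp: bij_betw_def)
  have "spans b {..<?n}"
    unfolding spans_def
  proof (intro conjI ballI bc)
    fix x assume "x \<in> carrier A"
    then obtain a where "x = module.lincomb A a B"
      using B' LinearCombinations.module.finite_in_span[OF mod B(1)] by metis
    then show "\<exists>k. x = comb b {..<?n} k" using comb_lincomb[OF _ bc inj] im by auto
  qed
  moreover have "indep b {..<?n}"
    unfolding indep_def
  proof (intro conjI allI impI ballI bc)
    fix k i assume k: "comb b {..<?n} k = \<zero>" and i: "i \<in> {..<?n}"
    let ?a = "k \<circ> the_inv_into {..<?n} b"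
    have "comb b {..<?n} k = comb b {..<?n} (\<lambda>i. ?a (b i))"
      unfolding comb_def using bc by (intro finsum_cong') (auto simp: Pi_iff the_inv_into_f_f[OF inj] smult_simps)
    then have "module.lincomb A ?a B = \<zero>" using comb_lincomb[OF _ bc inj, of ?a] im k by simp
    then have "?a (b i) = 0"
      using B' B(1) i im unfolding LinearCombinations.module.lin_dep_def[OF mod] by fastforce
    then show "k i = 0" using i by (simp add: the_inv_into_f_f[OF inj])
  qed
  ultimately show thesis by (rule that)
qed

lemma indep_spans:
  assumes fd: "vectorspace.fin_dim class_ring A" and I: "finite I" "indep b I"
    and card: "card I = vectorspace.dim class_ring A"
  shows "spans b I"
proof -
  have b: "b \<in> I \<rightarrow> carrier A" using I(2) by (simp add: indep_def)
  note inj = indep_inj[OF I]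
  have "vectorspace.basis class_ring A (b ` I)"
    using vectorspace.dim_li_is_basis[OF vs fd, of "b ` I"] indep_lin_indpt[OF I] I b card
    by (simp add: card_image[OF inj] image_subset_iff_funcset)
  then have span: "LinearCombinations.module.span class_ring A (b ` I) = carrier A"
    by (simp add: vectorspace.basis_def[OF vs])
  show ?thesis
    unfolding spans_def
  proof (intro conjI ballI b)
    fix x assume "x \<in> carrier A"
    then obtain a where "x = module.lincomb A a (b ` I)"
      using span LinearCombinations.module.finite_in_span[OF mod, of "b ` I" x] I(1) b
      by (metis finite_imageI image_subset_iff_funcset)
    then show "\<exists>k. x = comb b I k" using comb_lincomb[OF I(1) b inj] by auto
  qed
qed

text \<open>\<open>M x\<close> is the matrix of left multiplication by \<open>x\<close> in the basis
  \<open>b\<close>. It determines \<open>x\<close>, because it determines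
  \<open>x \<otimes> \<one>\<close> once \<open>\<one>\<close> is expanded in the basis.\<close>

lemma ex_regular_representation:
  assumes b: "spans b {..<n}" "indep b {..<n}"
  obtains M where "M \<in> carrier A \<rightarrow> carrier_mat n n"
    "\<And>x y. x \<in> carrier A \<Longrightarrow> y \<in> carrier A \<Longrightarrow> M (x \<oplus> y) = M x + M y"
    "\<And>x y. x \<in> carrier A \<Longrightarrow> y \<in> carrier A \<Longrightarrow> M (x \<otimes> y) = M x * M y"
    "M \<one> = 1\<^sub>m n" "\<And>x k. x \<in> carrier A \<Longrightarrow> M (k \<odot> x) = k \<cdot>\<^sub>m M x" "inj_on M (carrier A)"
proof -
  let ?I = "{..<n}"
  have bc: "b \<in> ?I \<rightarrow> carrier A" using b by (simp add: spans_def)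
  define co where "co x = (SOME k. x = comb b ?I k)" for x
  have co: "x = comb b ?I (co x)" if "x \<in> carrier A" for x
    unfolding co_def using someI_ex[of "\<lambda>k. x = comb b ?I k"] b that by (auto simp: spans_def)
  have coI: "co x i = k i" if "x \<in> carrier A" "x = comb b ?I k" "i < n" for x k i
    using indep_unique[OF _ b(2), of "co x" k i] co[OF that(1)] that by simp
  have bi: "b j \<in> carrier A" if "j < n" for j using bc that by auto
  define M where "M x = mat n n (\<lambda>(i, j). co (x \<otimes> b j) i)" for x
  have Mb: "x \<otimes> b j = comb b ?I (\<lambda>i. M x $$ (i, j))" if "x \<in> carrier A" "j < n" for x j
  proof -
    have "comb b ?I (co (x \<otimes> b j)) = comb b ?I (\<lambda>i. M x $$ (i, j))"
      unfolding comb_def using that bi by (intro finsum_cong') (auto simp: Pi_iff M_def smult_simps)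
    then show ?thesis using co that bi by simp
  qed
  have MI: "M x $$ (i, j) = k i" if "x \<in> carrier A" "i < n" "j < n" "x \<otimes> b j = comb b ?I k" for x i j k
  proof -
    have "x \<otimes> b j \<in> carrier A" using that(1,3) bi by simp
    then show ?thesis using coI[OF _ that(4) that(2)] that(2,3) by (simp add: M_def)
  qed
  have dims: "dim_row (M x) = n" "dim_col (M x) = n" for x by (simp_all add: M_def)
  show thesis
  proof (rule that[of M])
    show "M \<in> carrier A \<rightarrow> carrier_mat n n" by (auto simp: M_def)
    show "M (x \<oplus> y) = M x + M y" if "x \<in> carrier A" "y \<in> carrier A" for x y
    proof (rule eq_matI)
      fix i j assume ij: "i < dim_row (M x + M y)" "j < dim_col (M x + M y)"
      then have "(x \<oplus> y) \<otimes> b j = x \<otimes> b j \<oplus> y \<otimes> b j" using that bi by (simp add: l_distr dims)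
      also have "\<dots> = comb b ?I (\<lambda>i. M x $$ (i, j) + M y $$ (i, j))"
        using that ij by (simp only: Mb comb_add[OF bc] dims index_add_mat)
      finally have "(x \<oplus> y) \<otimes> b j = comb b ?I (\<lambda>i. M x $$ (i, j) + M y $$ (i, j))" .
      then show "M (x \<oplus> y) $$ (i, j) = (M x + M y) $$ (i, j)"
        using MI ij that by (simp add: dims)
    qed (simp_all add: dims)
    show "M (k \<odot> x) = k \<cdot>\<^sub>m M x" if "x \<in> carrier A" for x k
    proof (rule eq_matI)
      fix i j assume ij: "i < dim_row (k \<cdot>\<^sub>m M x)" "j < dim_col (k \<cdot>\<^sub>m M x)"
      then have "(k \<odot> x) \<otimes> b j = comb b ?I (\<lambda>i. k * M x $$ (i, j))"
        using that bi by (simp add: smult_mult Mb comb_smult[OF _ bc] dims)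
      then show "M (k \<odot> x) $$ (i, j) = (k \<cdot>\<^sub>m M x) $$ (i, j)"
        using MI ij that by (simp add: dims smult_simps)
    qed (simp_all add: dims)
    show "M \<one> = 1\<^sub>m n"
    proof (rule eq_matI)
      fix i j assume ij: "i < dim_row (1\<^sub>m n)" "j < dim_col (1\<^sub>m n)"
      then have "\<one> \<otimes> b j = comb b ?I (\<lambda>i. if i = j then 1 else 0)"
        using bi comb_unit[OF _ bc, of j, symmetric] by simp
      then show "M \<one> $$ (i, j) = 1\<^sub>m n $$ (i, j)" using MI ij by simp
    qed (simp_all add: dims)
    show "inj_on M (carrier A)"
    proof (rule inj_onI)
      fix x y assume xy: "x \<in> carrier A" "y \<in> carrier A" "M x = M y"
      obtain k where k: "\<one> = comb b ?I k" using b by (auto simp: spans_def)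
      have e: "z \<otimes> comb b ?I k = (\<Oplus>j\<in>?I. z \<otimes> (k j \<odot> b j))" if "z \<in> carrier A" for z
        unfolding comb_def using that bc
        by (intro finsum_endo) (auto simp: Pi_iff r_distr smult_simps)
      have "x = x \<otimes> \<one>" using xy by simp
      also have "\<dots> = (\<Oplus>j\<in>?I. x \<otimes> (k j \<odot> b j))" unfolding k using e xy by simp
      also have "\<dots> = (\<Oplus>j\<in>?I. y \<otimes> (k j \<odot> b j))"
        using xy bi by (intro finsum_cong') (auto simp: smult_mult smult_simps Mb)
      also have "\<dots> = y \<otimes> \<one>" unfolding k using e xy by simp
      finally show "x = y" using xy by simp
    qed
    show "M (x \<otimes> y) = M x * M y" if xy: "x \<in> carrier A" "y \<in> carrier A" for x y
    proof (rule eq_matI)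
      fix i j assume ij: "i < dim_row (M x * M y)" "j < dim_col (M x * M y)"
      then have ij: "i < n" "j < n" by (simp_all add: dims)
      have "(x \<otimes> y) \<otimes> b j = x \<otimes> comb b ?I (\<lambda>m. M y $$ (m, j))"
        using xy ij bi by (simp only: m_assoc Mb)
      also have "\<dots> = (\<Oplus>m\<in>?I. x \<otimes> (M y $$ (m, j) \<odot> b m))"
        unfolding comb_def using xy bc by (intro finsum_endo) (auto simp: Pi_iff r_distr smult_simps)
      also have "\<dots> = (\<Oplus>m\<in>?I. comb b ?I (\<lambda>i. M y $$ (m, j) * M x $$ (i, m)))"
        using xy bi bc comb_closed[OF bc]
        by (intro finsum_cong') (auto simp: smult_mult Mb comb_smult[OF _ bc])
      finally have e: "(x \<otimes> y) \<otimes> b j = (\<Oplus>m\<in>?I. comb b ?I (\<lambda>i. M y $$ (m, j) * M x $$ (i, m)))" .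
      have "co ((x \<otimes> y) \<otimes> b j) i = (\<Sum>m<n. M y $$ (m, j) * M x $$ (i, m))"
      proof -
        \<comment> \<open>A single coordinate is an additive function by uniqueness of coordinates,
          so it may be taken termwise in \<open>e\<close>.\<close>
        have add: "co (u \<oplus> v) i = co u i + co v i" if "u \<in> carrier A" "v \<in> carrier A" for u v
        proof -
          have "u \<oplus> v = comb b ?I (\<lambda>i. co u i + co v i)"
            by (simp only: comb_add[OF bc] co[OF that(1), symmetric] co[OF that(2), symmetric])
          then show ?thesis using coI[OF _ _ ij(1)] that by blast
        qed
        have "co \<zero> i = 0" using add[OF zero_closed zero_closed] unfolding l_zero[OF zero_closed]
          by (metis add_cancel_right_right)
        then show ?thesis unfolding e
          using finsum_hom[of ?I _ "\<lambda>u. co u i"] add comb_closed[OF bc] coI[OF comb_closed[OF bc] refl] ij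
          by (simp add: Pi_def)
      qed
      then show "M (x \<otimes> y) $$ (i, j) = (M x * M y) $$ (i, j)"
        using ij dims xy by (simp add: M_def[of "x \<otimes> y"] scalar_prod_def lessThan_atLeast0 mult.commute)
    qed (simp_all add: dims)
  qed
qed

end

section \<open>Calculus with two anticommuting elements\<close>

context central_subalgebra
begin

text \<open>Oriented as rewrite rules: scalars move to the left, \<open>u\<close> moves in front of
  \<open>v\<close>, and repeated letters become scalars. Words thereby reach the normal form with
  respect to \<open>1, u, v, u v\<close>.\<close>

lemma uv_rules:
  assumes "u * u = \<iota> c" "v * v = \<iota> d" "u * v = - (v * u)"
  shows "v * u = - (u * v)" "v * (u * z) = - (u * (v * z))" "u * (u * z) = \<iota> c * z" "v * (v * z) = \<iota> d * z"
    "u * (\<iota> a * z) = \<iota> a * (u * z)" "v * (\<iota> a * z) = \<iota> a * (v * z)" "u * \<iota> a = \<iota> a * u" "v * \<iota> a = \<iota> a * v"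
proof -
  show "u * (\<iota> a * z) = \<iota> a * (u * z)" "v * (\<iota> a * z) = \<iota> a * (v * z)" by (rule \<iota>_left_commute)+
  show "u * \<iota> a = \<iota> a * u" "v * \<iota> a = \<iota> a * v" by (rule \<iota>_commute[symmetric])+
qed (use assms in \<open>simp_all add: mult.assoc[symmetric]\<close>)

text \<open>The multiplication of the quaternion algebra with parameters \<open>c\<close> and
  \<open>d\<close> in coordinates; the explicit splitting is checked against it.\<close>

lemma uv_mult:
  assumes r: "u * u = \<iota> c" "v * v = \<iota> d" "u * v = - (v * u)"
  shows "(\<iota> a0 + \<iota> a1 * u + \<iota> a2 * v + \<iota> a3 * (u * v)) * (\<iota> b0 + \<iota> b1 * u + \<iota> b2 * v + \<iota> b3 * (u * v))
    = \<iota> (a0 * b0 + a1 * b1 * c + a2 * b2 * d - a3 * b3 * c * d)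
      + \<iota> (a0 * b1 + a1 * b0 - a2 * b3 * d + a3 * b2 * d) * u
      + \<iota> (a0 * b2 + a2 * b0 + a1 * b3 * c - a3 * b1 * c) * v
      + \<iota> (a0 * b3 + a3 * b0 + a1 * b2 - a2 * b1) * (u * v)"
proof -
  note uv = uv_rules[OF r]
  note R = uv r(1,2)
  have 1: "u * (\<iota> x * u) = \<iota> (x * c)" "v * (\<iota> x * v) = \<iota> (x * d)"
    "u * (\<iota> x * (u * v)) = \<iota> (x * c) * v" "u * v * (\<iota> x * u) = \<iota> (- (x * c)) * v"
    "v * (\<iota> x * u) = \<iota> (- x) * (u * v)" "u * (\<iota> x * v) = \<iota> x * (u * v)"
    "v * (\<iota> x * (u * v)) = \<iota> (- (x * d)) * u" "u * v * (\<iota> x * v) = \<iota> (x * d) * u"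
    "u * v * (\<iota> x * (u * v)) = \<iota> (- (x * c * d))" for x
    by (simp_all add: mult.assoc R \<iota>_mult \<iota>_minus \<iota>_commute[of c "\<iota> d"])
  have 2: "(\<iota> x * p) * q = \<iota> x * (p * q)" for x p q by (rule mult.assoc)
  have 3: "p * \<iota> x = \<iota> x * p" for x p by (rule \<iota>_commute[symmetric])
  have 4: "\<iota> x * (\<iota> y * p) = \<iota> (x * y) * p" for x y p by (rule \<iota>_mult_left[symmetric])
  have "(\<iota> a0 + \<iota> a1 * u + \<iota> a2 * v + \<iota> a3 * (u * v)) * (\<iota> b0 + \<iota> b1 * u + \<iota> b2 * v + \<iota> b3 * (u * v))
    = \<iota> (a0 * b0) + \<iota> (a0 * b1) * u + \<iota> (a0 * b2) * v + \<iota> (a0 * b3) * (u * v)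
    + (\<iota> (a1 * b0) * u + \<iota> (a1 * (b1 * c)) + \<iota> (a1 * b2) * (u * v) + \<iota> (a1 * (b3 * c)) * v)
    + (\<iota> (a2 * b0) * v + \<iota> (a2 * - b1) * (u * v) + \<iota> (a2 * (b2 * d)) + \<iota> (a2 * - (b3 * d)) * u)
    + (\<iota> (a3 * b0) * (u * v) + \<iota> (a3 * - (b1 * c)) * v + \<iota> (a3 * (b2 * d)) * u + \<iota> (a3 * - (b3 * c * d)))"
    unfolding distrib_left distrib_right 2 1 4 \<iota>_mult[symmetric] 3[of u b0] 3[of v b0] 3[of "u * v" b0]
    by (simp only: add_ac)
  then show ?thesis
    by (simp only:) (simp add: \<iota>_add \<iota>_diff \<iota>_minus distrib_right left_diff_distrib mult.assoc mult.left_commute)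
qed

text \<open>Multiplication by \<open>v\<close> on both sides sends \<open>a + b u\<close> to
  \<open>d (a - b u)\<close>. So both combinations vanish, and so does \<open>2 a\<close>.\<close>

lemma u_indep:
  assumes r: "u * u = \<iota> c" "v * v = \<iota> d" "u * v = - (v * u)" and nz: "c \<noteq> 0" "d \<noteq> 0"
    and e: "\<iota> a + \<iota> b * u = 0"
  shows "a = 0 \<and> b = 0"
proof -
  note R = uv_rules[OF r] r(1,2)
  have "v * ((\<iota> a + \<iota> b * u) * v) = \<iota> d * (\<iota> a - \<iota> b * u)"
    by (simp add: distrib_left distrib_right right_diff_distrib mult.assoc R \<iota>_left_commute[of u])
      (simp add: R(8)[symmetric] r(2)[symmetric] mult.assoc \<iota>_commute)
  then have "\<iota> a - \<iota> b * u = 0" using nz unfolding e by (auto simp: \<iota>_scale_0)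
  then have "\<iota> a + \<iota> a = 0" using e by (metis add_cancel_left_right add_diff_cancel_left' diff_add_cancel eq_iff_diff_eq_0 minus_unique)
  then have "\<iota> a = 0" by (rule two_\<iota>)
  then have "a = 0" by (simp add: \<iota>_eq_0)
  moreover have "u \<noteq> 0" using r(1) nz(1) by (auto simp: \<iota>_eq_0)
  ultimately show ?thesis using e by (auto simp: \<iota>_0 \<iota>_scale_0)
qed

text \<open>Written as \<open>p + q v\<close> with \<open>p\<close> and \<open>q\<close> in the span
  of \<open>1\<close> and \<open>u\<close>, multiplication by \<open>u\<close> on both sides changes
  the sign of the second term up to the factor \<open>c\<close>. Hence \<open>p = q = 0\<close>, and
  \<open>u_indep\<close> finishes.\<close>

lemma uv_indep:
  assumes r: "u * u = \<iota> c" "v * v = \<iota> d" "u * v = - (v * u)" and nz: "c \<noteq> 0" "d \<noteq> 0"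
    and e: "\<iota> a0 + \<iota> a1 * u + \<iota> a2 * v + \<iota> a3 * (u * v) = 0"
  shows "a0 = 0 \<and> a1 = 0 \<and> a2 = 0 \<and> a3 = 0"
proof -
  note R = uv_rules[OF r] r(1,2)
  define p q where "p = \<iota> a0 + \<iota> a1 * u" and "q = \<iota> a2 + \<iota> a3 * u"
  have pq: "p + q * v = 0" using e by (simp add: p_def q_def distrib_right mult.assoc add_ac)
  have pu: "u * p = p * u" "u * q = q * u"
    by (simp_all add: p_def q_def distrib_left distrib_right R mult.assoc \<iota>_left_commute[of u])
  have "u * ((p + q * v) * u) = p * (u * u) - q * (u * u) * v"
  proof -
    have "u * (p * u) = p * (u * u)" "u * (q * (u * v)) = q * (u * (u * v))"
      by (metis mult.assoc pu)+
    then show ?thesis by (simp add: distrib_left distrib_right right_diff_distrib mult.assoc R(1))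
  qed
  then have "\<iota> c * (p - q * v) = 0"
    unfolding pq r(1) by (simp add: right_diff_distrib \<iota>_commute[of c p] \<iota>_commute[of c q] mult.assoc[symmetric])
  then have "p = q * v" using nz by (simp add: \<iota>_scale_0)
  then have p0: "p = 0" using pq two_\<iota>[of p] by simp
  then have "q * v * v = 0" using pq by simp
  then have "\<iota> d * q = 0" by (simp add: mult.assoc r(2) \<iota>_commute)
  then have q0: "q = 0" using nz by (simp add: \<iota>_scale_0)
  show ?thesis using u_indep[OF r nz] p0 q0 unfolding p_def q_def by blast
qed

end

lemma (in kalg) hom_comb:
  fixes h :: "'a \<Rightarrow> 'b::comm_monoid_add"
  assumes "finite I" "b \<in> I \<rightarrow> carrier A"
    "\<And>x y. x \<in> carrier A \<Longrightarrow> y \<in> carrier A \<Longrightarrow> h (x \<oplus> y) = h x + h y"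
    "h \<zero> = 0"
  shows "h (comb b I k) = (\<Sum>i\<in>I. h (k i \<odot> b i))"
  unfolding comb_def using assms by (intro finsum_hom) (auto simp: Pi_iff smult_simps)

lemma (in kalg) smult_one_inj:
  assumes "\<one> \<noteq> \<zero>" "a \<odot> \<one> = b \<odot> \<one>"
  shows "a = b"
proof (rule ccontr)
  assume "a \<noteq> b"
  have "(a + - b) \<odot> \<one> = \<zero>"
    using assms(2) smult_simps(2)[of \<one> a "- b"] smult_zero(3)[of \<one> b] smult_simps(1)[of \<one> b] r_neg by simp
  then have "(inverse (a - b) * (a - b)) \<odot> \<one> = \<zero>"
    using smult_simps(4)[of \<one> "inverse (a - b)" "a - b"] smult_zero(2) by simp
  then show False using \<open>a \<noteq> b\<close> assms(1) smult_simps(5)[of \<one>] by simp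
qed

text \<open>In characteristic two, \<open>- 1 = 1\<close> is a square.\<close>

lemma formally_real_two_neq_0:
  assumes "formally_real (F :: 'k::field set)" "1 \<in> F"
  shows "(2 :: 'k) \<noteq> 0"
proof
  assume "(2 :: 'k) = 0"
  then have "(1 :: 'k) = - 1" by (simp add: eq_neg_iff_add_eq_0)
  then have "set [1] \<subseteq> F \<and> (\<Sum>x\<leftarrow>[1 :: 'k]. x\<^sup>2) = - 1" using assms(2) by simp
  then show False using assms(1) unfolding formally_real_def by blast
qed

text \<open>An anti-automorphism preserves the centre, which consists of the scalars; so the
  description defining \<open>centre_restriction\<close> has a solution, and it is unique by
  \<open>smult_one_inj\<close>.\<close>

lemma centre_restriction:
  fixes A :: "('k::field, 'a, 'm) module_scheme"
  assumes A: "k_algebra A" "centre A = range (\<lambda>k. k \<odot>\<^bsub>A\<^esub> \<one>\<^bsub>A\<^esub>)" "\<one>\<^bsub>A\<^esub> \<noteq> \<zero>\<^bsub>A\<^esub>" and \<sigma>: "involution A \<sigma>"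
  shows "\<sigma> (k \<odot>\<^bsub>A\<^esub> \<one>\<^bsub>A\<^esub>) = centre_restriction A \<sigma> k \<odot>\<^bsub>A\<^esub> \<one>\<^bsub>A\<^esub>"
proof -
  interpret kalg A using A(1) by (simp add: kalg_def kalg_axioms_def k_algebra_def)
  have \<sigma>c: "\<sigma> x \<in> carrier A" "\<sigma> (\<sigma> x) = x" if "x \<in> carrier A" for x
    using that \<sigma> by (auto simp: involution_def)
  have "\<sigma> (k \<odot>\<^bsub>A\<^esub> \<one>\<^bsub>A\<^esub>) \<in> centre A"
    unfolding centre_def
  proof (intro CollectI conjI ballI)
    show "\<sigma> (k \<odot>\<^bsub>A\<^esub> \<one>\<^bsub>A\<^esub>) \<in> carrier A" by (intro \<sigma>c smult_simps one_closed)
    fix x assume x: "x \<in> carrier A"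
    have "k \<odot>\<^bsub>A\<^esub> \<one>\<^bsub>A\<^esub> \<in> centre A" using A(2) by blast
    then have "\<sigma> (k \<odot>\<^bsub>A\<^esub> \<one>\<^bsub>A\<^esub> \<otimes>\<^bsub>A\<^esub> \<sigma> x) = \<sigma> (\<sigma> x \<otimes>\<^bsub>A\<^esub> (k \<odot>\<^bsub>A\<^esub> \<one>\<^bsub>A\<^esub>))"
      using \<sigma>c[OF x] by (simp add: centre_def)
    then show "\<sigma> (k \<odot>\<^bsub>A\<^esub> \<one>\<^bsub>A\<^esub>) \<otimes>\<^bsub>A\<^esub> x = x \<otimes>\<^bsub>A\<^esub> \<sigma> (k \<odot>\<^bsub>A\<^esub> \<one>\<^bsub>A\<^esub>)"
      using \<sigma> \<sigma>c[OF x] x smult_simps(1)[OF one_closed, of k] unfolding involution_def by simp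
  qed
  then obtain c where c: "\<sigma> (k \<odot>\<^bsub>A\<^esub> \<one>\<^bsub>A\<^esub>) = c \<odot>\<^bsub>A\<^esub> \<one>\<^bsub>A\<^esub>" using A(2) by auto
  show ?thesis unfolding centre_restriction_def
    by (rule theI[of _ c]) (use c smult_one_inj[OF A(3)] in auto)
qed

section \<open>Adapted quaternion bases and splittings\<close>

text \<open>A basis \<open>b 0, \<dots>, b 3\<close> of the form \<open>1, u, v, uv\<close> adapted to the involution, and a splitting
  \<open>\<phi>\<close> over the algebraic closure given by its matrix entries.\<close>

definition adapted_basis :: "('k::field, 'q, 'm) module_scheme \<Rightarrow> ('q \<Rightarrow> 'q) \<Rightarrow> (nat \<Rightarrow> 'q) \<Rightarrow>
    (nat \<Rightarrow> 'k) \<Rightarrow> (nat \<Rightarrow> 'k) \<Rightarrow> ('q \<Rightarrow> nat \<Rightarrow> nat \<Rightarrow> 'k alg_closure) \<Rightarrow> bool" where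
  "adapted_basis Q \<sigma> b w \<epsilon> \<phi> \<longleftrightarrow>
     (\<forall>j<4. b j \<in> carrier Q) \<and> b 0 = \<one>\<^bsub>Q\<^esub> \<and>
     (\<forall>x\<in>carrier Q. \<exists>k. x = kalg.comb Q b {..<4} k) \<and>
     (\<forall>j<4. \<sigma> (b j) = \<epsilon> j \<odot>\<^bsub>Q\<^esub> b j \<and> (\<epsilon> j = 1 \<or> \<epsilon> j = - 1)) \<and> \<epsilon> 0 = 1 \<and>
     (\<forall>j<4. b j \<otimes>\<^bsub>Q\<^esub> b j = w j \<odot>\<^bsub>Q\<^esub> \<one>\<^bsub>Q\<^esub> \<and> w j \<noteq> 0 \<and> w j \<in> fixed_field Q \<sigma>) \<and>
     (\<forall>j<4. \<forall>m<4. j \<noteq> m \<longrightarrow> (\<exists>p<4. b p \<otimes>\<^bsub>Q\<^esub> (b j \<otimes>\<^bsub>Q\<^esub> b m)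
        = (- 1) \<odot>\<^bsub>Q\<^esub> ((b j \<otimes>\<^bsub>Q\<^esub> b m) \<otimes>\<^bsub>Q\<^esub> b p))) \<and>
     (\<forall>x\<in>carrier Q. \<forall>y\<in>carrier Q. \<forall>i<2. \<forall>j<2. \<phi> (x \<oplus>\<^bsub>Q\<^esub> y) i j = \<phi> x i j + \<phi> y i j \<and>
        \<phi> (x \<otimes>\<^bsub>Q\<^esub> y) i j = (\<Sum>m<2. \<phi> x i m * \<phi> y m j)) \<and>
     (\<forall>k. \<forall>x\<in>carrier Q. \<forall>i<2. \<forall>j<2. \<phi> (k \<odot>\<^bsub>Q\<^esub> x) i j = to_ac k * \<phi> x i j) \<and>
     (\<forall>i<2. \<forall>j<2. \<phi> \<one>\<^bsub>Q\<^esub> i j = (if i = j then 1 else 0))"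

lemma four_cases: "(j::nat) < 4 \<Longrightarrow> j = 0 \<or> j = 1 \<or> j = 2 \<or> j = 3" by linarith

lemma sum_four: "(\<Sum>i<(4::nat). f i) = f 0 + f 1 + f 2 + f 3"
  by (simp add: eval_nat_numeral add.assoc)

lemma sum_two: "(\<Sum>i<(2::nat). f i) = f 0 + f 1"
  by (simp add: numeral_2_eq_2)

lemma k_algebra_kalg: "k_algebra A \<Longrightarrow> kalg A"
  by (simp add: kalg_def kalg_axioms_def k_algebra_def)

lemma (in ring) simple_ring_one_neq_zero: "simple_ring R \<Longrightarrow> \<one> \<noteq> \<zero>"
  using one_zeroD by (auto simp: simple_ring_def)

text \<open>Transport along the embedding of the regular representation into a ring type.\<close>

lemma quaternion_embedding:
  fixes Q :: "('k::field, 'q, 'm) module_scheme"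
  assumes Q: "quaternion_algebra Q" and \<sigma>: "involution Q \<sigma>" and two: "(2 :: 'k) \<noteq> 0"
  obtains \<rho> s where
    "\<And>x y. x \<in> carrier Q \<Longrightarrow> y \<in> carrier Q \<Longrightarrow> \<rho> (x \<oplus>\<^bsub>Q\<^esub> y) = (\<rho> x + \<rho> y :: 'k rfm)"
    "\<And>x y. x \<in> carrier Q \<Longrightarrow> y \<in> carrier Q \<Longrightarrow> \<rho> (x \<otimes>\<^bsub>Q\<^esub> y) = \<rho> x * \<rho> y"
    "\<And>x k. x \<in> carrier Q \<Longrightarrow> \<rho> (k \<odot>\<^bsub>Q\<^esub> x) = rfm_scalar k * \<rho> x"
    "\<rho> \<one>\<^bsub>Q\<^esub> = 1" "\<rho> \<zero>\<^bsub>Q\<^esub> = 0" "inj_on \<rho> (carrier Q)"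
    "\<And>x. x \<in> carrier Q \<Longrightarrow> \<rho> (\<sigma> x) = s (\<rho> x)"
    "involutive_quaternion (\<rho> ` carrier Q) rfm_scalar s (centre_restriction Q \<sigma>)"
proof -
  have csa: "k_algebra Q" "vectorspace.fin_dim (class_ring :: 'k ring) Q"
    "centre Q = range (\<lambda>k. k \<odot>\<^bsub>Q\<^esub> \<one>\<^bsub>Q\<^esub>)" "simple_ring Q"
    and dim4: "vectorspace.dim (class_ring :: 'k ring) Q = 4"
    using Q by (auto simp: quaternion_algebra_def central_simple_algebra_def has_degree_def)
  interpret Q: kalg Q using k_algebra_kalg[OF csa(1)] .
  have one0: "\<one>\<^bsub>Q\<^esub> \<noteq> \<zero>\<^bsub>Q\<^esub>" using Q.simple_ring_one_neq_zero[OF csa(4)] .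
  obtain b0 where b0: "Q.spans b0 {..<4::nat}" "Q.indep b0 {..<4}" using Q.ex_basis[OF csa(2), unfolded dim4] by blast
  obtain M where M: "M \<in> carrier Q \<rightarrow> carrier_mat 4 4"
    "\<And>x y. x \<in> carrier Q \<Longrightarrow> y \<in> carrier Q \<Longrightarrow> M (x \<oplus>\<^bsub>Q\<^esub> y) = M x + M y"
    "\<And>x y. x \<in> carrier Q \<Longrightarrow> y \<in> carrier Q \<Longrightarrow> M (x \<otimes>\<^bsub>Q\<^esub> y) = M x * M y"
    "M \<one>\<^bsub>Q\<^esub> = 1\<^sub>m 4" "\<And>x k. x \<in> carrier Q \<Longrightarrow> M (k \<odot>\<^bsub>Q\<^esub> x) = k \<cdot>\<^sub>m M x" "inj_on M (carrier Q)"
    using Q.ex_regular_representation[OF b0] by blast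
  have Mc: "M x \<in> carrier_mat 4 4" if "x \<in> carrier Q" for x using M(1) that by blast
  define \<rho> where "\<rho> x = block_rfm 4 (M x)" for x
  have add: "\<rho> (x \<oplus>\<^bsub>Q\<^esub> y) = \<rho> x + \<rho> y" if "x \<in> carrier Q" "y \<in> carrier Q" for x y
    using that by (simp add: \<rho>_def M(2) block_rfm_hom(1)[OF _ Mc Mc])
  have mult: "\<rho> (x \<otimes>\<^bsub>Q\<^esub> y) = \<rho> x * \<rho> y" if "x \<in> carrier Q" "y \<in> carrier Q" for x y
    using that by (simp add: \<rho>_def M(3) block_rfm_hom(2)[OF _ Mc Mc])
  have smult: "\<rho> (k \<odot>\<^bsub>Q\<^esub> x) = rfm_scalar k * \<rho> x" if "x \<in> carrier Q" for x k
    using that by (simp add: \<rho>_def M(5) block_rfm_hom(4)[OF _ Mc Mc])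
  have one: "\<rho> \<one>\<^bsub>Q\<^esub> = 1"
    using block_rfm_hom(3)[OF _ Mc[OF Q.one_closed] Mc[OF Q.one_closed]] by (simp add: \<rho>_def M(4))
  have zero: "\<rho> \<zero>\<^bsub>Q\<^esub> = 0" using add[OF Q.zero_closed Q.zero_closed] by simp
  have inj: "inj_on \<rho> (carrier Q)"
    using M(6) block_rfm_hom(5)[of 4, OF _ Mc Mc] unfolding inj_on_def \<rho>_def by (metis zero_less_numeral)
  have scal: "rfm_scalar k = \<rho> (k \<odot>\<^bsub>Q\<^esub> \<one>\<^bsub>Q\<^esub>)" for k using smult[of "\<one>\<^bsub>Q\<^esub>" k] by (simp add: one)
  have \<sigma>c: "\<sigma> x \<in> carrier Q" "\<sigma> (\<sigma> x) = x" if "x \<in> carrier Q" for x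
    using that \<sigma> by (auto simp: involution_def)
  have \<sigma>a: "\<sigma> (x \<oplus>\<^bsub>Q\<^esub> y) = \<sigma> x \<oplus>\<^bsub>Q\<^esub> \<sigma> y" "\<sigma> (x \<otimes>\<^bsub>Q\<^esub> y) = \<sigma> y \<otimes>\<^bsub>Q\<^esub> \<sigma> x"
    if "x \<in> carrier Q" "y \<in> carrier Q" for x y using that \<sigma> by (auto simp: involution_def)
  \<comment> \<open>The involution is conjugated by \<open>\<rho>\<close>; it is meaningful on the
    image of the carrier.\<close>
  define s where "s z = \<rho> (\<sigma> (the_inv_into (carrier Q) \<rho> z))" for z
  have s: "s (\<rho> x) = \<rho> (\<sigma> x)" if "x \<in> carrier Q" for x
    using that by (simp add: s_def the_inv_into_f_f[OF inj])
  have comb: "\<rho> (Q.comb c {..<4} k) = rfm_scalar (k 0) * \<rho> (c 0) + rfm_scalar (k 1) * \<rho> (c 1)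
      + rfm_scalar (k 2) * \<rho> (c 2) + rfm_scalar (k 3) * \<rho> (c 3)" if "c \<in> {..<4::nat} \<rightarrow> carrier Q" for c k
    using Q.hom_comb[of "{..<4}" c \<rho> k] that add zero by (simp add: sum_four smult Pi_iff)
  have inQ: "involutive_quaternion (\<rho> ` carrier Q) rfm_scalar s (centre_restriction Q \<sigma>)"
  proof (unfold_locales)
    show "rfm_scalar (a + b) = rfm_scalar a + rfm_scalar b" "rfm_scalar 1 = 1" for a b :: 'k
      by (simp_all add: rfm_scalar_simps)
    show "rfm_scalar (a * b) = rfm_scalar a * rfm_scalar b" for a b :: 'k by (rule rfm_scalar_mult)
    show "rfm_scalar a * x = x * rfm_scalar a" for a :: 'k and x by (rule rfm_scalar_commute)
    show "rfm_scalar a \<in> \<rho> ` carrier Q" for a unfolding scal by (auto intro: Q.smult_simps)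
    show "x + y \<in> \<rho> ` carrier Q" if "x \<in> \<rho> ` carrier Q" "y \<in> \<rho> ` carrier Q" for x y
      using that by (auto simp: add[symmetric])
    show "x * y \<in> \<rho> ` carrier Q" if "x \<in> \<rho> ` carrier Q" "y \<in> \<rho> ` carrier Q" for x y
      using that by (auto simp: mult[symmetric])
    show "(2 :: 'k) \<noteq> 0" by (rule two)
    show "z \<in> range rfm_scalar" if z: "z \<in> \<rho> ` carrier Q" "\<And>x. x \<in> \<rho> ` carrier Q \<Longrightarrow> z * x = x * z" for z
    proof -
      obtain z' where z': "z' \<in> carrier Q" "z = \<rho> z'" using z by blast
      have "z' \<otimes>\<^bsub>Q\<^esub> x = x \<otimes>\<^bsub>Q\<^esub> z'" if "x \<in> carrier Q" for x
      proof (rule inj_onD[OF inj])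
        show "\<rho> (z' \<otimes>\<^bsub>Q\<^esub> x) = \<rho> (x \<otimes>\<^bsub>Q\<^esub> z')" using z(2)[of "\<rho> x"] that z' by (simp add: mult)
      qed (use that z' in auto)
      then have "z' \<in> centre Q" using z' by (simp add: centre_def)
      then show ?thesis using csa(3) z' scal by auto
    qed
    show "1 \<in> I" if I: "I \<subseteq> \<rho> ` carrier Q" and Iadd: "\<And>x y. x \<in> I \<Longrightarrow> y \<in> I \<Longrightarrow> x + y \<in> I"
      and Il: "\<And>x y. x \<in> \<rho> ` carrier Q \<Longrightarrow> y \<in> I \<Longrightarrow> x * y \<in> I"
      and Ir: "\<And>x y. x \<in> \<rho> ` carrier Q \<Longrightarrow> y \<in> I \<Longrightarrow> y * x \<in> I" and z: "z \<in> I" "z \<noteq> 0" for I z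
    proof -
      \<comment> \<open>The preimage of the ideal in \<open>Q\<close>, where simplicity is
        available. Negatives stay inside, being products with the scalar \<open>- 1\<close>.\<close>
      define I' where "I' = {x \<in> carrier Q. \<rho> x \<in> I}"
      have neg: "\<ominus>\<^bsub>Q\<^esub> x \<in> I'" if "x \<in> I'" for x
      proof -
        have x: "x \<in> carrier Q" "\<rho> x \<in> I" using that by (auto simp: I'_def)
        have "\<ominus>\<^bsub>Q\<^esub> x = (- 1) \<odot>\<^bsub>Q\<^esub> x" using x Q.smult_zero(3)[of x 1] Q.smult_simps(5) by simp
        then have "\<rho> (\<ominus>\<^bsub>Q\<^esub> x) = \<rho> ((- 1) \<odot>\<^bsub>Q\<^esub> \<one>\<^bsub>Q\<^esub>) * \<rho> x" using x by (simp add: smult one)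
        moreover have "\<rho> ((- 1) \<odot>\<^bsub>Q\<^esub> \<one>\<^bsub>Q\<^esub>) * \<rho> x \<in> I" by (rule Il[OF _ x(2)]) (simp add: Q.smult_simps(1))
        ultimately show ?thesis using x(1) by (simp add: I'_def)
      qed
      have z': "\<exists>z'\<in>I'. z' \<noteq> \<zero>\<^bsub>Q\<^esub>" using z I zero by (auto simp: I'_def)
      have zeroI: "\<zero>\<^bsub>Q\<^esub> \<in> I'"
      proof -
        obtain y where y: "y \<in> I'" using z' by blast
        then have "\<rho> (y \<oplus>\<^bsub>Q\<^esub> \<ominus>\<^bsub>Q\<^esub> y) \<in> I" using neg[OF y] Iadd by (simp add: add I'_def)
        then show ?thesis using y by (simp add: I'_def Q.r_neg)
      qed
      have "ideal I' Q"
      proof (rule idealI)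
        show "subgroup I' (add_monoid Q)"
          using neg zeroI Iadd add by (intro Q.add.subgroupI) (auto simp: I'_def a_inv_def)
        show "x \<otimes>\<^bsub>Q\<^esub> a \<in> I'" "a \<otimes>\<^bsub>Q\<^esub> x \<in> I'" if "a \<in> I'" "x \<in> carrier Q" for a x
          using that Il Ir mult by (auto simp: I'_def)
      qed (rule Q.ring_axioms)
      then have "I' = carrier Q" using csa(4) z' unfolding simple_ring_def by blast
      then have "\<one>\<^bsub>Q\<^esub> \<in> I'" by simp
      then show ?thesis by (simp add: I'_def one)
    qed
    show "\<exists>a b c d. y = rfm_scalar a * x1 + rfm_scalar b * x2 + rfm_scalar c * x3 + rfm_scalar d * x4"
      if x: "x1 \<in> \<rho> ` carrier Q" "x2 \<in> \<rho> ` carrier Q" "x3 \<in> \<rho> ` carrier Q" "x4 \<in> \<rho> ` carrier Q"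
        and ind: "\<And>a b c d. rfm_scalar a * x1 + rfm_scalar b * x2 + rfm_scalar c * x3 + rfm_scalar d * x4 = 0
          \<Longrightarrow> a = 0 \<and> b = 0 \<and> c = 0 \<and> d = 0" and y: "y \<in> \<rho> ` carrier Q" for x1 x2 x3 x4 y
    proof -
      obtain y1 y2 y3 y4 where y': "y1 \<in> carrier Q" "y2 \<in> carrier Q" "y3 \<in> carrier Q" "y4 \<in> carrier Q"
        "x1 = \<rho> y1" "x2 = \<rho> y2" "x3 = \<rho> y3" "x4 = \<rho> y4" using x by blast
      define c where "c i = (if i = 0 then y1 else if i = 1 then y2 else if i = 2 then y3 else y4)" for i :: nat
      have c: "c \<in> {..<4} \<rightarrow> carrier Q" using y' by (auto simp: c_def)
      have cv: "\<rho> (c 0) = x1" "\<rho> (c 1) = x2" "\<rho> (c 2) = x3" "\<rho> (c 3) = x4" using y' by (simp_all add: c_def)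
      have "Q.indep c {..<4}"
        unfolding Q.indep_def
      proof (intro conjI c allI impI ballI)
        fix k i assume "Q.comb c {..<4} k = \<zero>\<^bsub>Q\<^esub>" and i: "i \<in> {..<4::nat}"
        then have "k 0 = 0 \<and> k 1 = 0 \<and> k 2 = 0 \<and> k 3 = 0" using comb[OF c, of k] zero by (intro ind) (simp add: cv del: One_nat_def)
        then show "k i = 0" using i four_cases by force
      qed
      then have "Q.spans c {..<4}" by (intro Q.indep_spans[OF csa(2)]) (simp_all add: dim4)
      then obtain k where "y = \<rho> (Q.comb c {..<4} k)" using y unfolding Q.spans_def by force
      then show ?thesis using comb[OF c, of k] cv by metis
    qed
    show "\<exists>x\<in>\<rho> ` carrier Q. x \<notin> range rfm_scalar"
    proof (rule ccontr)
      assume n: "\<not> ?thesis"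
      \<comment> \<open>If every element were a scalar, \<open>\<one>\<close> alone would be a
        basis, against dimension four.\<close>
      have "Q.spans (\<lambda>_. \<one>\<^bsub>Q\<^esub>) {0::nat}"
        unfolding Q.spans_def
      proof (intro conjI ballI)
        fix x assume x: "x \<in> carrier Q"
        then obtain k where "\<rho> x = \<rho> (k \<odot>\<^bsub>Q\<^esub> \<one>\<^bsub>Q\<^esub>)" using n scal by auto
        then have "x = k \<odot>\<^bsub>Q\<^esub> \<one>\<^bsub>Q\<^esub>" using x Q.smult_simps(1) by (intro inj_onD[OF inj]) auto
        then show "\<exists>k. x = Q.comb (\<lambda>_. \<one>\<^bsub>Q\<^esub>) {0::nat} k"
          by (intro exI[of _ "\<lambda>_. k"]) (simp add: Q.comb_def Q.smult_simps)
      qed simp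
      moreover have "Q.indep (\<lambda>_. \<one>\<^bsub>Q\<^esub>) {0::nat}"
        unfolding Q.indep_def
        using Q.smult_one_inj[OF one0, of _ 0] by (auto simp: Q.comb_def Q.smult_simps Q.smult_zero)
      ultimately show False using Q.basis_dim[of "{0::nat}" "\<lambda>_. \<one>\<^bsub>Q\<^esub>"] dim4 by simp
    qed
    show "s x \<in> \<rho> ` carrier Q" if "x \<in> \<rho> ` carrier Q" for x using that s \<sigma>c by auto
    show "s (x + y) = s x + s y" "s (x * y) = s y * s x"
      if xy: "x \<in> \<rho> ` carrier Q" "y \<in> \<rho> ` carrier Q" for x y
    proof -
      obtain x' y' where "x' \<in> carrier Q" "y' \<in> carrier Q" "x = \<rho> x'" "y = \<rho> y'" using xy by blast
      then show "s (x + y) = s x + s y" "s (x * y) = s y * s x"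
        by (simp_all add: s \<sigma>a \<sigma>c add[symmetric] mult[symmetric])
    qed
    show "s (s x) = x" if "x \<in> \<rho> ` carrier Q" for x using that s \<sigma>c by auto
    show "s (rfm_scalar k) = rfm_scalar (centre_restriction Q \<sigma> k)" for k
      unfolding scal using centre_restriction[OF csa(1,3) one0 \<sigma>, of k] s Q.smult_simps(1) by simp
  qed
  show thesis by (rule that[OF add mult smult one zero inj s[symmetric] inQ])
qed

theorem ex_adapted_basis:
  fixes Q :: "('k::field, 'q, 'm) module_scheme"
  assumes Q: "quaternion_algebra Q" and \<sigma>: "involution Q \<sigma>" and two: "(2 :: 'k) \<noteq> 0"
  obtains b w \<epsilon> \<phi> where "adapted_basis Q \<sigma> b w \<epsilon> \<phi>"
proof -
  have csa: "k_algebra Q" "centre Q = range (\<lambda>k. k \<odot>\<^bsub>Q\<^esub> \<one>\<^bsub>Q\<^esub>)" "simple_ring Q"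
    using Q by (auto simp: quaternion_algebra_def central_simple_algebra_def)
  interpret Q: kalg Q using k_algebra_kalg[OF csa(1)] .
  have one0: "\<one>\<^bsub>Q\<^esub> \<noteq> \<zero>\<^bsub>Q\<^esub>" using Q.simple_ring_one_neq_zero[OF csa(3)] .
  obtain \<rho> s where add: "\<And>x y. x \<in> carrier Q \<Longrightarrow> y \<in> carrier Q \<Longrightarrow> \<rho> (x \<oplus>\<^bsub>Q\<^esub> y) = (\<rho> x + \<rho> y :: 'k rfm)"
    and mult: "\<And>x y. x \<in> carrier Q \<Longrightarrow> y \<in> carrier Q \<Longrightarrow> \<rho> (x \<otimes>\<^bsub>Q\<^esub> y) = \<rho> x * \<rho> y"
    and smult: "\<And>x k. x \<in> carrier Q \<Longrightarrow> \<rho> (k \<odot>\<^bsub>Q\<^esub> x) = rfm_scalar k * \<rho> x"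
    and one: "\<rho> \<one>\<^bsub>Q\<^esub> = 1" and zero: "\<rho> \<zero>\<^bsub>Q\<^esub> = 0" and inj: "inj_on \<rho> (carrier Q)"
    and s: "\<And>x. x \<in> carrier Q \<Longrightarrow> \<rho> (\<sigma> x) = s (\<rho> x)"
    and iq: "involutive_quaternion (\<rho> ` carrier Q) rfm_scalar s (centre_restriction Q \<sigma>)"
    using quaternion_embedding[OF Q \<sigma> two] by blast
  interpret S: involutive_quaternion "\<rho> ` carrier Q" rfm_scalar s "centre_restriction Q \<sigma>" by (rule iq)
  have eqI: "x = y" if "\<rho> x = \<rho> y" "x \<in> carrier Q" "y \<in> carrier Q" for x y using that inj by (metis inj_onD)
  obtain ru rv c d where uv: "ru \<in> \<rho> ` carrier Q" "rv \<in> \<rho> ` carrier Q" "ru * ru = rfm_scalar c" "rv * rv = rfm_scalar d"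
    "ru * rv = - (rv * ru)" "c \<noteq> 0" "d \<noteq> 0" "centre_restriction Q \<sigma> c = c" "centre_restriction Q \<sigma> d = d"
    "s ru = ru \<or> s ru = - ru" "s rv = rv \<or> s rv = - rv"
    by (rule S.ex_quaternion_basis)
  obtain u v where u: "u \<in> carrier Q" "ru = \<rho> u" and v: "v \<in> carrier Q" "rv = \<rho> v" using uv(1,2) by blast
  define b where "b j = (if j = 0 then \<one>\<^bsub>Q\<^esub> else if j = 1 then u else if j = 2 then v else u \<otimes>\<^bsub>Q\<^esub> v)" for j :: nat
  have bc: "b \<in> {..<4} \<rightarrow> carrier Q" using u v by (auto simp: b_def)
  then have bj: "b j \<in> carrier Q" if "j < 4" for j using that by auto
  have rb: "\<rho> (b 0) = 1" "\<rho> (b 1) = ru" "\<rho> (b 2) = rv" "\<rho> (b 3) = ru * rv"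
    using u v by (simp_all add: b_def one mult)
  have comb: "\<rho> (Q.comb b {..<4} k) = rfm_scalar (k 0) + rfm_scalar (k 1) * ru
      + rfm_scalar (k 2) * rv + rfm_scalar (k 3) * (ru * rv)" for k
    using Q.hom_comb[of "{..<4}" b \<rho> k] bc bj add zero rb by (simp add: sum_four smult)
  have span: "\<exists>k. x = Q.comb b {..<4} k" if x: "x \<in> carrier Q" for x
  proof -
    have "\<exists>k0 k1 k2 k3. \<rho> x = rfm_scalar k0 * 1 + rfm_scalar k1 * ru + rfm_scalar k2 * rv + rfm_scalar k3 * (ru * rv)"
    proof (rule S.dim)
      show "a = 0 \<and> b = 0 \<and> c = 0 \<and> d = 0"
        if "rfm_scalar a * 1 + rfm_scalar b * ru + rfm_scalar c * rv + rfm_scalar d * (ru * rv) = 0" for a b c d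
        using S.uv_indep[OF uv(3,4,5,6,7), of a b c d] that by simp
    qed (use uv x S.S_closed in auto)
    then obtain k0 k1 k2 k3 where k: "\<rho> x = rfm_scalar k0 + rfm_scalar k1 * ru + rfm_scalar k2 * rv + rfm_scalar k3 * (ru * rv)"
      by auto
    define k where "k j = (if j = 0 then k0 else if j = 1 then k1 else if j = 2 then k2 else k3)" for j :: nat
    have "\<rho> x = \<rho> (Q.comb b {..<4} k)" unfolding comb k by (simp add: k_def)
    then show ?thesis using eqI x Q.comb_closed[OF bc] by blast
  qed
  \<comment> \<open>The last value is the square of \<open>u v\<close>, which equals
    \<open>- c d\<close>. Likewise \<open>s (u v) = s v s u\<close> picks up a sign from reordering,
    whence the last value of \<open>\<epsilon>\<close> below.\<close>
  define w where "w j = (if j = 0 then 1 else if j = 1 then c else if j = 2 then d else - (c * d))" for j :: nat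
  define eu ev where "eu = (if s ru = ru then 1 else - 1 :: 'k)" and "ev = (if s rv = rv then 1 else - 1 :: 'k)"
  define \<epsilon> where "\<epsilon> j = (if j = 0 then 1 else if j = 1 then eu else if j = 2 then ev else - (ev * eu))" for j :: nat
  have suv: "s ru = rfm_scalar eu * ru" "s rv = rfm_scalar ev * rv"
    using uv(10,11) by (auto simp: eu_def ev_def S.\<iota>_minus S.\<iota>_one)
  note R = S.uv_rules[OF uv(3,4,5)] uv(3,4)
  have j4: "j = 0 \<or> j = 1 \<or> j = 2 \<or> j = 3" if "j < 4" for j :: nat using that by (rule four_cases)
  have eps: "\<sigma> (b j) = \<epsilon> j \<odot>\<^bsub>Q\<^esub> b j" if j: "j < 4" for j
  proof (rule eqI)
    have "s (ru * rv) = rfm_scalar (- (ev * eu)) * (ru * rv)"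
      using S.s_mult[OF uv(1,2)] unfolding suv
      by (simp add: mult.assoc S.\<iota>_mult S.\<iota>_minus R(1) S.\<iota>_left_commute[of rv])
    then have "s (\<rho> (b j)) = rfm_scalar (\<epsilon> j) * \<rho> (b j)"
      using j4[OF j] suv S.s_1 rb by (auto simp: \<epsilon>_def S.\<iota>_one)
    then show "\<rho> (\<sigma> (b j)) = \<rho> (\<epsilon> j \<odot>\<^bsub>Q\<^esub> b j)" using s smult bj[OF j] by simp
  qed (use \<sigma> bj[OF j] Q.smult_simps(1) in \<open>auto simp: involution_def\<close>)
  have sq: "b j \<otimes>\<^bsub>Q\<^esub> b j = w j \<odot>\<^bsub>Q\<^esub> \<one>\<^bsub>Q\<^esub>" if j: "j < 4" for j
  proof (rule eqI)
    have "ru * rv * (ru * rv) = rfm_scalar (- (c * d))"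
      by (simp add: mult.assoc R S.\<iota>_minus S.\<iota>_mult S.\<iota>_commute[of d "rfm_scalar c"])
    then show "\<rho> (b j \<otimes>\<^bsub>Q\<^esub> b j) = \<rho> (w j \<odot>\<^bsub>Q\<^esub> \<one>\<^bsub>Q\<^esub>)"
      using j4[OF j] bj[OF j] uv(3,4) rb by (auto simp: mult smult one w_def S.\<iota>_one)
  qed (use bj[OF j] Q.smult_simps(1) in auto)
  have w0: "w j \<noteq> 0" for j using uv(6,7) by (simp add: w_def)
  have wF: "w j \<in> fixed_field Q \<sigma>" for j
  proof -
    have "centre_restriction Q \<sigma> (w j) = w j"
      using uv(8,9) S.\<tau>_simps by (simp add: w_def)
    then show ?thesis using centre_restriction[OF csa(1,2) one0 \<sigma>, of "w j"] by (simp add: fixed_field_def)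
  qed
  \<comment> \<open>A product of two different basis elements is a scalar multiple of
    \<open>u\<close>, \<open>v\<close> or \<open>u v\<close>. The element \<open>v\<close>
    anticommutes with the first, \<open>u\<close> with the other two; the case distinction singles
    out the products proportional to \<open>u\<close>.\<close>
  have anti: "\<exists>p<4. b p \<otimes>\<^bsub>Q\<^esub> (b j \<otimes>\<^bsub>Q\<^esub> b m) = (- 1) \<odot>\<^bsub>Q\<^esub> ((b j \<otimes>\<^bsub>Q\<^esub> b m) \<otimes>\<^bsub>Q\<^esub> b p)"
    if jm: "j < 4" "m < 4" "j \<noteq> m" for j m
  proof -
    have "\<exists>p<4. \<rho> (b p) * (\<rho> (b j) * \<rho> (b m)) = - (\<rho> (b j) * \<rho> (b m) * \<rho> (b p))"
    proof (cases "{j, m} = {0, 1} \<or> {j, m} = {2, 3}")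
      case True
      then show ?thesis by (intro exI[of _ 2]) (auto simp del: One_nat_def simp: rb doubleton_eq_iff mult.assoc R)
    next
      case False
      then show ?thesis using j4[OF jm(1)] j4[OF jm(2)] jm(3)
        by (intro exI[of _ 1]) (auto simp del: One_nat_def simp: rb mult.assoc R)
    qed
    then obtain p where p: "p < 4" "\<rho> (b p) * (\<rho> (b j) * \<rho> (b m)) = - (\<rho> (b j) * \<rho> (b m) * \<rho> (b p))" by blast
    have "b p \<otimes>\<^bsub>Q\<^esub> (b j \<otimes>\<^bsub>Q\<^esub> b m) = (- 1) \<odot>\<^bsub>Q\<^esub> ((b j \<otimes>\<^bsub>Q\<^esub> b m) \<otimes>\<^bsub>Q\<^esub> b p)"
      by (rule eqI) (use p bj jm in \<open>simp_all add: mult smult S.\<iota>_minus S.\<iota>_one Q.smult_simps(1)\<close>)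
    then show ?thesis using p(1) by blast
  qed
  \<comment> \<open>The square root of \<open>c\<close> that the splitting needs may be missing in
    the base field; this is where the algebraic closure enters.\<close>
  obtain r where r: "r ^ 2 = to_ac c" using nth_root_exists[of 2 "to_ac c"] by auto
  define co where "co x = (SOME k. x = Q.comb b {..<4} k)" for x
  have co: "x = Q.comb b {..<4} (co x)" if "x \<in> carrier Q" for x
    unfolding co_def using someI_ex[OF span[OF that]] .
  have coI: "co x 0 = k0 \<and> co x 1 = k1 \<and> co x 2 = k2 \<and> co x 3 = k3" if "x \<in> carrier Q"
    "\<rho> x = rfm_scalar k0 + rfm_scalar k1 * ru + rfm_scalar k2 * rv + rfm_scalar k3 * (ru * rv)" for x k0 k1 k2 k3
  proof -
    have "rfm_scalar (co x 0) + rfm_scalar (co x 1) * ru + rfm_scalar (co x 2) * rv + rfm_scalar (co x 3) * (ru * rv)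
       = rfm_scalar k0 + rfm_scalar k1 * ru + rfm_scalar k2 * rv + rfm_scalar k3 * (ru * rv)"
      using that co[OF that(1)] comb[of "co x"] by metis
    then have "rfm_scalar (co x 0 - k0) + rfm_scalar (co x 1 - k1) * ru + rfm_scalar (co x 2 - k2) * rv
       + rfm_scalar (co x 3 - k3) * (ru * rv) = 0"
      by (simp add: S.\<iota>_diff left_diff_distrib algebra_simps)
    then show ?thesis using S.uv_indep[OF uv(3,4,5,6,7)] by fastforce
  qed
  have \<rho>co: "\<rho> x = rfm_scalar (co x 0) + rfm_scalar (co x 1) * ru + rfm_scalar (co x 2) * rv + rfm_scalar (co x 3) * (ru * rv)"
    if "x \<in> carrier Q" for x using co[OF that] comb[of "co x"] by metis
  \<comment> \<open>The splitting sends \<open>u\<close> to the diagonal matrix with entries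
    \<open>r\<close> and \<open>- r\<close>, and \<open>v\<close> to the antidiagonal matrix with
    entries \<open>d\<close> in the first row and \<open>1\<close> in the second.\<close>
  define \<phi> where "\<phi> x i j =
    (if i = 0 then (if j = 0 then to_ac (co x 0) + to_ac (co x 1) * r else to_ac d * (to_ac (co x 2) + to_ac (co x 3) * r))
     else (if j = 0 then to_ac (co x 2) - to_ac (co x 3) * r else to_ac (co x 0) - to_ac (co x 1) * r))" for x and i j :: nat
  have co_add: "co (x \<oplus>\<^bsub>Q\<^esub> y) 0 = co x 0 + co y 0 \<and> co (x \<oplus>\<^bsub>Q\<^esub> y) 1 = co x 1 + co y 1 \<and>
      co (x \<oplus>\<^bsub>Q\<^esub> y) 2 = co x 2 + co y 2 \<and> co (x \<oplus>\<^bsub>Q\<^esub> y) 3 = co x 3 + co y 3"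
    if "x \<in> carrier Q" "y \<in> carrier Q" for x y
    by (rule coI) (use that \<rho>co[OF that(1)] \<rho>co[OF that(2)] in \<open>simp_all add: add S.\<iota>_add distrib_right add_ac\<close>)
  have co_smult: "co (k \<odot>\<^bsub>Q\<^esub> x) 0 = k * co x 0 \<and> co (k \<odot>\<^bsub>Q\<^esub> x) 1 = k * co x 1 \<and>
      co (k \<odot>\<^bsub>Q\<^esub> x) 2 = k * co x 2 \<and> co (k \<odot>\<^bsub>Q\<^esub> x) 3 = k * co x 3" if "x \<in> carrier Q" for x k
    by (rule coI) (use that \<rho>co[OF that] in \<open>simp_all add: smult S.\<iota>_mult distrib_left mult.assoc Q.smult_simps(1)\<close>)
  have co_one: "co \<one>\<^bsub>Q\<^esub> 0 = 1 \<and> co \<one>\<^bsub>Q\<^esub> 1 = 0 \<and> co \<one>\<^bsub>Q\<^esub> 2 = 0 \<and> co \<one>\<^bsub>Q\<^esub> 3 = 0"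
    by (rule coI) (simp_all add: one S.\<iota>_one S.\<iota>_0)
  note co_mult = coI[OF Q.m_closed]
  have rr: "r * r = to_ac c" "r * (r * z) = to_ac c * z" for z
    using r by (simp_all add: power2_eq_square mult.assoc[symmetric])
  have \<phi>_mult: "\<phi> (x \<otimes>\<^bsub>Q\<^esub> y) i j = (\<Sum>m<2. \<phi> x i m * \<phi> y m j)"
    if xy: "x \<in> carrier Q" "y \<in> carrier Q" and ij: "i < 2" "j < 2" for x y i j
  proof -
    have "\<rho> (x \<otimes>\<^bsub>Q\<^esub> y) = (rfm_scalar (co x 0) + rfm_scalar (co x 1) * ru + rfm_scalar (co x 2) * rv + rfm_scalar (co x 3) * (ru * rv))
      * (rfm_scalar (co y 0) + rfm_scalar (co y 1) * ru + rfm_scalar (co y 2) * rv + rfm_scalar (co y 3) * (ru * rv))"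
      using xy mult \<rho>co by metis
    note e = co_mult[OF xy this[unfolded S.uv_mult[OF uv(3,4,5)]]]
    have "i = 0 \<or> i = 1" "j = 0 \<or> j = 1" using ij by auto
    then show ?thesis
      by (elim disjE) (simp_all add: \<phi>_def e sum_two algebra_simps rr del: One_nat_def)
  qed
  have "adapted_basis Q \<sigma> b w \<epsilon> \<phi>"
    unfolding adapted_basis_def
  proof (intro conjI allI impI ballI)
    show "\<epsilon> j = 1 \<or> \<epsilon> j = - 1" for j by (auto simp: \<epsilon>_def eu_def ev_def)
  qed (use bj span eps sq w0 wF anti \<phi>_mult co_add co_smult co_one in
      \<open>auto simp: b_def[of 0] \<epsilon>_def[of 0] \<phi>_def algebra_simps\<close>)
  then show thesis by (rule that)
qed

section \<open>Tensor products\<close>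

locale tensor_family =
  fixes I :: "nat set" and Q :: "nat \<Rightarrow> ('k::field, 'q) module"
  assumes I: "finite I" and Q: "i \<in> I \<Longrightarrow> k_algebra (Q i)"
begin

abbreviation "P \<equiv> product_group I Q"
abbreviation "R \<equiv> tuple_algebra I Q"
abbreviation "J \<equiv> tensor_ideal I Q"
abbreviation "A \<equiv> tensor_algebra I Q"

lemma Q_kalg: "i \<in> I \<Longrightarrow> kalg (Q i)" using Q k_algebra_kalg by blast
lemma Q_ring: "i \<in> I \<Longrightarrow> ring (Q i)" using Q by (auto simp: k_algebra_def)
lemma Q_monoid: "i \<in> I \<Longrightarrow> monoid (Q i)" using Q_ring by (auto simp: ring_def)

lemma monoid_P: "monoid P"
  by (rule monoidI)
    (auto simp: PiE_iff fun_eq_iff extensional_def monoid.m_closed[OF Q_monoid] monoid.one_closed[OF Q_monoid]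
      monoid.m_assoc[OF Q_monoid] monoid.l_one[OF Q_monoid] monoid.r_one[OF Q_monoid])

sublocale M: monoid_ring P R
  rewrites "monoid_algebra P = R"
  by (simp_all add: monoid_ring_def monoid_P tuple_algebra_def)

sublocale R: ring R by (rule M.ring_R)

lemma upd_in: "g \<in> carrier P \<Longrightarrow> i \<in> I \<Longrightarrow> x \<in> carrier (Q i) \<Longrightarrow> g(i := x) \<in> carrier P"
  by (auto simp: PiE_iff extensional_def)

lemma P_at: "g \<in> carrier P \<Longrightarrow> i \<in> I \<Longrightarrow> g i \<in> carrier (Q i)" by (auto simp: PiE_iff)

lemma R_diff_in: "f \<in> carrier R \<Longrightarrow> h \<in> carrier R \<Longrightarrow> (\<lambda>g. f g - h g) \<in> carrier R"
  using R.a_closed[OF _ M.minus_in, of f h] by (simp add: M.R_simps(4))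

lemma relations_in: "multilinear_relations I Q \<subseteq> carrier R"
proof
  fix f assume "f \<in> multilinear_relations I Q"
  then show "f \<in> carrier R"
    unfolding multilinear_relations_def using Q_kalg Q_ring
    by (auto simp: ring.ring_simprules kalg.smult_simps(1) intro!: R_diff_in M.single_in upd_in simp del: carrier_product_group)
qed

lemma ideal_J: "ideal J R"
  unfolding tensor_ideal_def by (rule R.genideal_ideal[OF relations_in])

sublocale J: ideal J R by (rule ideal_J)

abbreviation "T \<equiv> R Quot J"

lemma A_simps: "carrier A = carrier T" "monoid.mult A = monoid.mult T" "\<one>\<^bsub>A\<^esub> = \<one>\<^bsub>T\<^esub>" "\<zero>\<^bsub>A\<^esub> = \<zero>\<^bsub>T\<^esub>"
  "add A = add T" "k \<odot>\<^bsub>A\<^esub> c = (J +>\<^bsub>R\<^esub> single \<one>\<^bsub>P\<^esub> k) \<otimes>\<^bsub>T\<^esub> c"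
  by (simp_all add: tensor_algebra_def Let_def)

lemma ring_A: "ring A"
proof -
  interpret T: ring T by (rule J.quotient_is_ring)
  show ?thesis
  proof (intro ringI abelian_groupI monoidI)
    show "\<exists>y\<in>carrier A. y \<oplus>\<^bsub>A\<^esub> x = \<zero>\<^bsub>A\<^esub>" if "x \<in> carrier A" for x
      using that T.l_neg T.a_inv_closed by (auto simp: A_simps)
    show "x \<oplus>\<^bsub>A\<^esub> y = y \<oplus>\<^bsub>A\<^esub> x" if "x \<in> carrier A" "y \<in> carrier A" for x y
      using T.a_comm that by (simp add: A_simps)
  qed (auto simp: A_simps T.m_assoc T.l_distr T.r_distr T.a_assoc)
qed

sublocale A: ring A by (rule ring_A)

definition \<pi> :: "((nat \<Rightarrow> 'q) \<Rightarrow> 'k) \<Rightarrow> ((nat \<Rightarrow> 'q) \<Rightarrow> 'k) set" where "\<pi> f = J +>\<^bsub>R\<^esub> f"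

lemma \<pi>_hom: "\<pi> \<in> Ring.ring_hom R T"
  using J.rcos_ring_hom unfolding \<pi>_def[abs_def] .

lemma \<pi>_in: "f \<in> carrier R \<Longrightarrow> \<pi> f \<in> carrier A"
  using ring_hom_closed[OF \<pi>_hom] by (simp add: A_simps)

lemma \<pi>_add: "f \<in> carrier R \<Longrightarrow> h \<in> carrier R \<Longrightarrow> \<pi> (\<lambda>g. f g + h g) = \<pi> f \<oplus>\<^bsub>A\<^esub> \<pi> h"
  using ring_hom_add[OF \<pi>_hom] by (simp add: A_simps M.R_simps(4)[symmetric])

lemma \<pi>_mult: "f \<in> carrier R \<Longrightarrow> h \<in> carrier R \<Longrightarrow> \<pi> (f \<otimes>\<^bsub>R\<^esub> h) = \<pi> f \<otimes>\<^bsub>A\<^esub> \<pi> h"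
  using ring_hom_mult[OF \<pi>_hom] by (simp add: A_simps)

lemma \<pi>_one: "\<pi> (single \<one>\<^bsub>P\<^esub> 1) = \<one>\<^bsub>A\<^esub>"
  using ring_hom_one[OF \<pi>_hom] by (simp add: A_simps(3) M.R_simps(2) del: one_product_group)

lemma \<pi>_surj: "x \<in> carrier A \<Longrightarrow> \<exists>f\<in>carrier R. x = \<pi> f"
  by (auto simp: A_simps FactRing_def A_RCOSETS_def' \<pi>_def)

lemma \<pi>_eq_iff:
  assumes "f \<in> carrier R" "h \<in> carrier R"
  shows "\<pi> f = \<pi> h \<longleftrightarrow> (\<lambda>g. f g - h g) \<in> J"
proof -
  have neg: "\<ominus>\<^bsub>R\<^esub> h = (\<lambda>g. - h g)"
    by (rule R.minus_equality) (auto simp: M.R_simps(4) M.R_simps(3) assms M.minus_in)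
  have e: "f \<oplus>\<^bsub>R\<^esub> \<ominus>\<^bsub>R\<^esub> h = (\<lambda>g. f g - h g)" unfolding neg by (simp add: M.R_simps(4))
  show ?thesis
    unfolding \<pi>_def e[symmetric] using assms J.a_rcos_module J.a_rcos_self R.a_repr_independence[OF _ _ J.a_subgroup]
    by metis
qed

lemma scalar_in: "single \<one>\<^bsub>P\<^esub> k \<in> carrier R"
  using M.single_in[OF M.one_closed] .

lemma scaled_in: "f \<in> carrier R \<Longrightarrow> (\<lambda>g. k * f g) \<in> carrier R"
  using R.m_closed[OF scalar_in, of f k] M.scalar_central(1)[of f k] by simp

lemma \<pi>_smult: "f \<in> carrier R \<Longrightarrow> k \<odot>\<^bsub>A\<^esub> \<pi> f = \<pi> (\<lambda>g. k * f g)"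
  using \<pi>_mult[OF scalar_in, of f k] M.scalar_central(1)[of f k]
  by (simp add: A_simps(2,6) \<pi>_def del: one_product_group)

text \<open>Scalar multiplication is multiplication by the class of \<open>single \<one> k\<close>,
  an element that is central already in the monoid algebra; compatibility with products is
  associativity.\<close>

lemma k_algebra_A: "k_algebra A"
proof -
  have "module_axioms (class_ring :: 'k ring) A"
  proof (unfold module_axioms_def, intro conjI allI impI)
    fix a b :: 'k and x y
    assume "x \<in> carrier A"
    then obtain f where f: "f \<in> carrier R" "x = \<pi> f" using \<pi>_surj by blast
    show "a \<odot>\<^bsub>A\<^esub> x \<in> carrier A" using f by (simp add: \<pi>_smult \<pi>_in scaled_in)
    show "(a \<oplus>\<^bsub>class_ring\<^esub> b) \<odot>\<^bsub>A\<^esub> x = a \<odot>\<^bsub>A\<^esub> x \<oplus>\<^bsub>A\<^esub> b \<odot>\<^bsub>A\<^esub> x"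
      using f by (simp add: \<pi>_smult \<pi>_add[symmetric] scaled_in distrib_right)
    show "(a \<otimes>\<^bsub>class_ring\<^esub> b) \<odot>\<^bsub>A\<^esub> x = a \<odot>\<^bsub>A\<^esub> (b \<odot>\<^bsub>A\<^esub> x)"
      using f by (simp add: \<pi>_smult scaled_in mult.assoc)
    show "\<one>\<^bsub>class_ring\<^esub> \<odot>\<^bsub>A\<^esub> x = x" using f by (simp add: \<pi>_smult)
    show "a \<odot>\<^bsub>A\<^esub> (x \<oplus>\<^bsub>A\<^esub> y) = a \<odot>\<^bsub>A\<^esub> x \<oplus>\<^bsub>A\<^esub> a \<odot>\<^bsub>A\<^esub> y" if "y \<in> carrier A"
    proof -
      obtain h where h: "h \<in> carrier R" "y = \<pi> h" using \<pi>_surj \<open>y \<in> carrier A\<close> by blast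
      have "(\<lambda>g. f g + h g) \<in> carrier R" using R.a_closed[OF f(1) h(1)] by (simp add: M.R_simps(4))
      then show ?thesis using f h by (simp add: \<pi>_smult \<pi>_add[symmetric] scaled_in distrib_left)
    qed
  qed
  then have vs: "vectorspace (class_ring :: 'k ring) A"
    by (simp add: vectorspace_def Module.module_def class_cring.cring_axioms class_field.field_axioms A.abelian_group_axioms)
  have "(k \<odot>\<^bsub>A\<^esub> x) \<otimes>\<^bsub>A\<^esub> y = k \<odot>\<^bsub>A\<^esub> (x \<otimes>\<^bsub>A\<^esub> y) \<and> x \<otimes>\<^bsub>A\<^esub> (k \<odot>\<^bsub>A\<^esub> y) = k \<odot>\<^bsub>A\<^esub> (x \<otimes>\<^bsub>A\<^esub> y)"
    if xy: "x \<in> carrier A" "y \<in> carrier A" for k x y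
  proof -
    obtain f where f: "f \<in> carrier R" "x = \<pi> f" using \<pi>_surj[OF xy(1)] by blast
    let ?k = "\<pi> (single \<one>\<^bsub>P\<^esub> k)"
    have k: "?k \<in> carrier A" using \<pi>_in[OF scalar_in] .
    have sm: "k \<odot>\<^bsub>A\<^esub> z = ?k \<otimes>\<^bsub>A\<^esub> z" for z by (simp add: A_simps(2,6) \<pi>_def)
    have c: "?k \<otimes>\<^bsub>A\<^esub> x = x \<otimes>\<^bsub>A\<^esub> ?k"
      using f scalar_in by (simp add: \<pi>_mult[symmetric] M.scalar_central del: one_product_group)
    show ?thesis unfolding sm using A.m_assoc[OF k xy] A.m_assoc[OF xy(1) k xy(2)] c by simp
  qed
  then show ?thesis using vs ring_A by (simp add: k_algebra_def)
qed

sublocale A: kalg A by (rule k_algebra_kalg[OF k_algebra_A])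

text \<open>The pure tensor with components \<open>g i\<close>.\<close>

definition pt :: "(nat \<Rightarrow> 'q) \<Rightarrow> ((nat \<Rightarrow> 'q) \<Rightarrow> 'k) set" where "pt g = \<pi> (single g 1)"

lemma pt_in: "g \<in> carrier P \<Longrightarrow> pt g \<in> carrier A"
  unfolding pt_def by (intro \<pi>_in M.single_in)

lemma pt_mult: "g \<in> carrier P \<Longrightarrow> h \<in> carrier P \<Longrightarrow> pt g \<otimes>\<^bsub>A\<^esub> pt h = pt (g \<otimes>\<^bsub>P\<^esub> h)"
  unfolding pt_def using M.single_in by (simp add: \<pi>_mult[symmetric] M.single_mult del: carrier_product_group mult_product_group)

lemma pt_one: "pt \<one>\<^bsub>P\<^esub> = \<one>\<^bsub>A\<^esub>" unfolding pt_def by (rule \<pi>_one)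

lemma \<pi>_single: "g \<in> carrier P \<Longrightarrow> \<pi> (single g k) = k \<odot>\<^bsub>A\<^esub> pt g"
proof -
  assume g: "g \<in> carrier P"
  have "(\<lambda>h. k * single g 1 h) = single g k" by (auto simp: single_def)
  then show ?thesis using \<pi>_smult[OF M.single_in[OF g], of k 1] by (simp add: pt_def)
qed

lemma rel_J: "multilinear_relations I Q \<subseteq> J"
  unfolding tensor_ideal_def by (rule R.genideal_self[OF relations_in])

lemma pt_add:
  assumes "g \<in> carrier P" "i \<in> I" "x \<in> carrier (Q i)" "y \<in> carrier (Q i)"
  shows "pt (g(i := x \<oplus>\<^bsub>Q i\<^esub> y)) = pt (g(i := x)) \<oplus>\<^bsub>A\<^esub> pt (g(i := y))"
proof -
  have xy: "x \<oplus>\<^bsub>Q i\<^esub> y \<in> carrier (Q i)" using assms Q_ring by (simp add: ring.ring_simprules)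
  note c = M.single_in[OF upd_in[OF assms(1,2) xy]] M.single_in[OF upd_in[OF assms(1,2,3)]] M.single_in[OF upd_in[OF assms(1,2,4)]]
  have s: "(\<lambda>h. single (g(i := x)) (1::'k) h + single (g(i := y)) 1 h) \<in> carrier R"
    using R.a_closed[OF c(2,3)] by (simp add: M.R_simps(4))
  have "(\<lambda>h. single (g(i := x \<oplus>\<^bsub>Q i\<^esub> y)) (1::'k) h - (single (g(i := x)) 1 h + single (g(i := y)) 1 h)) \<in> J"
    using rel_J assms unfolding multilinear_relations_def diff_diff_eq[symmetric] by blast
  then have "\<pi> (single (g(i := x \<oplus>\<^bsub>Q i\<^esub> y)) 1) = \<pi> (\<lambda>h. single (g(i := x)) 1 h + single (g(i := y)) 1 h)"
    using \<pi>_eq_iff[OF c(1) s] by blast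
  then show ?thesis unfolding pt_def using \<pi>_add[OF c(2,3)] by simp
qed

lemma pt_smult:
  assumes "g \<in> carrier P" "i \<in> I" "x \<in> carrier (Q i)"
  shows "pt (g(i := k \<odot>\<^bsub>Q i\<^esub> x)) = k \<odot>\<^bsub>A\<^esub> pt (g(i := x))"
proof -
  have kx: "k \<odot>\<^bsub>Q i\<^esub> x \<in> carrier (Q i)" using assms Q_kalg by (simp add: kalg.smult_simps)
  note c = M.single_in[OF upd_in[OF assms(1,2) kx]] M.single_in[OF upd_in[OF assms(1,2,3)]]
  have "(\<lambda>h. single (g(i := k \<odot>\<^bsub>Q i\<^esub> x)) (1::'k) h - single (g(i := x)) k h) \<in> J"
    using rel_J assms unfolding multilinear_relations_def by blast
  then have "\<pi> (single (g(i := k \<odot>\<^bsub>Q i\<^esub> x)) 1) = \<pi> (single (g(i := x)) k)"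
    using \<pi>_eq_iff[OF c] by blast
  then show ?thesis using \<pi>_single[OF upd_in[OF assms], of k] pt_def[of "g(i := k \<odot>\<^bsub>Q i\<^esub> x)"] by metis
qed

text \<open>The relations extract a scalar from one coordinate; induction over the set
  \<open>S\<close> of coordinates already scaled collects them all.\<close>

lemma pt_smult_all:
  assumes "g \<in> carrier P"
  shows "pt (\<lambda>i\<in>I. k i \<odot>\<^bsub>Q i\<^esub> g i) = (\<Prod>i\<in>I. k i) \<odot>\<^bsub>A\<^esub> pt g"
proof -
  have "S \<subseteq> I \<Longrightarrow> pt (\<lambda>i\<in>I. if i \<in> S then k i \<odot>\<^bsub>Q i\<^esub> g i else g i) = (\<Prod>i\<in>S. k i) \<odot>\<^bsub>A\<^esub> pt g" if "finite S" for S
    using that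
  proof (induction S rule: finite_induct)
    case empty
    have "(\<lambda>i\<in>I. g i) = g" using assms by (auto simp: PiE_iff fun_eq_iff extensional_def)
    then show ?case using A.smult_simps(5)[OF pt_in[OF assms]] by simp
  next
    case (insert j S)
    let ?h = "\<lambda>i\<in>I. if i \<in> S then k i \<odot>\<^bsub>Q i\<^esub> g i else g i"
    have j: "j \<in> I" using insert by simp
    have h: "?h \<in> carrier P" using assms Q_kalg by (auto simp: PiE_iff kalg.smult_simps)
    have e: "(\<lambda>i\<in>I. if i \<in> insert j S then k i \<odot>\<^bsub>Q i\<^esub> g i else g i) = ?h(j := k j \<odot>\<^bsub>Q j\<^esub> g j)"
      using j by (auto simp: fun_eq_iff)
    have hj: "?h(j := g j) = ?h" by (rule fun_upd_idem) (use j insert.hyps in simp)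
    have IH: "pt ?h = (\<Prod>i\<in>S. k i) \<odot>\<^bsub>A\<^esub> pt g" by (rule insert.IH) (use insert.prems in simp)
    show ?case unfolding e pt_smult[OF h j P_at[OF assms j]] hj IH
      using insert.hyps A.smult_simps(4)[OF pt_in[OF assms]] by simp
  qed
  note all = this[OF I subset_refl]
  have "(\<lambda>i\<in>I. k i \<odot>\<^bsub>Q i\<^esub> g i) = (\<lambda>i\<in>I. if i \<in> I then k i \<odot>\<^bsub>Q i\<^esub> g i else g i)"
    by (rule restrict_ext) simp
  then show ?thesis using all by simp
qed

text \<open>Elements are sums of pure tensors, and multilinearity expands a pure tensor one
  coordinate at a time. Independence is another matter and is settled by traces.\<close>

lemma spans_pt:
  assumes b: "\<And>i j. i \<in> I \<Longrightarrow> j < 4 \<Longrightarrow> b i j \<in> carrier (Q i)"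
    and span: "\<And>i x. i \<in> I \<Longrightarrow> x \<in> carrier (Q i) \<Longrightarrow> \<exists>k. x = kalg.comb (Q i) (b i) {..<4::nat} k"
  shows "A.spans (\<lambda>g. pt (\<lambda>i\<in>I. b i (g i))) (I \<rightarrow>\<^sub>E {..<4::nat})"
proof -
  let ?G = "I \<rightarrow>\<^sub>E {..<4::nat}" and ?e = "\<lambda>g. pt (\<lambda>i\<in>I. b i (g i))"
  have fG: "finite ?G" using I by (simp add: finite_PiE)
  have e: "?e \<in> ?G \<rightarrow> carrier A" using b by (auto intro!: pt_in simp: PiE_iff)
  define Sp where "Sp = {x. \<exists>k. x = A.comb ?e ?G k}"
  have Sp_add: "x \<oplus>\<^bsub>A\<^esub> y \<in> Sp" if "x \<in> Sp" "y \<in> Sp" for x y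
    using that A.comb_add[OF e, symmetric] unfolding Sp_def by blast
  have Sp_smult: "k \<odot>\<^bsub>A\<^esub> x \<in> Sp" if "x \<in> Sp" for x k
    using that A.comb_smult[OF fG e] unfolding Sp_def by blast
  have Sp_e: "?e g \<in> Sp" if "g \<in> ?G" for g
    using A.comb_unit[OF fG e that] unfolding Sp_def by blast
  have Sp_in: "x \<in> carrier A" if "x \<in> Sp" for x using that A.comb_closed[OF e] by (auto simp: Sp_def)
  have Sp_0: "\<zero>\<^bsub>A\<^esub> \<in> Sp"
  proof -
    have "A.comb ?e ?G (\<lambda>_. 0) \<in> Sp" by (auto simp: Sp_def)
    then have "0 \<odot>\<^bsub>A\<^esub> A.comb ?e ?G (\<lambda>_. 0) \<in> Sp" by (rule Sp_smult)
    then show ?thesis using A.smult_zero(1)[OF A.comb_closed[OF e]] by simp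
  qed
  \<comment> \<open>\<open>S\<close> contains the coordinates of \<open>h\<close> that need not be
    basis vectors yet. The step for \<open>i\<close> runs an inner induction over the basis
    expansion of \<open>h i\<close>.\<close>
  have pure: "finite S \<Longrightarrow> S \<subseteq> I \<Longrightarrow> h \<in> carrier P \<Longrightarrow> (\<And>i. i \<in> I - S \<Longrightarrow> \<exists>m<4. h i = b i m) \<Longrightarrow> pt h \<in> Sp" for S h
  proof (induction S arbitrary: h rule: finite_induct)
    case empty
    then have "\<forall>i\<in>I. \<exists>m<4. h i = b i m" by simp
    then obtain m where m: "\<And>i. i \<in> I \<Longrightarrow> m i < 4 \<and> h i = b i (m i)" by metis
    have he: "h = (\<lambda>i\<in>I. b i ((\<lambda>i\<in>I. m i) i))" using empty.prems(2) m by (auto simp: PiE_iff extensional_def fun_eq_iff)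
    have "pt (\<lambda>i\<in>I. b i ((\<lambda>i\<in>I. m i) i)) \<in> Sp" by (rule Sp_e) (use m in auto)
    then show ?case by (subst he)
  next
    case (insert i S)
    have i: "i \<in> I" using insert.prems by simp
    interpret Qi: kalg "Q i" using Q_kalg[OF i] .
    note h = insert.prems(2)
    have upd: "pt (h(i := b i m)) \<in> Sp" if "m < 4" for m
    proof (rule insert.IH)
      show "\<exists>m'<4. (h(i := b i m)) j = b j m'" if "j \<in> I - S" for j
        using that \<open>m < 4\<close> insert.prems(3)[of j] by auto
    qed (use insert.prems upd_in[OF h i b[OF i \<open>m < 4\<close>]] in auto)
    have "pt (h(i := Qi.comb (b i) N k)) \<in> Sp" if "finite N" "N \<subseteq> {..<4}" for N k
      using that
    proof (induction N rule: finite_induct)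
      case empty
      \<comment> \<open>A pure tensor with a zero coordinate vanishes: writing zero as
        \<open>0\<close> times zero lets the scalar \<open>0\<close> be extracted.\<close>
      have "pt (h(i := 0 \<odot>\<^bsub>Q i\<^esub> \<zero>\<^bsub>Q i\<^esub>)) = 0 \<odot>\<^bsub>A\<^esub> pt (h(i := \<zero>\<^bsub>Q i\<^esub>))"
        by (rule pt_smult[OF h i]) simp
      also have "\<dots> = \<zero>\<^bsub>A\<^esub>" by (intro A.smult_zero(1) pt_in upd_in h i) simp
      finally have z: "pt (h(i := 0 \<odot>\<^bsub>Q i\<^esub> \<zero>\<^bsub>Q i\<^esub>)) \<in> Sp" using Sp_0 by (simp only:)
      have "Qi.comb (b i) {} k = 0 \<odot>\<^bsub>Q i\<^esub> \<zero>\<^bsub>Q i\<^esub>" by (simp add: Qi.comb_def Qi.smult_zero)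
      then show ?case using z by (simp only:)
    next
      case (insert m N)
      have bN: "b i \<in> N \<rightarrow> carrier (Q i)" and bm: "b i m \<in> carrier (Q i)" "m < 4" using insert.prems b[OF i] by auto
      have "Qi.comb (b i) (insert m N) k = k m \<odot>\<^bsub>Q i\<^esub> b i m \<oplus>\<^bsub>Q i\<^esub> Qi.comb (b i) N k"
        unfolding Qi.comb_def using insert.hyps bN bm by (subst Qi.finsum_insert) (auto simp: Qi.smult_simps Pi_iff)
      then have e: "pt (h(i := Qi.comb (b i) (insert m N) k))
        = k m \<odot>\<^bsub>A\<^esub> pt (h(i := b i m)) \<oplus>\<^bsub>A\<^esub> pt (h(i := Qi.comb (b i) N k))"
        using pt_add[OF h i Qi.smult_simps(1)[OF bm(1), of "k m"] Qi.comb_closed[OF bN, of k]] pt_smult[OF h i bm(1), of "k m"] by (simp only:)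
      show ?case unfolding e
        by (intro Sp_add Sp_smult upd[OF bm(2)] insert.IH) (use insert.prems in simp)
    qed
    note all = this[OF finite_lessThan subset_refl]
    obtain k where "h i = Qi.comb (b i) {..<4} k" using span[OF i P_at[OF h i]] by blast
    then have "h(i := Qi.comb (b i) {..<4} k) = h" using fun_upd_triv[of h i] by simp
    then show ?case using all[of k] by (simp only:)
  qed
  \<comment> \<open>The representative \<open>f\<close> is reduced to zero by subtracting one tuple
    of its support after the other.\<close>
  have tot: "finite W \<Longrightarrow> f \<in> carrier R \<Longrightarrow> {g. f g \<noteq> 0} \<subseteq> W \<Longrightarrow> \<pi> f \<in> Sp" for W f
  proof (induction W arbitrary: f rule: finite_induct)
    case empty
    then have "f = (\<lambda>g. 0 * f g)" by auto
    then have "\<pi> f = 0 \<odot>\<^bsub>A\<^esub> \<pi> f" using \<pi>_smult[OF empty(1), of 0] by simp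
    then show ?case using Sp_0 A.smult_zero(1)[OF \<pi>_in[OF empty(1)]] by simp
  next
    case (insert g W)
    show ?case
    proof (cases "f g = 0")
      case True
      then show ?thesis using insert by auto
    next
      case False
      have g: "g \<in> carrier P" using M.R_carrierD(2)[OF insert.prems(1) False] .
      let ?f = "\<lambda>h. f h - single g (f g) h"
      have f': "?f \<in> carrier R" by (intro R_diff_in insert.prems M.single_in g)
      have "\<pi> ?f \<in> Sp" by (rule insert.IH[OF f']) (use insert.prems in \<open>auto simp: single_def split: if_splits\<close>)
      moreover have "\<pi> f = \<pi> ?f \<oplus>\<^bsub>A\<^esub> f g \<odot>\<^bsub>A\<^esub> pt g"
        using \<pi>_add[OF f' M.single_in[OF g], of "f g"] \<pi>_single[OF g, of "f g"] by simp
      moreover have "pt g \<in> Sp" by (rule pure[OF I subset_refl g]) simp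
      ultimately show ?thesis using Sp_add Sp_smult by simp
    qed
  qed
  show ?thesis
    unfolding A.spans_def
  proof (intro conjI ballI e)
    fix x assume "x \<in> carrier A"
    then obtain f where f: "f \<in> carrier R" "x = \<pi> f" using \<pi>_surj by blast
    then have "x \<in> Sp" using tot[of "{g. f g \<noteq> 0}" f] M.R_carrierD(1)[of f] by (simp add: fin_supp_def)
    then show "\<exists>k. x = A.comb ?e ?G k" by (simp add: Sp_def)
  qed
qed

text \<open>The kernel of \<open>\<Phi>\<close> is an ideal, so once it contains the relations it
  contains \<open>J\<close>. Thus \<open>\<Phi>\<close> is constant on classes, and the choice of
  representatives in \<open>\<phi>\<close> is harmless.\<close>

lemma hom_factor:
  assumes S: "ring S" and \<Phi>: "\<Phi> \<in> Ring.ring_hom R S" and rel: "\<And>f. f \<in> multilinear_relations I Q \<Longrightarrow> \<Phi> f = \<zero>\<^bsub>S\<^esub>"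
  obtains \<phi> where "\<phi> \<in> Ring.ring_hom A S" "\<And>f. f \<in> carrier R \<Longrightarrow> \<phi> (\<pi> f) = \<Phi> f"
proof -
  have h: "ring_hom_ring R S \<Phi>" by (rule ring_hom_ringI2[OF R.ring_axioms S \<Phi>])
  have "J \<subseteq> a_kernel R S \<Phi>"
    unfolding tensor_ideal_def using relations_in rel
    by (intro R.genideal_minimal ring_hom_ring.kernel_is_ideal[OF h]) (auto simp: a_kernel_def')
  then have JK: "\<Phi> f = \<zero>\<^bsub>S\<^esub>" if "f \<in> J" for f using that by (auto simp: a_kernel_def')
  have wd: "\<Phi> f = \<Phi> h" if "f \<in> carrier R" "h \<in> carrier R" "\<pi> f = \<pi> h" for f h
  proof -
    have d: "(\<lambda>g. f g - h g) \<in> J" using \<pi>_eq_iff that by blast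
    have "(\<lambda>g. f g - h g) \<oplus>\<^bsub>R\<^esub> h = f" by (simp add: M.R_simps(4))
    then have "\<Phi> f = \<Phi> (\<lambda>g. f g - h g) \<oplus>\<^bsub>S\<^esub> \<Phi> h"
      using ring_hom_add[OF \<Phi> R_diff_in[OF that(1,2)] that(2)] by simp
    also have "\<dots> = \<Phi> h" unfolding JK[OF d]
      by (rule monoid.l_one[of "add_monoid S", simplified])
        (use S ring_hom_closed[OF \<Phi> that(2)] in \<open>auto simp: ring_def abelian_group_def abelian_monoid_def comm_monoid_def\<close>)
    finally show ?thesis .
  qed
  define \<phi> where "\<phi> x = \<Phi> (SOME f. f \<in> carrier R \<and> x = \<pi> f)" for x
  have \<phi>: "\<phi> (\<pi> f) = \<Phi> f" if "f \<in> carrier R" for f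
  proof -
    have 1: "(SOME f'. f' \<in> carrier R \<and> \<pi> f = \<pi> f') \<in> carrier R \<and> \<pi> f = \<pi> (SOME f'. f' \<in> carrier R \<and> \<pi> f = \<pi> f')"
      by (rule someI[of "\<lambda>f'. f' \<in> carrier R \<and> \<pi> f = \<pi> f'" f]) (rule conjI[OF that refl])
    show ?thesis unfolding \<phi>_def by (rule wd[OF conjunct1[OF 1] that conjunct2[OF 1, symmetric]])
  qed
  have "\<phi> \<in> Ring.ring_hom A S"
  proof (rule ring_hom_memI)
    fix x y assume xy: "x \<in> carrier A" "y \<in> carrier A"
    obtain f k where f: "f \<in> carrier R" "x = \<pi> f" "k \<in> carrier R" "y = \<pi> k"
      using \<pi>_surj[OF xy(1)] \<pi>_surj[OF xy(2)] by blast
    show "\<phi> x \<in> carrier S" using f \<phi> ring_hom_closed[OF \<Phi>] by simp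
    show "\<phi> (x \<otimes>\<^bsub>A\<^esub> y) = \<phi> x \<otimes>\<^bsub>S\<^esub> \<phi> y" using f \<phi> ring_hom_mult[OF \<Phi>] by (simp add: \<pi>_mult[symmetric])
    have "\<phi> (\<pi> (f \<oplus>\<^bsub>R\<^esub> k)) = \<Phi> f \<oplus>\<^bsub>S\<^esub> \<Phi> k" using f \<phi> ring_hom_add[OF \<Phi>] by simp
    then show "\<phi> (x \<oplus>\<^bsub>A\<^esub> y) = \<phi> x \<oplus>\<^bsub>S\<^esub> \<phi> y" using f \<phi> by (simp add: M.R_simps(4) \<pi>_add)
  next
    show "\<phi> \<one>\<^bsub>A\<^esub> = \<one>\<^bsub>S\<^esub>" using \<phi>[OF R.one_closed] \<pi>_one ring_hom_one[OF \<Phi>] by (simp add: M.R_simps(2) del: one_product_group)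
  qed
  then show thesis using that \<phi> by blast
qed

end

section \<open>The involution of the tensor product\<close>

text \<open>\<open>2 k\<close> is the sum of the fixed element \<open>k + \<tau> k\<close> and of
  \<open>\<theta> = k - \<tau> k\<close>. The square of \<open>\<theta>\<close> is fixed, so
  \<open>\<tau>'\<close> maps \<open>\<theta>\<close> to itself or its negative, and the first is
  impossible as \<open>\<theta>\<close> is not fixed. This turns the hypothesis on fixed fields into
  equality of the restrictions to the centre, without which the tensor involution would not be well
  defined.\<close>

lemma involution_unique_of_fixed_field:
  fixes \<tau> \<tau>' :: "'k::field \<Rightarrow> 'k"
  assumes two: "(2 :: 'k) \<noteq> 0"
    and t: "\<And>a b. \<tau> (a + b) = \<tau> a + \<tau> b" "\<And>a b. \<tau> (a * b) = \<tau> a * \<tau> b" "\<And>a. \<tau> (\<tau> a) = a"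
    and t': "\<And>a b. \<tau>' (a + b) = \<tau>' a + \<tau>' b" "\<And>a b. \<tau>' (a * b) = \<tau>' a * \<tau>' b" "\<And>a. \<tau>' (\<tau>' a) = a"
    and fix_eq: "\<And>a. \<tau> a = a \<longleftrightarrow> \<tau>' a = a"
  shows "\<tau> k = \<tau>' k"
proof (cases "\<tau> k = k")
  case True
  then show ?thesis using fix_eq by simp
next
  case False
  define x where "x = k + \<tau> k"
  define \<theta> where "\<theta> = k - \<tau> k"
  have m: "\<tau> (- a) = - \<tau> a" for a
    using t(1)[of a "- a"] t(1)[of 0 0] by (simp add: eq_neg_iff_add_eq_0 add.commute)
  have m': "\<tau>' (- a) = - \<tau>' a" for a
    using t'(1)[of a "- a"] t'(1)[of 0 0] by (simp add: eq_neg_iff_add_eq_0 add.commute)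
  have "\<tau> x = x" by (simp add: x_def t add.commute)
  then have x: "\<tau>' x = x" using fix_eq by simp
  have \<theta>0: "\<theta> \<noteq> 0" using False by (simp add: \<theta>_def)
  have \<tau>\<theta>: "\<tau> \<theta> = - \<theta>" using t(1)[of k "- \<tau> k"] by (simp add: \<theta>_def m t)
  then have "\<tau> (\<theta> * \<theta>) = \<theta> * \<theta>" by (simp add: t)
  then have "\<tau>' \<theta> * \<tau>' \<theta> = \<theta> * \<theta>" using fix_eq t'(2) by simp
  then have "(\<tau>' \<theta> - \<theta>) * (\<tau>' \<theta> + \<theta>) = 0" by (simp add: algebra_simps)
  then have "\<tau>' \<theta> = \<theta> \<or> \<tau>' \<theta> = - \<theta>" by (auto simp: eq_neg_iff_add_eq_0)
  moreover have "\<tau>' \<theta> \<noteq> \<theta>"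
  proof
    assume "\<tau>' \<theta> = \<theta>"
    then have "- \<theta> = \<theta>" using fix_eq[of \<theta>] \<tau>\<theta> by simp
    then have "2 * \<theta> = 0" by (metis mult_2 neg_eq_iff_add_eq_0)
    then show False using two \<theta>0 by simp
  qed
  ultimately have \<tau>'\<theta>: "\<tau>' \<theta> = - \<theta>" by blast
  have "k + k = x + \<theta>" by (simp add: x_def \<theta>_def)
  then have "\<tau>' k + \<tau>' k = x + - \<theta>" using t'(1)[of k k] t'(1)[of x \<theta>] x \<tau>'\<theta> by simp
  also have "\<dots> = \<tau> k + \<tau> k" by (simp add: x_def \<theta>_def)
  finally have "2 * \<tau>' k = 2 * \<tau> k" by (simp only: mult_2)
  then show ?thesis using two by simp
qed

locale quaternion_tensor =
  fixes I :: "nat set" and Q :: "nat \<Rightarrow> ('k::field, 'q) module" and \<sigma> :: "nat \<Rightarrow> 'q \<Rightarrow> 'q" and F :: "'k set"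
  assumes fin_I: "finite I" and I_ne: "I \<noteq> {}"
    and qa: "\<And>i. i \<in> I \<Longrightarrow> quaternion_algebra (Q i)"
    and inv: "\<And>i. i \<in> I \<Longrightarrow> involution (Q i) (\<sigma> i)"
    and fixF: "\<And>i. i \<in> I \<Longrightarrow> fixed_field (Q i) (\<sigma> i) = F"
    and two: "(2 :: 'k) \<noteq> 0"
begin

lemma Q_csa: assumes "i \<in> I"
  shows "k_algebra (Q i)" "centre (Q i) = range (\<lambda>k. k \<odot>\<^bsub>Q i\<^esub> \<one>\<^bsub>Q i\<^esub>)" "\<one>\<^bsub>Q i\<^esub> \<noteq> \<zero>\<^bsub>Q i\<^esub>"
  using qa[OF assms] ring.simple_ring_one_neq_zero[of "Q i"]
  by (auto simp: quaternion_algebra_def central_simple_algebra_def simple_ring_def)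

sublocale tensor_family I Q
  by (simp add: tensor_family_def fin_I Q_csa)

abbreviation \<tau> :: "'k \<Rightarrow> 'k" where "\<tau> \<equiv> common_restriction I Q \<sigma>"

lemma centre_restriction_simps:
  assumes i: "i \<in> I"
  shows "centre_restriction (Q i) (\<sigma> i) (a + b) = centre_restriction (Q i) (\<sigma> i) a + centre_restriction (Q i) (\<sigma> i) b"
    "centre_restriction (Q i) (\<sigma> i) (a * b) = centre_restriction (Q i) (\<sigma> i) a * centre_restriction (Q i) (\<sigma> i) b"
    "centre_restriction (Q i) (\<sigma> i) (centre_restriction (Q i) (\<sigma> i) a) = a"
    "centre_restriction (Q i) (\<sigma> i) a = a \<longleftrightarrow> a \<in> F"
proof -
  obtain \<rho> s where "involutive_quaternion (\<rho> ` carrier (Q i)) rfm_scalar s (centre_restriction (Q i) (\<sigma> i))"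
    using quaternion_embedding[OF qa[OF i] inv[OF i] two] by metis
  then interpret iq: involutive_quaternion "\<rho> ` carrier (Q i)" rfm_scalar s "centre_restriction (Q i) (\<sigma> i)" .
  show "centre_restriction (Q i) (\<sigma> i) (a + b) = centre_restriction (Q i) (\<sigma> i) a + centre_restriction (Q i) (\<sigma> i) b"
    "centre_restriction (Q i) (\<sigma> i) (a * b) = centre_restriction (Q i) (\<sigma> i) a * centre_restriction (Q i) (\<sigma> i) b"
    "centre_restriction (Q i) (\<sigma> i) (centre_restriction (Q i) (\<sigma> i) a) = a"
    by (rule iq.\<tau>_simps)+
  have h: "a \<in> F \<longleftrightarrow> centre_restriction (Q i) (\<sigma> i) a \<odot>\<^bsub>Q i\<^esub> \<one>\<^bsub>Q i\<^esub> = a \<odot>\<^bsub>Q i\<^esub> \<one>\<^bsub>Q i\<^esub>"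
    using fixF[OF i] centre_restriction[OF Q_csa[OF i] inv[OF i], of a] by (auto simp: fixed_field_def)
  show "centre_restriction (Q i) (\<sigma> i) a = a \<longleftrightarrow> a \<in> F"
  proof
    assume "a \<in> F"
    then have "centre_restriction (Q i) (\<sigma> i) a \<odot>\<^bsub>Q i\<^esub> \<one>\<^bsub>Q i\<^esub> = a \<odot>\<^bsub>Q i\<^esub> \<one>\<^bsub>Q i\<^esub>" by (simp only: h)
    then show "centre_restriction (Q i) (\<sigma> i) a = a"
      by (rule kalg.smult_one_inj[OF Q_kalg[OF i] Q_csa(3)[OF i]])
  qed (simp only: h)
qed

text \<open>The restrictions of all factors coincide by
  \<open>involution_unique_of_fixed_field\<close>, so the description in
  \<open>common_restriction\<close> has exactly one solution.\<close>

lemma \<tau>_eq: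
  assumes i: "i \<in> I" shows "\<tau> k = centre_restriction (Q i) (\<sigma> i) k"
proof -
  have all: "centre_restriction (Q j) (\<sigma> j) k = centre_restriction (Q i) (\<sigma> i) k" if "j \<in> I" for j
    by (rule involution_unique_of_fixed_field[OF two])
      (simp_all add: centre_restriction_simps[OF i] centre_restriction_simps[OF that])
  have c: "\<sigma> j (k \<odot>\<^bsub>Q j\<^esub> \<one>\<^bsub>Q j\<^esub>) = centre_restriction (Q i) (\<sigma> i) k \<odot>\<^bsub>Q j\<^esub> \<one>\<^bsub>Q j\<^esub>" if "j \<in> I" for j
    using centre_restriction[OF Q_csa[OF that] inv[OF that], of k] all[OF that] by simp
  show ?thesis
    unfolding common_restriction_def
  proof (rule the_equality)
    fix c' assume "\<forall>j\<in>I. \<sigma> j (k \<odot>\<^bsub>Q j\<^esub> \<one>\<^bsub>Q j\<^esub>) = c' \<odot>\<^bsub>Q j\<^esub> \<one>\<^bsub>Q j\<^esub>"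
    then have "c' \<odot>\<^bsub>Q i\<^esub> \<one>\<^bsub>Q i\<^esub> = centre_restriction (Q i) (\<sigma> i) k \<odot>\<^bsub>Q i\<^esub> \<one>\<^bsub>Q i\<^esub>" using c[OF i] i by simp
    then show "c' = centre_restriction (Q i) (\<sigma> i) k"
      by (rule kalg.smult_one_inj[OF Q_kalg[OF i] Q_csa(3)[OF i]])
  qed (use c in blast)
qed

lemma \<tau>_simps: "\<tau> (a + b) = \<tau> a + \<tau> b" "\<tau> (a * b) = \<tau> a * \<tau> b" "\<tau> (\<tau> a) = a" "\<tau> a = a \<longleftrightarrow> a \<in> F"
  "\<tau> 0 = 0" "\<tau> 1 = 1" "\<tau> (- a) = - \<tau> a" "\<tau> (a - b) = \<tau> a - \<tau> b" "\<tau> a = 0 \<longleftrightarrow> a = 0" "\<tau> (of_nat n) = of_nat n"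
proof -
  obtain i where i: "i \<in> I" using I_ne by blast
  show add: "\<tau> (a + b) = \<tau> a + \<tau> b" and mul: "\<tau> (a * b) = \<tau> a * \<tau> b" and inv: "\<tau> (\<tau> a) = a" and "\<tau> a = a \<longleftrightarrow> a \<in> F" for a b
    by (simp_all add: \<tau>_eq[OF i] centre_restriction_simps[OF i])
  show z: "\<tau> 0 = 0" using add[of 0 0] by (metis add_cancel_right_right add_0)
  show z': "\<tau> a = 0 \<longleftrightarrow> a = 0" for a using inv[of a] inv[of 0] z by auto
  show o: "\<tau> 1 = 1" using mul[of 1 1] z'[of 1] by auto
  show m: "\<tau> (- a) = - \<tau> a" for a using add[of a "- a"] z by (simp add: eq_neg_iff_add_eq_0 add.commute)
  show "\<tau> (a - b) = \<tau> a - \<tau> b" using add[of a "- b"] m by simp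
  show "\<tau> (of_nat n) = of_nat n" by (induction n) (simp_all add: z o add)
qed

lemma \<sigma>_simps:
  assumes i: "i \<in> I"
  shows "x \<in> carrier (Q i) \<Longrightarrow> \<sigma> i x \<in> carrier (Q i)" "x \<in> carrier (Q i) \<Longrightarrow> \<sigma> i (\<sigma> i x) = x"
    "x \<in> carrier (Q i) \<Longrightarrow> y \<in> carrier (Q i) \<Longrightarrow> \<sigma> i (x \<oplus>\<^bsub>Q i\<^esub> y) = \<sigma> i x \<oplus>\<^bsub>Q i\<^esub> \<sigma> i y"
    "x \<in> carrier (Q i) \<Longrightarrow> y \<in> carrier (Q i) \<Longrightarrow> \<sigma> i (x \<otimes>\<^bsub>Q i\<^esub> y) = \<sigma> i y \<otimes>\<^bsub>Q i\<^esub> \<sigma> i x"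
    "\<sigma> i \<one>\<^bsub>Q i\<^esub> = \<one>\<^bsub>Q i\<^esub>"
    "x \<in> carrier (Q i) \<Longrightarrow> \<sigma> i (k \<odot>\<^bsub>Q i\<^esub> x) = \<tau> k \<odot>\<^bsub>Q i\<^esub> \<sigma> i x"
proof -
  interpret Qi: kalg "Q i" by (rule Q_kalg[OF i])
  show s: "x \<in> carrier (Q i) \<Longrightarrow> \<sigma> i x \<in> carrier (Q i)" "x \<in> carrier (Q i) \<Longrightarrow> \<sigma> i (\<sigma> i x) = x"
    "x \<in> carrier (Q i) \<Longrightarrow> y \<in> carrier (Q i) \<Longrightarrow> \<sigma> i (x \<oplus>\<^bsub>Q i\<^esub> y) = \<sigma> i x \<oplus>\<^bsub>Q i\<^esub> \<sigma> i y"
    "x \<in> carrier (Q i) \<Longrightarrow> y \<in> carrier (Q i) \<Longrightarrow> \<sigma> i (x \<otimes>\<^bsub>Q i\<^esub> y) = \<sigma> i y \<otimes>\<^bsub>Q i\<^esub> \<sigma> i x"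
    "\<sigma> i \<one>\<^bsub>Q i\<^esub> = \<one>\<^bsub>Q i\<^esub>" for x y using inv[OF i] by (auto simp: involution_def)
  show "\<sigma> i (k \<odot>\<^bsub>Q i\<^esub> x) = \<tau> k \<odot>\<^bsub>Q i\<^esub> \<sigma> i x" if x: "x \<in> carrier (Q i)"
  proof -
    have "k \<odot>\<^bsub>Q i\<^esub> x = (k \<odot>\<^bsub>Q i\<^esub> \<one>\<^bsub>Q i\<^esub>) \<otimes>\<^bsub>Q i\<^esub> x" using x by (simp add: Qi.smult_mult)
    then have "\<sigma> i (k \<odot>\<^bsub>Q i\<^esub> x) = \<sigma> i x \<otimes>\<^bsub>Q i\<^esub> (\<tau> k \<odot>\<^bsub>Q i\<^esub> \<one>\<^bsub>Q i\<^esub>)"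
      using s(4)[OF Qi.smult_simps(1)[OF Qi.one_closed] x] centre_restriction[OF Q_csa[OF i] inv[OF i], of k] \<tau>_eq[OF i] by simp
    then show ?thesis using s(1)[OF x] by (simp add: Qi.smult_mult)
  qed
qed

definition sg :: "(nat \<Rightarrow> 'q) \<Rightarrow> nat \<Rightarrow> 'q" where "sg g = (\<lambda>i\<in>I. \<sigma> i (g i))"

lemma sg_in: "g \<in> carrier P \<Longrightarrow> sg g \<in> carrier P"
  by (auto simp: sg_def PiE_iff \<sigma>_simps)

lemma sg_sg: "g \<in> carrier P \<Longrightarrow> sg (sg g) = g"
  by (auto simp: sg_def PiE_iff \<sigma>_simps fun_eq_iff extensional_def)

lemma sg_mult: "g \<in> carrier P \<Longrightarrow> h \<in> carrier P \<Longrightarrow> sg (g \<otimes>\<^bsub>P\<^esub> h) = sg h \<otimes>\<^bsub>P\<^esub> sg g"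
  by (auto simp: sg_def PiE_iff \<sigma>_simps fun_eq_iff)

lemma sg_one: "sg \<one>\<^bsub>P\<^esub> = \<one>\<^bsub>P\<^esub>"
  by (auto simp: sg_def \<sigma>_simps fun_eq_iff)

lemma sg_upd: "i \<in> I \<Longrightarrow> sg (g(i := x)) = (sg g)(i := \<sigma> i x)"
  by (auto simp: sg_def fun_eq_iff)

abbreviation star where "star \<equiv> tuple_star I Q \<sigma>"

lemma star_apply: "star f g = (if g \<in> carrier P then \<tau> (f (sg g)) else 0)"
  by (simp add: tuple_star_def sg_def)

lemma star_supp: assumes "f \<in> carrier R" shows "{g. star f g \<noteq> 0} = sg ` {g. f g \<noteq> 0}"
proof (intro equalityI subsetI)
  fix g assume "g \<in> {g. star f g \<noteq> 0}"
  then have "g \<in> carrier P" "f (sg g) \<noteq> 0" by (auto simp: star_apply \<tau>_simps split: if_splits)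
  then show "g \<in> sg ` {g. f g \<noteq> 0}" using sg_sg by (intro image_eqI[of _ _ "sg g"]) auto
next
  fix g assume "g \<in> sg ` {g. f g \<noteq> 0}"
  then obtain h where h: "g = sg h" "f h \<noteq> 0" by blast
  then have "h \<in> carrier P" using M.R_carrierD(2)[OF assms] by blast
  then show "g \<in> {g. star f g \<noteq> 0}" using h sg_in sg_sg by (auto simp: star_apply \<tau>_simps(9) simp del: carrier_product_group)
qed

lemma star_in: assumes f: "f \<in> carrier R" shows "star f \<in> carrier R"
proof -
  have "fin_supp (star f)" using M.R_carrierD(1)[OF f] by (simp add: fin_supp_def star_supp[OF f])
  then show ?thesis by (auto simp: M.R_simps(1) star_apply split: if_splits)
qed

lemma ev_star:
  assumes U: "additive_family U" and f: "f \<in> carrier R"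
  shows "ev U (star f) = ev (\<lambda>g c. U (sg g) (\<tau> c)) f"
proof -
  have inj: "inj_on sg {g. f g \<noteq> 0}"
    by (rule inj_on_inverseI[of _ sg]) (rule sg_sg, rule M.R_carrierD(2)[OF f], simp)
  have "ev U (star f) = (\<Sum>g\<in>sg ` {g. f g \<noteq> 0}. U g (star f g))" unfolding ev_def star_supp[OF f] ..
  also have "\<dots> = (\<Sum>g | f g \<noteq> 0. U (sg g) (star f (sg g)))" by (simp add: sum.reindex[OF inj])
  also have "\<dots> = (\<Sum>g | f g \<noteq> 0. U (sg g) (\<tau> (f g)))"
    using M.R_carrierD(2)[OF f] sg_in sg_sg by (intro sum.cong refl) (simp add: star_apply del: carrier_product_group)
  finally show ?thesis by (simp add: ev_def)
qed

lemma star_single: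
  assumes g: "g \<in> carrier P" shows "star (single g c) = single (sg g) (\<tau> c)"
proof
  fix h
  show "star (single g c) h = single (sg g) (\<tau> c) h"
  proof (cases "h = sg g")
    case True
    then show ?thesis using sg_in[OF g] sg_sg[OF g] by (simp add: star_apply single_def del: carrier_product_group)
  next
    case False
    then have "sg h \<noteq> g" if "h \<in> carrier P" using sg_sg[OF that] by auto
    then show ?thesis using False by (simp add: star_apply single_def \<tau>_simps(5) del: carrier_product_group)
  qed
qed

lemma star_add: "star (\<lambda>g. f g + h g) = (\<lambda>g. star f g + star h g)"
  and star_diff: "star (\<lambda>g. f g - h g) = (\<lambda>g. star f g - star h g)"
  by (auto simp: star_apply \<tau>_simps fun_eq_iff)

lemma star_star: "f \<in> carrier R \<Longrightarrow> star (star f) = f"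
proof
  fix g assume f: "f \<in> carrier R"
  show "star (star f) g = f g"
    using M.R_carrierD(2)[OF f, of g] sg_in[of g] sg_sg[of g] by (auto simp: star_apply \<tau>_simps simp del: carrier_product_group)
qed

text \<open>Compared under evaluations: \<open>sg\<close> reverses products of tuples, and
  exchanging the two sums reverses the factors accordingly.\<close>

lemma star_mult:
  assumes f: "f \<in> carrier R" and h: "h \<in> carrier R"
  shows "star (f \<otimes>\<^bsub>R\<^esub> h) = star h \<otimes>\<^bsub>R\<^esub> star f"
proof (rule M.R_eqI)
  fix U :: "(nat \<Rightarrow> 'q) \<Rightarrow> 'k \<Rightarrow> 'k" assume U: "additive_family U"
  have U': "additive_family (\<lambda>g c. U (sg g) (\<tau> c))"
    by (rule additive_familyI) (simp add: \<tau>_simps additive_familyD[OF U])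
  note fs = M.R_carrierD(1)[OF f] M.R_carrierD(1)[OF h] M.R_carrierD(1)[OF star_in[OF f]] M.R_carrierD(1)[OF star_in[OF h]]
  have "ev U (star (f \<otimes>\<^bsub>R\<^esub> h)) = ev (\<lambda>u c. ev (\<lambda>v d. U (sg (u \<otimes>\<^bsub>P\<^esub> v)) (\<tau> (c * d))) h) f"
    unfolding ev_star[OF U M.mult_closed[OF f h]] by (rule M.ev_mult[OF U' fs(1,2)])
  also have "\<dots> = ev (\<lambda>u c. ev (\<lambda>v d. U (sg v \<otimes>\<^bsub>P\<^esub> sg u) (\<tau> d * \<tau> c)) h) f"
    using M.R_carrierD(2)[OF f] M.R_carrierD(2)[OF h]
    by (intro ev_cong) (simp add: sg_mult \<tau>_simps(2) mult.commute del: carrier_product_group mult_product_group)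
  also have "\<dots> = ev (\<lambda>v d. ev (\<lambda>u c. U (sg v \<otimes>\<^bsub>P\<^esub> sg u) (\<tau> d * \<tau> c)) f) h" by (rule ev_swap)
  also have "\<dots> = ev (\<lambda>v d. ev (\<lambda>u c. U (sg v \<otimes>\<^bsub>P\<^esub> u) (\<tau> d * c)) (star f)) h"
    by (simp only: ev_star[OF M.additive_right[OF U] f])
  also have "\<dots> = ev (\<lambda>v d. ev (\<lambda>u c. U (v \<otimes>\<^bsub>P\<^esub> u) (d * c)) (star f)) (star h)"
    by (rule ev_star[OF M.additive_left[OF U] h, symmetric])
  also have "\<dots> = ev U (star h \<otimes>\<^bsub>R\<^esub> star f)" by (rule M.ev_mult[OF U fs(4,3), symmetric])
  finally show "ev U (star (f \<otimes>\<^bsub>R\<^esub> h)) = ev U (star h \<otimes>\<^bsub>R\<^esub> star f)" .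
qed (use f h star_in M.mult_closed in auto)

lemma star_relations:
  assumes "f \<in> multilinear_relations I Q" shows "star f \<in> multilinear_relations I Q"
proof -
  consider (1) g i x y where "g \<in> carrier P" "i \<in> I" "x \<in> carrier (Q i)" "y \<in> carrier (Q i)"
      "f = (\<lambda>h. single (g(i := x \<oplus>\<^bsub>Q i\<^esub> y)) 1 h - single (g(i := x)) 1 h - single (g(i := y)) 1 h)"
    | (2) g i k x where "g \<in> carrier P" "i \<in> I" "x \<in> carrier (Q i)"
      "f = (\<lambda>h. single (g(i := k \<odot>\<^bsub>Q i\<^esub> x)) 1 h - single (g(i := x)) k h)"
    using assms unfolding multilinear_relations_def by blast
  then show ?thesis
  proof cases
    case 1
    have xy: "x \<oplus>\<^bsub>Q i\<^esub> y \<in> carrier (Q i)" using 1 Q_ring by (simp add: ring.ring_simprules)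
    have "star f = (\<lambda>h. single ((sg g)(i := \<sigma> i x \<oplus>\<^bsub>Q i\<^esub> \<sigma> i y)) 1 h - single ((sg g)(i := \<sigma> i x)) 1 h - single ((sg g)(i := \<sigma> i y)) 1 h)"
      unfolding 1(5) star_diff star_single[OF upd_in[OF 1(1,2) xy]] star_single[OF upd_in[OF 1(1,2,3)]] star_single[OF upd_in[OF 1(1,2,4)]]
        sg_upd[OF 1(2)] \<sigma>_simps(3)[OF 1(2,3,4)] \<tau>_simps(6) ..
    then show ?thesis
      using sg_in[OF 1(1)] 1(2) \<sigma>_simps(1)[OF 1(2,3)] \<sigma>_simps(1)[OF 1(2,4)] unfolding multilinear_relations_def by blast
  next
    case 2
    have kx: "k \<odot>\<^bsub>Q i\<^esub> x \<in> carrier (Q i)" using 2 Q_kalg by (simp add: kalg.smult_simps)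
    have "star f = (\<lambda>h. single ((sg g)(i := \<tau> k \<odot>\<^bsub>Q i\<^esub> \<sigma> i x)) 1 h - single ((sg g)(i := \<sigma> i x)) (\<tau> k) h)"
      unfolding 2(4) star_diff star_single[OF upd_in[OF 2(1,2) kx]] star_single[OF upd_in[OF 2(1,2,3)]]
        sg_upd[OF 2(2)] \<sigma>_simps(6)[OF 2(2,3)] \<tau>_simps(6) ..
    then show ?thesis
      using sg_in[OF 2(1)] 2(2) \<sigma>_simps(1)[OF 2(2,3)] unfolding multilinear_relations_def by blast
  qed
qed

text \<open>The preimage of \<open>J\<close> under \<open>star\<close> is an ideal: as
  \<open>star\<close> reverses products, its left and right closure come from the right and left
  closure of \<open>J\<close>. It contains the relations because \<open>star\<close> maps relations
  to relations.\<close>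

lemma star_J: assumes "f \<in> J" shows "star f \<in> J"
proof -
  define J' where "J' = {f \<in> carrier R. star f \<in> J}"
  have add: "f \<oplus>\<^bsub>R\<^esub> h \<in> J'" if "f \<in> J'" "h \<in> J'" for f h
    using that J.a_closed[of "star f" "star h"] R.a_closed[of f h] by (simp add: J'_def M.R_simps(4) star_add)
  have "ideal J' R"
  proof (rule idealI[OF R.ring_axioms])
    show "subgroup J' (add_monoid R)"
    proof (rule R.add.subgroupI)
      show "J' \<subseteq> carrier R" by (auto simp: J'_def)
      have "star (\<lambda>g. 0) = (\<lambda>g. 0)" by (auto simp: star_apply \<tau>_simps fun_eq_iff)
      then have "\<zero>\<^bsub>R\<^esub> \<in> J'" using J.zero_closed R.zero_closed by (simp add: J'_def M.R_simps(3))
      then show "J' \<noteq> {}" by blast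
      show "\<ominus>\<^bsub>R\<^esub> f \<in> J'" if f: "f \<in> J'" for f
      proof -
        have fc: "f \<in> carrier R" and sf: "star f \<in> J" using f by (auto simp: J'_def)
        have neg: "\<ominus>\<^bsub>R\<^esub> h = (\<lambda>g. - h g)" if "h \<in> carrier R" for h
          by (rule R.minus_equality) (auto simp: M.R_simps(4) M.R_simps(3) that M.minus_in)
        have "star (\<lambda>g. - f g) = (\<lambda>g. - star f g)" by (auto simp: star_apply \<tau>_simps fun_eq_iff)
        then have "star (\<ominus>\<^bsub>R\<^esub> f) \<in> J" using J.a_inv_closed[OF sf] neg[OF fc] neg[OF star_in[OF fc]] by simp
        then show ?thesis using R.a_inv_closed[OF fc] by (simp add: J'_def)
      qed
      show "f \<oplus>\<^bsub>R\<^esub> h \<in> J'" if "f \<in> J'" "h \<in> J'" for f h using add[OF that] .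
    qed
    show "x \<otimes>\<^bsub>R\<^esub> a \<in> J'" "a \<otimes>\<^bsub>R\<^esub> x \<in> J'" if "a \<in> J'" "x \<in> carrier R" for a x
      using that star_mult star_in J.I_l_closed J.I_r_closed M.mult_closed by (auto simp: J'_def)
  qed
  moreover have "multilinear_relations I Q \<subseteq> J'"
    using relations_in rel_J star_relations by (auto simp: J'_def)
  ultimately have "J \<subseteq> J'" unfolding tensor_ideal_def by (rule R.genideal_minimal)
  then show ?thesis using assms by (auto simp: J'_def)
qed

abbreviation s where "s \<equiv> tensor_involution I Q \<sigma>"

text \<open>The tensor involution takes images of cosets as sets. One inclusion is
  \<open>star_J\<close>; for the other, \<open>star\<close> being its own inverse makes it map
  \<open>J\<close> onto \<open>J\<close>.\<close>

lemma s_\<pi>: assumes f: "f \<in> carrier R" shows "s (\<pi> f) = \<pi> (star f)"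
proof -
  have Jc: "J \<subseteq> carrier R" by (rule J.a_subset)
  have coset: "\<pi> h = {(\<lambda>g. j g + h g) | j. j \<in> J}" for h
    by (auto simp: \<pi>_def a_r_coset_def' M.R_simps(4))
  show ?thesis
    unfolding tensor_involution_def coset
  proof (intro equalityI subsetI)
    fix x assume "x \<in> star ` {\<lambda>g. j g + f g |j. j \<in> J}"
    then obtain j where j: "j \<in> J" "x = star (\<lambda>g. j g + f g)" by blast
    then have "x = (\<lambda>g. star j g + star f g)" by (simp only: star_add)
    then show "x \<in> {\<lambda>g. j g + star f g |j. j \<in> J}" using star_J[OF j(1)] by blast
  next
    fix x assume "x \<in> {\<lambda>g. j g + star f g |j. j \<in> J}"
    then obtain j where j: "j \<in> J" "x = (\<lambda>g. j g + star f g)" by blast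
    have "j \<in> carrier R" using j Jc by blast
    then have "x = star (\<lambda>g. star j g + f g)" unfolding star_add j(2) by (simp only: star_star)
    then show "x \<in> star ` {\<lambda>g. j g + f g |j. j \<in> J}" using star_J[OF j(1)] by blast
  qed
qed

lemma s_simps:
  "x \<in> carrier A \<Longrightarrow> s x \<in> carrier A" "x \<in> carrier A \<Longrightarrow> s (s x) = x"
  "x \<in> carrier A \<Longrightarrow> y \<in> carrier A \<Longrightarrow> s (x \<oplus>\<^bsub>A\<^esub> y) = s x \<oplus>\<^bsub>A\<^esub> s y"
  "x \<in> carrier A \<Longrightarrow> y \<in> carrier A \<Longrightarrow> s (x \<otimes>\<^bsub>A\<^esub> y) = s y \<otimes>\<^bsub>A\<^esub> s x"
  "x \<in> carrier A \<Longrightarrow> s (k \<odot>\<^bsub>A\<^esub> x) = \<tau> k \<odot>\<^bsub>A\<^esub> s x"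
proof -
  show "s x \<in> carrier A" "s (s x) = x" if x: "x \<in> carrier A"
  proof -
    obtain f where f: "f \<in> carrier R" "x = \<pi> f" using \<pi>_surj[OF x] by blast
    show "s x \<in> carrier A" "s (s x) = x"
      unfolding f(2) s_\<pi>[OF f(1)] s_\<pi>[OF star_in[OF f(1)]] star_star[OF f(1)] by (rule \<pi>_in[OF star_in[OF f(1)]], rule refl)
  qed
  show "s (x \<oplus>\<^bsub>A\<^esub> y) = s x \<oplus>\<^bsub>A\<^esub> s y" "s (x \<otimes>\<^bsub>A\<^esub> y) = s y \<otimes>\<^bsub>A\<^esub> s x"
    if xy: "x \<in> carrier A" "y \<in> carrier A"
  proof -
    obtain f h where f: "f \<in> carrier R" "x = \<pi> f" and h: "h \<in> carrier R" "y = \<pi> h"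
      using \<pi>_surj[OF xy(1)] \<pi>_surj[OF xy(2)] by blast
    have fh: "(\<lambda>g. f g + h g) \<in> carrier R" using R.a_closed[OF f(1) h(1)] by (simp add: M.R_simps(4))
    show "s (x \<oplus>\<^bsub>A\<^esub> y) = s x \<oplus>\<^bsub>A\<^esub> s y"
      unfolding f(2) h(2) \<pi>_add[OF f(1) h(1), symmetric] s_\<pi>[OF fh] s_\<pi>[OF f(1)] s_\<pi>[OF h(1)] star_add
      by (rule \<pi>_add[OF star_in[OF f(1)] star_in[OF h(1)]])
    show "s (x \<otimes>\<^bsub>A\<^esub> y) = s y \<otimes>\<^bsub>A\<^esub> s x"
      unfolding f(2) h(2) \<pi>_mult[OF f(1) h(1), symmetric] s_\<pi>[OF M.mult_closed[OF f(1) h(1)]] s_\<pi>[OF f(1)] s_\<pi>[OF h(1)]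
        star_mult[OF f(1) h(1)]
      by (rule \<pi>_mult[OF star_in[OF h(1)] star_in[OF f(1)]])
  qed
  show "s (k \<odot>\<^bsub>A\<^esub> x) = \<tau> k \<odot>\<^bsub>A\<^esub> s x" if x: "x \<in> carrier A"
  proof -
    obtain f where f: "f \<in> carrier R" "x = \<pi> f" using \<pi>_surj[OF x] by blast
    have "star (\<lambda>g. k * f g) = (\<lambda>g. \<tau> k * star f g)" by (auto simp: star_apply \<tau>_simps fun_eq_iff)
    then show ?thesis
      unfolding f(2) \<pi>_smult[OF f(1)] s_\<pi>[OF f(1)] s_\<pi>[OF scaled_in[OF f(1)]] \<pi>_smult[OF star_in[OF f(1)]] by simp
  qed
qed

lemma s_pt: "g \<in> carrier P \<Longrightarrow> s (pt g) = pt (sg g)"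
  unfolding pt_def using s_\<pi>[OF M.single_in] star_single \<tau>_simps(6) by (simp del: carrier_product_group)

lemma s_one: "s \<one>\<^bsub>A\<^esub> = \<one>\<^bsub>A\<^esub>"
  using s_pt[OF M.one_closed] unfolding sg_one pt_one .

lemma s_scalar: "s (k \<odot>\<^bsub>A\<^esub> \<one>\<^bsub>A\<^esub>) = \<tau> k \<odot>\<^bsub>A\<^esub> \<one>\<^bsub>A\<^esub>"
  using s_simps(5)[OF A.one_closed] s_one by simp

end

section \<open>The reduced trace\<close>

lemma mat_trace_add:
  assumes "M \<in> carrier_mat n n" "N \<in> carrier_mat n n" shows "mat_trace (M + N) = mat_trace M + mat_trace N"
  using assms by (simp add: mat_trace_def sum.distrib)

lemma mat_trace_smult:
  fixes c :: "'b::semiring_0"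
  assumes "M \<in> carrier_mat n n" shows "mat_trace (c \<cdot>\<^sub>m M) = c * mat_trace M"
  using assms by (simp add: mat_trace_def sum_distrib_left)

lemma mat_trace_one: "mat_trace (1\<^sub>m n :: 'b::semiring_1 mat) = of_nat n"
  by (simp add: mat_trace_def)

lemma mat_trace_comm:
  fixes M N :: "'b::comm_semiring_0 mat"
  assumes M: "M \<in> carrier_mat n n" and N: "N \<in> carrier_mat n n" shows "mat_trace (M * N) = mat_trace (N * M)"
proof -
  have "mat_trace (M * N) = (\<Sum>i<n. \<Sum>k<n. M $$ (i, k) * N $$ (k, i))"
    using M N by (simp add: mat_trace_def scalar_prod_def lessThan_atLeast0)
  also have "\<dots> = (\<Sum>k<n. \<Sum>i<n. M $$ (i, k) * N $$ (k, i))" by (rule sum.swap)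
  also have "\<dots> = mat_trace (N * M)"
    using M N by (simp add: mat_trace_def scalar_prod_def lessThan_atLeast0 mult.commute)
  finally show ?thesis .
qed

text \<open>The trace of \<open>E M E\<close> equals \<open>c\<close> times the trace of
  \<open>M\<close> by cyclicity, and its negative by anticommutation.\<close>

lemma mat_trace_anticommute:
  fixes M E :: "'b::field mat"
  assumes M: "M \<in> carrier_mat n n" and E: "E \<in> carrier_mat n n" and c: "E * E = c \<cdot>\<^sub>m 1\<^sub>m n" "c \<noteq> 0"
    and two: "(2::'b) \<noteq> 0" and anti: "E * M = (- 1) \<cdot>\<^sub>m (M * E)"
  shows "mat_trace M = 0"
proof -
  have "mat_trace (E * (M * E)) = mat_trace ((M * E) * E)"
    using M E by (intro mat_trace_comm[of _ n]) auto
  also have "(M * E) * E = M * (c \<cdot>\<^sub>m 1\<^sub>m n)" using M E c(1) by (simp add: assoc_mult_mat[of _ n n _ n _ n])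
  also have "\<dots> = c \<cdot>\<^sub>m M" using M by (simp add: mult_smult_distrib[of _ n n _ n])
  finally have 1: "mat_trace (E * (M * E)) = c * mat_trace M" using M by (simp add: mat_trace_smult)
  have "E * (M * E) = (E * M) * E" using M E by (simp add: assoc_mult_mat[of _ n n _ n _ n])
  also have "\<dots> = (- 1) \<cdot>\<^sub>m ((M * E) * E)" unfolding anti using M E by (simp add: mult_smult_assoc_mat[of _ n n _ n])
  also have "(M * E) * E = M * (c \<cdot>\<^sub>m 1\<^sub>m n)" using M E c(1) by (simp add: assoc_mult_mat[of _ n n _ n _ n])
  also have "\<dots> = c \<cdot>\<^sub>m M" using M by (simp add: mult_smult_distrib[of _ n n _ n])
  finally have "mat_trace (E * (M * E)) = - 1 * (c * mat_trace M)"
    using M by (simp only: mat_trace_smult[of _ n] smult_carrier_mat)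
  then have "2 * (c * mat_trace M) = 0" unfolding 1 by (metis add.right_inverse mult_2 mult_minus1)
  then show ?thesis using c(2) two by simp
qed

section \<open>The product basis\<close>

locale quaternion_tensor_data = quaternion_tensor I Q \<sigma> F
  for I :: "nat set" and Q :: "nat \<Rightarrow> ('k::field, 'q) module" and \<sigma> :: "nat \<Rightarrow> 'q \<Rightarrow> 'q" and F :: "'k set" +
  fixes b :: "nat \<Rightarrow> nat \<Rightarrow> 'q" and w \<epsilon> :: "nat \<Rightarrow> nat \<Rightarrow> 'k" and \<phi> :: "nat \<Rightarrow> 'q \<Rightarrow> nat \<Rightarrow> nat \<Rightarrow> 'k alg_closure"
  assumes adapted: "\<And>i. i \<in> I \<Longrightarrow> adapted_basis (Q i) (\<sigma> i) (b i) (w i) (\<epsilon> i) (\<phi> i)"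
begin

lemma b_simps:
  assumes i: "i \<in> I"
  shows "j < 4 \<Longrightarrow> b i j \<in> carrier (Q i)" "b i 0 = \<one>\<^bsub>Q i\<^esub>"
    "x \<in> carrier (Q i) \<Longrightarrow> \<exists>k. x = kalg.comb (Q i) (b i) {..<4} k"
    "j < 4 \<Longrightarrow> \<sigma> i (b i j) = \<epsilon> i j \<odot>\<^bsub>Q i\<^esub> b i j" "j < 4 \<Longrightarrow> \<epsilon> i j = 1 \<or> \<epsilon> i j = - 1" "\<epsilon> i 0 = 1"
    "j < 4 \<Longrightarrow> b i j \<otimes>\<^bsub>Q i\<^esub> b i j = w i j \<odot>\<^bsub>Q i\<^esub> \<one>\<^bsub>Q i\<^esub>" "j < 4 \<Longrightarrow> w i j \<noteq> 0" "j < 4 \<Longrightarrow> w i j \<in> F"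
    "j < 4 \<Longrightarrow> m < 4 \<Longrightarrow> j \<noteq> m \<Longrightarrow> \<exists>p<4. b i p \<otimes>\<^bsub>Q i\<^esub> (b i j \<otimes>\<^bsub>Q i\<^esub> b i m)
        = (- 1) \<odot>\<^bsub>Q i\<^esub> ((b i j \<otimes>\<^bsub>Q i\<^esub> b i m) \<otimes>\<^bsub>Q i\<^esub> b i p)"
  using adapted[OF i] fixF[OF i] by (auto simp: adapted_basis_def)

lemma \<phi>_simps:
  assumes i: "i \<in> I" and r: "r < 2" and t: "t < 2"
  shows "x \<in> carrier (Q i) \<Longrightarrow> y \<in> carrier (Q i) \<Longrightarrow> \<phi> i (x \<oplus>\<^bsub>Q i\<^esub> y) r t = \<phi> i x r t + \<phi> i y r t"
    "x \<in> carrier (Q i) \<Longrightarrow> y \<in> carrier (Q i) \<Longrightarrow> \<phi> i (x \<otimes>\<^bsub>Q i\<^esub> y) r t = (\<Sum>m<2. \<phi> i x r m * \<phi> i y m t)"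
    "x \<in> carrier (Q i) \<Longrightarrow> \<phi> i (k \<odot>\<^bsub>Q i\<^esub> x) r t = to_ac k * \<phi> i x r t"
    "\<phi> i \<one>\<^bsub>Q i\<^esub> r t = (if r = t then 1 else 0)"
  using adapted[OF i] r t by (simp_all add: adapted_basis_def)

abbreviation "G \<equiv> I \<rightarrow>\<^sub>E {..<4::nat}"
definition bt where "bt g = (\<lambda>i\<in>I. b i (g i))"
definition e where "e g = pt (bt g)"
text \<open>The scalar square of \<open>e g\<close>. It differs from the similitude factor
  \<open>w\<^sub>g\<close> of the overview by the sign \<open>E g\<close>; that factor appears below
  as \<open>E g * W g\<close>.\<close>

definition W where "W g = (\<Prod>i\<in>I. w i (g i))"
definition E where "E g = (\<Prod>i\<in>I. \<epsilon> i (g i))"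
definition g0 :: "nat \<Rightarrow> nat" where "g0 = (\<lambda>i\<in>I. 0)"

lemma finite_G: "finite G" using fin_I by (simp add: finite_PiE)
lemma card_G: "card G = 4 ^ card I" using fin_I by (simp add: card_PiE)
lemma G_lt: "g \<in> G \<Longrightarrow> i \<in> I \<Longrightarrow> g i < 4" by (auto simp: PiE_iff)
lemma g0_in: "g0 \<in> G" by (simp add: g0_def)

lemma bt_in: "g \<in> G \<Longrightarrow> bt g \<in> carrier P"
  using b_simps(1) by (auto simp: bt_def PiE_iff)

lemma e_in: "g \<in> G \<Longrightarrow> e g \<in> carrier A"
  unfolding e_def by (rule pt_in[OF bt_in])

lemma e_funcset: "e \<in> G \<rightarrow> carrier A" using e_in by blast

lemma spans_e: "A.spans e G"
  using spans_pt[of b] b_simps(1,3) unfolding e_def[abs_def] bt_def[abs_def] by blast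

lemma bt_g0: "bt g0 = \<one>\<^bsub>P\<^esub>"
  using b_simps(2) by (auto simp: bt_def g0_def fun_eq_iff)

lemma e_g0: "e g0 = \<one>\<^bsub>A\<^esub>" unfolding e_def bt_g0 by (rule pt_one)

lemma scalar_tuple:
  assumes x: "x \<in> carrier P" and k: "\<And>i. i \<in> I \<Longrightarrow> y i = k i \<odot>\<^bsub>Q i\<^esub> x i" and y: "y \<in> extensional I"
  shows "pt y = (\<Prod>i\<in>I. k i) \<odot>\<^bsub>A\<^esub> pt x"
proof -
  have "y = (\<lambda>i\<in>I. k i \<odot>\<^bsub>Q i\<^esub> x i)" using k y by (auto simp: extensional_def fun_eq_iff)
  then show ?thesis using pt_smult_all[OF x, of k] by (simp only:)
qed

lemma P_mult_ext: "x \<otimes>\<^bsub>P\<^esub> y \<in> extensional I" by simp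

lemma e_sq: assumes g: "g \<in> G" shows "e g \<otimes>\<^bsub>A\<^esub> e g = W g \<odot>\<^bsub>A\<^esub> \<one>\<^bsub>A\<^esub>"
proof -
  have "pt (bt g \<otimes>\<^bsub>P\<^esub> bt g) = (\<Prod>i\<in>I. w i (g i)) \<odot>\<^bsub>A\<^esub> pt \<one>\<^bsub>P\<^esub>"
    by (rule scalar_tuple[OF M.one_closed _ P_mult_ext]) (simp add: bt_def b_simps(7)[OF _ G_lt[OF g]])
  then show ?thesis unfolding e_def pt_mult[OF bt_in[OF g] bt_in[OF g]] pt_one W_def .
qed

lemma s_e: assumes g: "g \<in> G" shows "s (e g) = E g \<odot>\<^bsub>A\<^esub> e g"
proof -
  have "pt (sg (bt g)) = (\<Prod>i\<in>I. \<epsilon> i (g i)) \<odot>\<^bsub>A\<^esub> pt (bt g)"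
    by (rule scalar_tuple[OF bt_in[OF g]]) (simp_all add: sg_def bt_def b_simps(4)[OF _ G_lt[OF g]])
  then show ?thesis unfolding e_def s_pt[OF bt_in[OF g]] E_def .
qed

lemma \<tau>_prod: "\<tau> (prod f S) = (\<Prod>i\<in>S. \<tau> (f i))"
  by (induction S rule: infinite_finite_induct) (simp_all add: \<tau>_simps)

lemma W_simps: assumes g: "g \<in> G" shows "W g \<noteq> 0" "\<tau> (W g) = W g"
proof -
  show "W g \<noteq> 0" unfolding W_def using fin_I b_simps(8)[OF _ G_lt[OF g]] by simp
  show "\<tau> (W g) = W g" unfolding W_def \<tau>_prod
    using b_simps(9)[OF _ G_lt[OF g]] by (intro prod.cong refl) (simp add: \<tau>_simps(4))
qed

lemma E_simps: assumes g: "g \<in> G" shows "E g \<noteq> 0" "\<tau> (E g) = E g" "E g0 = 1"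
proof -
  have c: "\<epsilon> i (g i) = 1 \<or> \<epsilon> i (g i) = - 1" if "i \<in> I" for i using b_simps(5)[OF that G_lt[OF g that]] .
  have "\<epsilon> i (g i) \<noteq> 0" if "i \<in> I" for i using c[OF that] by auto
  then show "E g \<noteq> 0" unfolding E_def using fin_I by simp
  have "\<tau> (\<epsilon> i (g i)) = \<epsilon> i (g i)" if "i \<in> I" for i
    using c[OF that] \<tau>_simps(6) \<tau>_simps(7)[of 1] by auto
  then show "\<tau> (E g) = E g" unfolding E_def \<tau>_prod by (intro prod.cong refl)
  show "E g0 = 1" unfolding E_def by (rule prod.neutral) (simp add: g0_def b_simps(6))
qed

text \<open>Take a coordinate \<open>i0\<close> where \<open>g\<close> and \<open>h\<close> differ,
  and let \<open>e m\<close> be a basis vector anticommuting with the product there and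
  \<open>\<one>\<close> in all other coordinates. Then exactly one coordinate contributes the
  sign.\<close>

lemma e_anti:
  assumes g: "g \<in> G" and h: "h \<in> G" and ne: "g \<noteq> h"
  obtains m where "m \<in> G" "e m \<otimes>\<^bsub>A\<^esub> (e g \<otimes>\<^bsub>A\<^esub> e h) = (- 1) \<odot>\<^bsub>A\<^esub> ((e g \<otimes>\<^bsub>A\<^esub> e h) \<otimes>\<^bsub>A\<^esub> e m)"
proof -
  obtain i0 where i0: "i0 \<in> I" "g i0 \<noteq> h i0" using PiE_ext[OF g h] ne by blast
  obtain p where p: "p < 4" "b i0 p \<otimes>\<^bsub>Q i0\<^esub> (b i0 (g i0) \<otimes>\<^bsub>Q i0\<^esub> b i0 (h i0))
      = (- 1) \<odot>\<^bsub>Q i0\<^esub> ((b i0 (g i0) \<otimes>\<^bsub>Q i0\<^esub> b i0 (h i0)) \<otimes>\<^bsub>Q i0\<^esub> b i0 p)"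
    using b_simps(10)[OF i0(1) G_lt[OF g i0(1)] G_lt[OF h i0(1)] i0(2)] by blast
  define m where "m = (\<lambda>i\<in>I. if i = i0 then p else 0)"
  have m: "m \<in> G" using p(1) by (auto simp: m_def)
  note gh = M.m_closed[OF bt_in[OF g] bt_in[OF h]]
  have "pt (bt m \<otimes>\<^bsub>P\<^esub> (bt g \<otimes>\<^bsub>P\<^esub> bt h)) = (\<Prod>i\<in>I. if i = i0 then - 1 else 1) \<odot>\<^bsub>A\<^esub> pt ((bt g \<otimes>\<^bsub>P\<^esub> bt h) \<otimes>\<^bsub>P\<^esub> bt m)"
  proof (rule scalar_tuple[OF M.m_closed[OF gh bt_in[OF m]] _ P_mult_ext])
    fix i assume i: "i \<in> I"
    interpret Qi: kalg "Q i" by (rule Q_kalg[OF i])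
    have c: "b i (g i) \<otimes>\<^bsub>Q i\<^esub> b i (h i) \<in> carrier (Q i)"
      using b_simps(1)[OF i G_lt[OF g i]] b_simps(1)[OF i G_lt[OF h i]] by simp
    show "(bt m \<otimes>\<^bsub>P\<^esub> (bt g \<otimes>\<^bsub>P\<^esub> bt h)) i = (if i = i0 then - 1 else 1) \<odot>\<^bsub>Q i\<^esub> ((bt g \<otimes>\<^bsub>P\<^esub> bt h) \<otimes>\<^bsub>P\<^esub> bt m) i"
    proof (cases "i = i0")
      case True
      then show ?thesis using p(2) i by (simp add: bt_def m_def)
    next
      case False
      then show ?thesis using i c by (simp add: bt_def m_def b_simps(2)[OF i] Qi.smult_simps)
    qed
  qed
  also have "(\<Prod>i\<in>I. if i = i0 then - 1 else 1) = (- 1 :: 'k)" using fin_I i0(1) by (simp add: prod.delta)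
  finally have "e m \<otimes>\<^bsub>A\<^esub> (e g \<otimes>\<^bsub>A\<^esub> e h) = (- 1) \<odot>\<^bsub>A\<^esub> ((e g \<otimes>\<^bsub>A\<^esub> e h) \<otimes>\<^bsub>A\<^esub> e m)"
    unfolding e_def pt_mult[OF bt_in[OF g] bt_in[OF h]] pt_mult[OF bt_in[OF m] gh] pt_mult[OF gh bt_in[OF m]] .
  then show thesis using that m by blast
qed

section \<open>Matrix representations and the reduced trace\<close>

definition rep :: "nat \<Rightarrow> (((nat \<Rightarrow> 'q) \<Rightarrow> 'k) set \<Rightarrow> 'k alg_closure mat) \<Rightarrow> bool" where
  "rep n f \<longleftrightarrow> f \<in> Ring.ring_hom A (ring_mat TYPE('k alg_closure) n ()) \<and>
     (\<forall>k. \<forall>x\<in>carrier A. f (k \<odot>\<^bsub>A\<^esub> x) = to_ac k \<cdot>\<^sub>m f x)"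

lemma rep_simps:
  assumes "rep n f"
  shows "x \<in> carrier A \<Longrightarrow> f x \<in> carrier_mat n n"
    "x \<in> carrier A \<Longrightarrow> y \<in> carrier A \<Longrightarrow> f (x \<oplus>\<^bsub>A\<^esub> y) = f x + f y"
    "x \<in> carrier A \<Longrightarrow> y \<in> carrier A \<Longrightarrow> f (x \<otimes>\<^bsub>A\<^esub> y) = f x * f y"
    "f \<one>\<^bsub>A\<^esub> = 1\<^sub>m n" "x \<in> carrier A \<Longrightarrow> f (k \<odot>\<^bsub>A\<^esub> x) = to_ac k \<cdot>\<^sub>m f x"
  using assms unfolding rep_def Ring.ring_hom_def by (auto simp: ring_mat_def)

lemma two_ac: "(2 :: 'k alg_closure) \<noteq> 0"
  using two to_ac_eq_0_iff[of "2 :: 'k"] by simp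

text \<open>For \<open>g \<noteq> h\<close> the product anticommutes with some \<open>e m\<close>,
  whose square is a nonzero scalar, so its trace vanishes. Nothing is used about the representation,
  which is the source of uniqueness of the reduced trace.\<close>

lemma rep_trace_e:
  assumes r: "rep n f" and g: "g \<in> G" and h: "h \<in> G"
  shows "mat_trace (f (e g \<otimes>\<^bsub>A\<^esub> e h)) = to_ac (if g = h then of_nat n * W g else 0)"
proof (cases "g = h")
  case True
  then show ?thesis
    using rep_simps(5)[OF r A.one_closed, of "W g"] rep_simps(4)[OF r] e_sq[OF g]
    by (simp add: mat_trace_smult[of _ n] mat_trace_one mult.commute)
next
  case False
  obtain m where m: "m \<in> G" "e m \<otimes>\<^bsub>A\<^esub> (e g \<otimes>\<^bsub>A\<^esub> e h) = (- 1) \<odot>\<^bsub>A\<^esub> ((e g \<otimes>\<^bsub>A\<^esub> e h) \<otimes>\<^bsub>A\<^esub> e m)"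
    using e_anti[OF g h False] .
  have gh: "e g \<otimes>\<^bsub>A\<^esub> e h \<in> carrier A" by (rule A.m_closed[OF e_in[OF g] e_in[OF h]])
  have "mat_trace (f (e g \<otimes>\<^bsub>A\<^esub> e h)) = 0"
  proof (rule mat_trace_anticommute[OF rep_simps(1)[OF r gh] rep_simps(1)[OF r e_in[OF m(1)]] _ _ two_ac])
    show "f (e m) * f (e m) = to_ac (W m) \<cdot>\<^sub>m 1\<^sub>m n"
      unfolding rep_simps(3)[OF r e_in[OF m(1)] e_in[OF m(1)], symmetric] e_sq[OF m(1)]
        rep_simps(5)[OF r A.one_closed] rep_simps(4)[OF r] ..
    show "to_ac (W m) \<noteq> 0" using W_simps(1)[OF m(1)] by simp
    have "f (e m) * f (e g \<otimes>\<^bsub>A\<^esub> e h) = to_ac (- 1) \<cdot>\<^sub>m (f (e g \<otimes>\<^bsub>A\<^esub> e h) * f (e m))"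
      unfolding rep_simps(3)[OF r e_in[OF m(1)] gh, symmetric] m(2)
        rep_simps(5)[OF r A.m_closed[OF gh e_in[OF m(1)]]] rep_simps(3)[OF r gh e_in[OF m(1)]] ..
    then show "f (e m) * f (e g \<otimes>\<^bsub>A\<^esub> e h) = - 1 \<cdot>\<^sub>m (f (e g \<otimes>\<^bsub>A\<^esub> e h) * f (e m))" by simp
  qed
  then show ?thesis using False by simp
qed

text \<open>By orthogonality the trace against \<open>e h\<close> reads off the coefficient at
  \<open>h\<close>. Independence of the basis, uniqueness of the reduced trace and faithfulness of
  representations all rest on this.\<close>

lemma rep_trace_comb:
  assumes r: "rep n f" and h: "h \<in> G"
  shows "mat_trace (f (e h \<otimes>\<^bsub>A\<^esub> A.comb e G k)) = to_ac (of_nat n * W h * k h)"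
proof -
  define t where "t x = mat_trace (f (e h \<otimes>\<^bsub>A\<^esub> x))" for x
  have t_add: "t (x \<oplus>\<^bsub>A\<^esub> y) = t x + t y" if "x \<in> carrier A" "y \<in> carrier A" for x y
    unfolding t_def A.r_distr[OF that e_in[OF h]] rep_simps(2)[OF r A.m_closed[OF e_in[OF h] that(1)] A.m_closed[OF e_in[OF h] that(2)]]
    by (intro mat_trace_add[of _ n] rep_simps(1)[OF r] A.m_closed[OF e_in[OF h]] that)
  have t_smult: "t (c \<odot>\<^bsub>A\<^esub> x) = to_ac c * t x" if "x \<in> carrier A" for x c
    unfolding t_def A.smult_mult(2)[OF e_in[OF h] that] rep_simps(5)[OF r A.m_closed[OF e_in[OF h] that]]
    by (intro mat_trace_smult[of _ n] rep_simps(1)[OF r] A.m_closed[OF e_in[OF h]] that)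
  have t0: "t \<zero>\<^bsub>A\<^esub> = 0" using t_smult[OF A.zero_closed, of 0] A.smult_zero(1)[OF A.zero_closed] by simp
  have "t (A.comb e G k) = (\<Sum>g\<in>G. t (k g \<odot>\<^bsub>A\<^esub> e g))"
    by (rule A.hom_comb[OF finite_G e_funcset t_add t0])
  also have "\<dots> = (\<Sum>g\<in>G. to_ac (k g) * to_ac (if h = g then of_nat n * W h else 0))"
    by (intro sum.cong refl) (subst t_smult[OF e_in], assumption, simp only: t_def rep_trace_e[OF r h])
  also have "\<dots> = to_ac (of_nat n * W h * k h)"
    using h finite_G by (simp add: if_distrib[of to_ac] if_distrib[of "\<lambda>x. _ * x"] sum.delta mult.commute cong: if_cong)
  finally show ?thesis by (simp add: t_def)
qed

text \<open>The Kronecker product of the splittings \<open>\<phi> i\<close>. Its rows and columns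
  are naturally indexed by functions from \<open>I\<close> to \<open>{0, 1}\<close>, and
  \<open>\<beta>\<close> numbers them.\<close>

lemma ex_rep: "\<exists>f. rep (2 ^ card I) f"
proof -
  let ?n = "2 ^ card I :: nat"
  let ?B = "I \<rightarrow>\<^sub>E {..<2::nat}"
  have fB: "finite ?B" and cB: "card ?B = ?n" using fin_I by (auto simp: card_PiE finite_PiE)
  obtain \<beta> where \<beta>: "bij_betw \<beta> {..<?n} ?B" using ex_bij_betw_nat_finite[OF fB] cB by (auto simp: atLeast0LessThan)
  have \<beta>2: "\<beta> r i < 2" if "r < ?n" "i \<in> I" for r i
  proof -
    have "\<beta> r \<in> ?B" using \<beta> that(1) by (auto simp: bij_betw_def)
    then show ?thesis using that(2) by (auto simp: PiE_iff)
  qed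
  define \<psi> where "\<psi> g r t = (\<Prod>i\<in>I. \<phi> i (g i) (\<beta> r i) (\<beta> t i))" for g r t
  define U where "U r t = (\<lambda>g c. to_ac c * \<psi> g r t)" for r t
  have U: "additive_family (U r t)" for r t by (rule additive_familyI) (simp add: U_def distrib_right)
  define \<Phi> where "\<Phi> f = mat ?n ?n (\<lambda>(r, t). ev (U r t) f)" for f
  have \<psi>_mult: "\<psi> (u \<otimes>\<^bsub>P\<^esub> v) r t = (\<Sum>m<?n. \<psi> u r m * \<psi> v m t)"
    if uv: "u \<in> carrier P" "v \<in> carrier P" and rt: "r < ?n" "t < ?n" for u v r t
  proof -
    \<comment> \<open>Matrix products in every factor, then distributivity of the product over the
      sums: choosing a middle index in each factor amounts to choosing one middle index of the
      Kronecker product.\<close>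
    have "\<psi> (u \<otimes>\<^bsub>P\<^esub> v) r t = (\<Prod>i\<in>I. \<Sum>m<2. \<phi> i (u i) (\<beta> r i) m * \<phi> i (v i) m (\<beta> t i))"
      unfolding \<psi>_def
      by (intro prod.cong refl) (simp add: \<phi>_simps(2)[OF _ \<beta>2[OF rt(1)] \<beta>2[OF rt(2)] P_at[OF uv(1)] P_at[OF uv(2)]])
    also have "\<dots> = (\<Sum>p\<in>?B. \<Prod>i\<in>I. \<phi> i (u i) (\<beta> r i) (p i) * \<phi> i (v i) (p i) (\<beta> t i))"
      by (rule prod_sum_PiE[OF fin_I]) simp
    also have "\<dots> = (\<Sum>m<?n. \<Prod>i\<in>I. \<phi> i (u i) (\<beta> r i) (\<beta> m i) * \<phi> i (v i) (\<beta> m i) (\<beta> t i))"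
      by (rule sum.reindex_bij_betw[OF \<beta>, symmetric])
    finally show ?thesis by (simp only: \<psi>_def prod.distrib)
  qed
  \<comment> \<open>With the factor of coordinate \<open>i\<close> split off, the multilinear
    relations reduce to additivity and homogeneity of \<open>\<phi> i\<close>.\<close>
  have \<psi>_upd: "\<psi> (g(i := x)) r t = \<phi> i x (\<beta> r i) (\<beta> t i) * (\<Prod>j\<in>I - {i}. \<phi> j (g j) (\<beta> r j) (\<beta> t j))"
    if i: "i \<in> I" for g i x r t
    unfolding \<psi>_def prod.remove[OF fin_I i] by (intro arg_cong2[of _ _ _ _ "(*)"] prod.cong refl) auto
  have \<Phi>_hom: "\<Phi> \<in> Ring.ring_hom R (ring_mat TYPE('k alg_closure) ?n ())"
  proof (rule ring_hom_memI)
    fix f h assume f: "f \<in> carrier R" and h: "h \<in> carrier R"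
    note fs = M.R_carrierD(1)[OF f] M.R_carrierD(1)[OF h]
    show "\<Phi> f \<in> carrier (ring_mat TYPE('k alg_closure) ?n ())" by (simp add: \<Phi>_def ring_mat_def)
    show "\<Phi> (f \<oplus>\<^bsub>R\<^esub> h) = \<Phi> f \<oplus>\<^bsub>ring_mat TYPE('k alg_closure) ?n ()\<^esub> \<Phi> h"
      by (auto simp: \<Phi>_def ring_mat_def M.R_simps(4) ev_add[OF U fs])
    have "ev (U r t) (f \<otimes>\<^bsub>R\<^esub> h) = (\<Sum>m<?n. ev (U r m) f * ev (U m t) h)" if rt: "r < ?n" "t < ?n" for r t
    proof -
      let ?A = "{u. f u \<noteq> 0}" and ?B = "{v. h v \<noteq> 0}"
      have "ev (U r t) (f \<otimes>\<^bsub>R\<^esub> h) = ev (\<lambda>u c. ev (\<lambda>v d. U r t (u \<otimes>\<^bsub>P\<^esub> v) (c * d)) h) f"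
        by (rule M.ev_mult[OF U fs])
      also have "\<dots> = (\<Sum>u\<in>?A. \<Sum>v\<in>?B. \<Sum>m<?n. U r m u (f u) * U m t v (h v))"
        unfolding ev_def
      proof (intro sum.cong refl)
        fix u v assume "u \<in> ?A" "v \<in> ?B"
        then have "u \<in> carrier P" "v \<in> carrier P" using M.R_carrierD(2)[OF f] M.R_carrierD(2)[OF h] by blast+
        from \<psi>_mult[OF this rt] show "U r t (u \<otimes>\<^bsub>P\<^esub> v) (f u * h v) = (\<Sum>m<?n. U r m u (f u) * U m t v (h v))"
          unfolding U_def to_ac_mult by (simp only: sum_distrib_left mult_ac)
      qed
      also have "\<dots> = (\<Sum>u\<in>?A. \<Sum>m<?n. \<Sum>v\<in>?B. U r m u (f u) * U m t v (h v))"
        by (rule sum.cong[OF refl]) (rule sum.swap)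
      also have "\<dots> = (\<Sum>m<?n. \<Sum>u\<in>?A. \<Sum>v\<in>?B. U r m u (f u) * U m t v (h v))" by (rule sum.swap)
      finally show ?thesis by (simp only: ev_def sum_product)
    qed
    then show "\<Phi> (f \<otimes>\<^bsub>R\<^esub> h) = \<Phi> f \<otimes>\<^bsub>ring_mat TYPE('k alg_closure) ?n ()\<^esub> \<Phi> h"
      by (intro eq_matI) (auto simp: \<Phi>_def ring_mat_def scalar_prod_def lessThan_atLeast0)
  next
    have "\<psi> \<one>\<^bsub>P\<^esub> r t = (if r = t then 1 else 0)" if rt: "r < ?n" "t < ?n" for r t
    proof -
      have "\<psi> \<one>\<^bsub>P\<^esub> r t = (\<Prod>i\<in>I. if \<beta> r i = \<beta> t i then 1 else 0)"
        unfolding \<psi>_def by (intro prod.cong refl) (simp add: \<phi>_simps(4)[OF _ \<beta>2[OF rt(1)] \<beta>2[OF rt(2)]])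
      also have "\<dots> = (if r = t then 1 else 0)"
      proof (cases "r = t")
        case False
        have "\<beta> r \<noteq> \<beta> t" "\<beta> r \<in> ?B" "\<beta> t \<in> ?B" using \<beta> rt False by (auto simp: bij_betw_def inj_on_def)
        then obtain i where "i \<in> I" "\<beta> r i \<noteq> \<beta> t i" using PiE_ext[of "\<beta> r" I _ "\<beta> t"] by blast
        then have "(\<Prod>i\<in>I. if \<beta> r i = \<beta> t i then 1 else 0) = (0 :: 'k alg_closure)"
          by (intro prod_zero[OF fin_I]) auto
        then show ?thesis using False by simp
      qed simp
      finally show ?thesis .
    qed
    then show "\<Phi> \<one>\<^bsub>R\<^esub> = \<one>\<^bsub>ring_mat TYPE('k alg_closure) ?n ()\<^esub>"
      unfolding M.R_simps(2) \<Phi>_def ev_single[OF U] by (intro eq_matI) (auto simp: ring_mat_def U_def simp del: one_product_group)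
  qed
  have rel: "\<Phi> f = \<zero>\<^bsub>ring_mat TYPE('k alg_closure) ?n ()\<^esub>" if f: "f \<in> multilinear_relations I Q" for f
  proof -
    have "ev (U r t) f = 0" if rt: "r < ?n" "t < ?n" for r t
    proof -
      consider (1) g i x y where "g \<in> carrier P" "i \<in> I" "x \<in> carrier (Q i)" "y \<in> carrier (Q i)"
          "f = (\<lambda>h. single (g(i := x \<oplus>\<^bsub>Q i\<^esub> y)) 1 h - single (g(i := x)) 1 h - single (g(i := y)) 1 h)"
        | (2) g i k x where "g \<in> carrier P" "i \<in> I" "x \<in> carrier (Q i)"
          "f = (\<lambda>h. single (g(i := k \<odot>\<^bsub>Q i\<^esub> x)) 1 h - single (g(i := x)) k h)"
        using f unfolding multilinear_relations_def by blast
      then show ?thesis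
      proof cases
        case 1
        show ?thesis
          unfolding 1(5) ev_diff[OF U fin_supp_simps(2)[OF fin_supp_single fin_supp_single] fin_supp_single]
            ev_diff[OF U fin_supp_single fin_supp_single] ev_single[OF U]
          unfolding U_def \<psi>_upd[OF 1(2)] \<phi>_simps(1)[OF 1(2) \<beta>2[OF rt(1) 1(2)] \<beta>2[OF rt(2) 1(2)] 1(3,4)]
          by (simp add: distrib_right)
      next
        case 2
        show ?thesis
          unfolding 2(4) ev_diff[OF U fin_supp_single fin_supp_single] ev_single[OF U]
          unfolding U_def \<psi>_upd[OF 2(2)] \<phi>_simps(3)[OF 2(2) \<beta>2[OF rt(1) 2(2)] \<beta>2[OF rt(2) 2(2)] 2(3)]
          by simp
      qed
    qed
    then show ?thesis by (intro eq_matI) (auto simp: \<Phi>_def ring_mat_def)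
  qed
  obtain f where f: "f \<in> Ring.ring_hom A (ring_mat TYPE('k alg_closure) ?n ())" "\<And>h. h \<in> carrier R \<Longrightarrow> f (\<pi> h) = \<Phi> h"
    using hom_factor[OF ring_mat \<Phi>_hom rel] by blast
  have "f (k \<odot>\<^bsub>A\<^esub> x) = to_ac k \<cdot>\<^sub>m f x" if xA: "x \<in> carrier A" for k x
  proof -
    obtain h where h: "h \<in> carrier R" "x = \<pi> h" using \<pi>_surj[OF xA] by blast
    have fin: "finite {g. h g \<noteq> 0}" using M.R_carrierD(1)[OF h(1)] by (simp add: fin_supp_def)
    have sub: "{g. k * h g \<noteq> 0} \<subseteq> {g. h g \<noteq> 0}" by auto
    have "ev (U r t) (\<lambda>g. k * h g) = to_ac k * ev (U r t) h" for r t
      unfolding ev_superset[OF U fin sub] unfolding ev_def U_def by (simp add: sum_distrib_left mult.assoc)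
    then show ?thesis
      unfolding h(2) \<pi>_smult[OF h(1)] f(2)[OF h(1)] f(2)[OF scaled_in[OF h(1)]] \<Phi>_def by (intro eq_matI) auto
  qed
  then show ?thesis unfolding rep_def using f(1) by blast
qed

lemma power_two_neq_0: "of_nat (2 ^ m) \<noteq> (0 :: 'k)" "of_nat (4 ^ m) \<noteq> (0 :: 'k)"
proof -
  have "(4 :: 'k) = 2 * 2" by simp
  then have "(4 :: 'k) \<noteq> 0" using two by (metis mult_eq_0_iff)
  then show "of_nat (2 ^ m) \<noteq> (0 :: 'k)" "of_nat (4 ^ m) \<noteq> (0 :: 'k)" using two by simp_all
qed

text \<open>In a vanishing combination the trace against \<open>e g\<close> is zero, and it equals
  the coefficient at \<open>g\<close> times \<open>2 ^ card I * W g\<close>, which is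
  nonzero.\<close>

lemma indep_e: "A.indep e G"
  unfolding A.indep_def
proof (intro conjI e_funcset allI impI ballI)
  fix k g assume z: "A.comb e G k = \<zero>\<^bsub>A\<^esub>" and g: "g \<in> G"
  obtain f where r: "rep (2 ^ card I) f" using ex_rep by blast
  have "e g \<otimes>\<^bsub>A\<^esub> \<zero>\<^bsub>A\<^esub> = 0 \<odot>\<^bsub>A\<^esub> \<one>\<^bsub>A\<^esub>" using e_in[OF g] A.smult_zero(1)[OF A.one_closed] by simp
  then have "mat_trace (f (e g \<otimes>\<^bsub>A\<^esub> A.comb e G k)) = 0"
    using rep_simps(5)[OF r A.one_closed, of 0] rep_simps(4)[OF r] unfolding z by (simp add: mat_trace_smult[of _ "2 ^ card I"])
  then have "to_ac (of_nat (2 ^ card I) * W g * k g) = 0" unfolding rep_trace_comb[OF r g] .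
  then have "of_nat (2 ^ card I) * W g * k g = 0" by (simp only: to_ac_eq_0_iff)
  then show "k g = 0" using W_simps(1)[OF g] power_two_neq_0(1)[of "card I"] by (simp only: mult_eq_0_iff) simp
qed

text \<open>This needs the product basis to be independent, as the degree is read from the dimension
  \<open>4 ^ card I\<close>. It pins down \<open>n\<close> in the definition of the reduced
  trace.\<close>

lemma degree: "has_degree A n \<longleftrightarrow> n = 2 ^ card I"
proof -
  have "(4 :: nat) ^ card I = (2 ^ card I)\<^sup>2" by (simp add: power2_eq_square power_mult_distrib[symmetric])
  moreover have "n\<^sup>2 = (2 ^ card I)\<^sup>2 \<longleftrightarrow> n = 2 ^ card I" by (rule power2_eq_iff_nonneg) auto
  ultimately show ?thesis
    unfolding has_degree_def A.basis_dim[OF finite_G spans_e indep_e] card_G by auto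
qed

lemma reduced_trace_alt: "reduced_trace A x = (THE t. \<exists>f. rep (2 ^ card I) f \<and> to_ac t = mat_trace (f x))"
proof -
  have "(\<exists>n \<phi>. has_degree A n \<and> \<phi> \<in> Ring.ring_hom A (ring_mat TYPE('k alg_closure) n ()) \<and>
      (\<forall>k. \<forall>x\<in>carrier A. \<phi> (k \<odot>\<^bsub>A\<^esub> x) = to_ac k \<cdot>\<^sub>m \<phi> x) \<and> to_ac t = mat_trace (\<phi> x))
    \<longleftrightarrow> (\<exists>f. rep (2 ^ card I) f \<and> to_ac t = mat_trace (f x))" for t
    unfolding degree rep_def by (simp only: conj_assoc ex_simps simp_thms)
  then show ?thesis unfolding reduced_trace_def by (simp only:)
qed

text \<open>With \<open>e g0 = \<one>\<close>, the trace of every representation of this degree is a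
  fixed multiple of the coefficient at \<open>g0\<close>, which lies in the base field. Hence the
  description is unique, and any representation computes it.\<close>

lemma reduced_trace_eq:
  assumes x: "x \<in> carrier A" and r: "rep (2 ^ card I) f"
  shows "to_ac (reduced_trace A x) = mat_trace (f x)"
proof -
  obtain k where k: "x = A.comb e G k" using spans_e x unfolding A.spans_def by blast
  define d where "d = of_nat (2 ^ card I) * W g0 * k g0"
  have tr: "mat_trace (f' x) = to_ac d" if "rep (2 ^ card I) f'" for f'
    using rep_trace_comb[OF that g0_in, of k] unfolding e_g0 k[symmetric] A.l_one[OF x] d_def .
  have "reduced_trace A x = d"
    unfolding reduced_trace_alt
  proof (rule the_equality)
    show "\<exists>f. rep (2 ^ card I) f \<and> to_ac d = mat_trace (f x)"
      by (intro exI[of _ f] conjI r tr[OF r, symmetric])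
    fix t assume "\<exists>f. rep (2 ^ card I) f \<and> to_ac t = mat_trace (f x)"
    then obtain f' where f': "rep (2 ^ card I) f'" "to_ac t = mat_trace (f' x)" by (elim exE conjE)
    have "to_ac t = to_ac d" unfolding f'(2) by (rule tr[OF f'(1)])
    then show "t = d" by (simp only: to_ac_eq_iff)
  qed
  then show ?thesis by (simp only: tr[OF r])
qed

end

section \<open>Hermitian squares in tensor products\<close>

lemma sum_of_hermitian_squares_zero: "sum_of_hermitian_squares A \<sigma> \<zero>\<^bsub>A\<^esub>" if "ring A"
proof -
  interpret ring A by (rule that)
  show ?thesis unfolding sum_of_hermitian_squares_def by (rule exI[of _ 0]) simp
qed

lemma sum_of_hermitian_squares_add_square:
  assumes "ring A" and \<sigma>: "\<And>x. x \<in> carrier A \<Longrightarrow> \<sigma> x \<in> carrier A"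
    and a: "sum_of_hermitian_squares A \<sigma> a" and z: "z \<in> carrier A"
  shows "sum_of_hermitian_squares A \<sigma> (a \<oplus>\<^bsub>A\<^esub> \<sigma> z \<otimes>\<^bsub>A\<^esub> z)"
proof -
  interpret ring A by (rule assms(1))
  obtain n :: nat and x where x: "\<And>i. i < n \<Longrightarrow> x i \<in> carrier A"
    and e: "a = finsum A (\<lambda>i. \<sigma> (x i) \<otimes>\<^bsub>A\<^esub> x i) {..<n}"
    using a unfolding sum_of_hermitian_squares_def by blast
  have c: "(\<lambda>i. \<sigma> (x i) \<otimes>\<^bsub>A\<^esub> x i) \<in> {..<n} \<rightarrow> carrier A" using x \<sigma> by auto
  have a: "a \<in> carrier A" unfolding e by (rule finsum_closed[OF c])
  let ?x = "x(n := z)"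
  have "finsum A (\<lambda>i. \<sigma> (?x i) \<otimes>\<^bsub>A\<^esub> ?x i) {..<Suc n} = \<sigma> z \<otimes>\<^bsub>A\<^esub> z \<oplus>\<^bsub>A\<^esub> finsum A (\<lambda>i. \<sigma> (?x i) \<otimes>\<^bsub>A\<^esub> ?x i) {..<n}"
    unfolding lessThan_Suc using x z \<sigma> by (subst finsum_insert) auto
  also have "finsum A (\<lambda>i. \<sigma> (?x i) \<otimes>\<^bsub>A\<^esub> ?x i) {..<n} = a"
    unfolding e using c by (intro finsum_cong') auto
  also have "\<sigma> z \<otimes>\<^bsub>A\<^esub> z \<oplus>\<^bsub>A\<^esub> a = a \<oplus>\<^bsub>A\<^esub> \<sigma> z \<otimes>\<^bsub>A\<^esub> z" using a z \<sigma> by (simp add: a_comm)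
  finally have "a \<oplus>\<^bsub>A\<^esub> \<sigma> z \<otimes>\<^bsub>A\<^esub> z = finsum A (\<lambda>i. \<sigma> (?x i) \<otimes>\<^bsub>A\<^esub> ?x i) {..<Suc n}" ..
  moreover have "\<forall>i<Suc n. ?x i \<in> carrier A" using x z by (auto simp: less_Suc_eq)
  ultimately show "sum_of_hermitian_squares A \<sigma> (a \<oplus>\<^bsub>A\<^esub> \<sigma> z \<otimes>\<^bsub>A\<^esub> z)"
    unfolding sum_of_hermitian_squares_def by blast
qed

text \<open>For involutions of the second kind \<open>Trd\<close> doubles the reduced trace of a
  symmetric element; signs are unaffected.\<close>

lemma field_ordering_double:
  fixes x :: "'k::field"
  assumes P: "field_ordering F P" and x: "x \<in> F" and two: "(2 :: 'k) \<noteq> 0"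
  shows "x + x \<in> P \<longleftrightarrow> x \<in> P"
proof
  assume d: "x + x \<in> P"
  show "x \<in> P"
  proof (rule ccontr)
    assume n: "x \<notin> P"
    then have "- x \<in> P" using P x by (auto simp: field_ordering_def)
    then have "- x + - x \<in> P" using P unfolding field_ordering_def by blast
    then have "- (x + x) \<in> P" by simp
    then have "x + x = 0" using P d unfolding field_ordering_def by blast
    then have "2 * x = 0" by (simp only: mult_2)
    then have "x = 0" using two by simp
    then show False using n \<open>- x \<in> P\<close> by simp
  qed
next
  assume "x \<in> P"
  then show "x + x \<in> P" using P unfolding field_ordering_def by blast
qed

section \<open>Traces and hermitian squares in the tensor product\<close>

context quaternion_tensor_data
begin

abbreviation "c \<equiv> reduced_trace A"

lemma c_simps:
  shows "x \<in> carrier A \<Longrightarrow> y \<in> carrier A \<Longrightarrow> c (x \<oplus>\<^bsub>A\<^esub> y) = c x + c y"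
    "x \<in> carrier A \<Longrightarrow> c (k \<odot>\<^bsub>A\<^esub> x) = k * c x"
    "g \<in> G \<Longrightarrow> h \<in> G \<Longrightarrow> c (e g \<otimes>\<^bsub>A\<^esub> e h) = (if g = h then of_nat (2 ^ card I) * W g else 0)"
    "h \<in> G \<Longrightarrow> c (e h \<otimes>\<^bsub>A\<^esub> A.comb e G q) = of_nat (2 ^ card I) * W h * q h"
proof -
  obtain f where r: "rep (2 ^ card I) f" using ex_rep by blast
  note t = reduced_trace_eq[OF _ r]
  show "c (x \<oplus>\<^bsub>A\<^esub> y) = c x + c y" if "x \<in> carrier A" "y \<in> carrier A"
  proof -
    have "to_ac (c (x \<oplus>\<^bsub>A\<^esub> y)) = to_ac (c x + c y)"
      unfolding to_ac_add t[OF that(1)] t[OF that(2)] t[OF A.a_closed[OF that]] rep_simps(2)[OF r that]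
      by (rule mat_trace_add[OF rep_simps(1)[OF r that(1)] rep_simps(1)[OF r that(2)]])
    then show ?thesis by (simp only: to_ac_eq_iff)
  qed
  show "c (k \<odot>\<^bsub>A\<^esub> x) = k * c x" if "x \<in> carrier A"
  proof -
    have "to_ac (c (k \<odot>\<^bsub>A\<^esub> x)) = to_ac (k * c x)"
      unfolding to_ac_mult t[OF that] t[OF A.smult_simps(1)[OF that]] rep_simps(5)[OF r that]
      by (rule mat_trace_smult[OF rep_simps(1)[OF r that]])
    then show ?thesis by (simp only: to_ac_eq_iff)
  qed
  show "c (e g \<otimes>\<^bsub>A\<^esub> e h) = (if g = h then of_nat (2 ^ card I) * W g else 0)" if "g \<in> G" "h \<in> G"
    using t[OF A.m_closed[OF e_in[OF that(1)] e_in[OF that(2)]]] unfolding rep_trace_e[OF r that] to_ac_eq_iff .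
  show "c (e h \<otimes>\<^bsub>A\<^esub> A.comb e G q) = of_nat (2 ^ card I) * W h * q h" if "h \<in> G"
    using t[OF A.m_closed[OF e_in[OF that] A.comb_closed[OF e_funcset]]] unfolding rep_trace_comb[OF r that] to_ac_eq_iff .
qed

lemma ex_comb: assumes "x \<in> carrier A" obtains k where "x = A.comb e G k"
  using spans_e assms unfolding A.spans_def by blast

lemma s_zero: "s \<zero>\<^bsub>A\<^esub> = \<zero>\<^bsub>A\<^esub>"
  using s_simps(5)[OF A.zero_closed, of 0] \<tau>_simps(5) A.smult_zero(1)[OF A.zero_closed]
    A.smult_zero(1)[OF s_simps(1)[OF A.zero_closed]] by (simp only:)

lemma s_comb: "s (A.comb e G k) = A.comb e G (\<lambda>g. \<tau> (k g) * E g)"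
proof -
  have "s (A.comb e G k) = finsum A (\<lambda>g. s (k g \<odot>\<^bsub>A\<^esub> e g)) G"
    unfolding A.comb_def
    by (rule A.finsum_endo[OF finite_G _ _ s_zero s_simps(3)]) (auto intro: A.smult_simps(1) e_in s_simps(1))
  also have "\<dots> = finsum A (\<lambda>g. (\<tau> (k g) * E g) \<odot>\<^bsub>A\<^esub> e g) G"
  proof (rule A.finsum_cong'[OF refl])
    show "(\<lambda>g. (\<tau> (k g) * E g) \<odot>\<^bsub>A\<^esub> e g) \<in> G \<rightarrow> carrier A" by (intro Pi_I A.smult_simps(1) e_in)
    fix g assume g: "g \<in> G"
    show "s (k g \<odot>\<^bsub>A\<^esub> e g) = (\<tau> (k g) * E g) \<odot>\<^bsub>A\<^esub> e g"
      unfolding s_simps(5)[OF e_in[OF g]] s_e[OF g] A.smult_simps(4)[OF e_in[OF g]] ..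
  qed
  finally show ?thesis unfolding A.comb_def .
qed

text \<open>The reduced trace sees the coefficient at the unit \<open>e g0\<close> only, and there
  the sign \<open>E g0\<close> is \<open>1\<close>.\<close>

lemma c_s: assumes x: "x \<in> carrier A" shows "c (s x) = \<tau> (c x)"
proof -
  obtain k where k: "x = A.comb e G k" using ex_comb[OF x] .
  have 1: "c (A.comb e G q) = of_nat (2 ^ card I) * W g0 * q g0" for q
    using c_simps(4)[OF g0_in, of q] unfolding e_g0 A.l_one[OF A.comb_closed[OF e_funcset]] .
  show ?thesis
    unfolding k s_comb 1 \<tau>_simps(2) \<tau>_simps(10) W_simps(2)[OF g0_in] E_simps(3)[OF g0_in] by simp
qed

lemma c_s_e:
  assumes "g \<in> G" "h \<in> G"
  shows "c (s (e g) \<otimes>\<^bsub>A\<^esub> e h) = (if g = h then of_nat (2 ^ card I) * (E g * W g) else 0)"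
  unfolding s_e[OF assms(1)] A.smult_mult(1)[OF e_in[OF assms(1)] e_in[OF assms(2)]]
    c_simps(2)[OF A.m_closed[OF e_in[OF assms(1)] e_in[OF assms(2)]]] c_simps(3)[OF assms] by simp

text \<open>The trace of the unit is a nonzero multiple of \<open>2 ^ card I\<close>, whereas zero
  has trace zero.\<close>

lemma one_neq_zero: "\<one>\<^bsub>A\<^esub> \<noteq> \<zero>\<^bsub>A\<^esub>"
proof
  assume z: "\<one>\<^bsub>A\<^esub> = \<zero>\<^bsub>A\<^esub>"
  have "c (e g0 \<otimes>\<^bsub>A\<^esub> e g0) = of_nat (2 ^ card I) * W g0" unfolding c_simps(3)[OF g0_in g0_in] by simp
  moreover have "c (e g0 \<otimes>\<^bsub>A\<^esub> e g0) = 0"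
    using c_simps(2)[OF A.zero_closed, of 0] unfolding e_g0 z A.smult_zero(1)[OF A.zero_closed] A.l_null[OF A.zero_closed] by simp
  ultimately show False using W_simps(1)[OF g0_in] power_two_neq_0(1)[of "card I"] by (simp only: mult_eq_0_iff) simp
qed

lemma fixed_field_A: "fixed_field A s = {k. \<tau> k = k}"
proof -
  have "s (k \<odot>\<^bsub>A\<^esub> \<one>\<^bsub>A\<^esub>) = k \<odot>\<^bsub>A\<^esub> \<one>\<^bsub>A\<^esub> \<longleftrightarrow> \<tau> k = k" for k
  proof
    assume "s (k \<odot>\<^bsub>A\<^esub> \<one>\<^bsub>A\<^esub>) = k \<odot>\<^bsub>A\<^esub> \<one>\<^bsub>A\<^esub>"
    then show "\<tau> k = k" unfolding s_scalar by (rule A.smult_one_inj[OF one_neq_zero])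
  qed (simp only: s_scalar)
  then show ?thesis unfolding fixed_field_def by blast
qed

text \<open>For symmetric \<open>y\<close> the value \<open>c y\<close> is fixed by
  \<open>\<tau>\<close>. So \<open>Trd\<close> is \<open>c y\<close> or twice it, according to the
  kind, and both have the same sign.\<close>

lemma Trd_ordering:
  assumes y: "y \<in> carrier A" "s y = y" and Z: "field_ordering (fixed_field A s) Z"
  shows "0 \<le>\<^bsub>Z\<^esub> Trd A s y \<longleftrightarrow> c y \<in> Z"
proof -
  have f: "\<tau> (c y) = c y" using c_s[OF y(1)] y(2) by simp
  have "centre_restriction A s (c y) = c y"
    unfolding centre_restriction_def
  proof (rule the_equality)
    show "s (c y \<odot>\<^bsub>A\<^esub> \<one>\<^bsub>A\<^esub>) = c y \<odot>\<^bsub>A\<^esub> \<one>\<^bsub>A\<^esub>" unfolding s_scalar f ..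
    fix d assume "s (c y \<odot>\<^bsub>A\<^esub> \<one>\<^bsub>A\<^esub>) = d \<odot>\<^bsub>A\<^esub> \<one>\<^bsub>A\<^esub>"
    then have "c y \<odot>\<^bsub>A\<^esub> \<one>\<^bsub>A\<^esub> = d \<odot>\<^bsub>A\<^esub> \<one>\<^bsub>A\<^esub>" unfolding s_scalar f .
    then have "c y = d" by (rule A.smult_one_inj[OF one_neq_zero])
    then show "d = c y" ..
  qed
  then have "Trd A s y = (if first_kind A s then c y else c y + c y)" by (simp only: Trd_def)
  moreover have "c y + c y \<in> Z \<longleftrightarrow> c y \<in> Z"
    by (rule field_ordering_double[OF Z _ two]) (simp add: fixed_field_A f)
  ultimately show ?thesis by (simp add: ord_le_def)
qed

text \<open>The representation over the algebraic closure also embeds \<open>A\<close> into a ring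
  type, with the scalars of the base field going to scalar matrices. The abstract argument of
  \<open>diagonal_trace_algebra\<close> runs in the image, and the result is pulled back.\<close>

theorem PS_conjecture: "PS_conjecture_holds A s"
proof -
  let ?n = "2 ^ card I :: nat"
  have n0: "?n > 0" by simp
  obtain f where r: "rep ?n f" using ex_rep by blast
  note fc = rep_simps(1)[OF r]
  define \<rho> where "\<rho> x = block_rfm ?n (f x)" for x
  define \<iota> where "\<iota> k = rfm_scalar (to_ac k)" for k :: 'k
  have add: "\<rho> (x \<oplus>\<^bsub>A\<^esub> y) = \<rho> x + \<rho> y" if "x \<in> carrier A" "y \<in> carrier A" for x y
    unfolding \<rho>_def rep_simps(2)[OF r that] by (rule block_rfm_hom(1)[OF n0 fc[OF that(1)] fc[OF that(2)]])
  have mult: "\<rho> (x \<otimes>\<^bsub>A\<^esub> y) = \<rho> x * \<rho> y" if "x \<in> carrier A" "y \<in> carrier A" for x y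
    unfolding \<rho>_def rep_simps(3)[OF r that] by (rule block_rfm_hom(2)[OF n0 fc[OF that(1)] fc[OF that(2)]])
  have smult: "\<rho> (k \<odot>\<^bsub>A\<^esub> x) = \<iota> k * \<rho> x" if "x \<in> carrier A" for k x
    unfolding \<rho>_def \<iota>_def rep_simps(5)[OF r that] by (rule block_rfm_hom(4)[OF n0 fc[OF that] fc[OF that]])
  have one: "\<rho> \<one>\<^bsub>A\<^esub> = 1"
    unfolding \<rho>_def rep_simps(4)[OF r] by (rule block_rfm_hom(3)[OF n0 fc[OF A.one_closed] fc[OF A.one_closed]])
  have \<rho>0: "\<rho> \<zero>\<^bsub>A\<^esub> = 0" using add[OF A.zero_closed A.zero_closed] unfolding A.l_zero[OF A.zero_closed] by simp
  \<comment> \<open>Equal images have equal traces against all basis elements, hence equal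
    coordinates; simplicity of \<open>A\<close> is not invoked.\<close>
  have inj: "inj_on \<rho> (carrier A)"
  proof (rule inj_onI)
    fix x y assume xy: "x \<in> carrier A" "y \<in> carrier A" "\<rho> x = \<rho> y"
    have fxy: "f x = f y" using xy(3) unfolding \<rho>_def by (rule block_rfm_hom(5)[OF n0 fc[OF xy(1)] fc[OF xy(2)]])
    obtain k k' where k: "x = A.comb e G k" "y = A.comb e G k'" using ex_comb[OF xy(1)] ex_comb[OF xy(2)] by metis
    have "k g = k' g" if g: "g \<in> G" for g
    proof -
      have "f (e g \<otimes>\<^bsub>A\<^esub> x) = f (e g \<otimes>\<^bsub>A\<^esub> y)"
        unfolding rep_simps(3)[OF r e_in[OF g] xy(1)] rep_simps(3)[OF r e_in[OF g] xy(2)] fxy ..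
      then have "to_ac (of_nat ?n * W g * k g) = to_ac (of_nat ?n * W g * k' g)"
        unfolding k rep_trace_comb[OF r g, symmetric] by (simp only:)
      then have "of_nat ?n * W g * k g = of_nat ?n * W g * k' g" by (simp only: to_ac_eq_iff)
      then show ?thesis using W_simps(1)[OF g] power_two_neq_0(1)[of "card I"] by (simp only: mult_cancel_left mult_eq_0_iff) simp
    qed
    then show "x = y" unfolding k A.comb_def using e_in A.smult_simps(1) by (intro A.finsum_cong') auto
  qed
  have scal: "\<rho> (k \<odot>\<^bsub>A\<^esub> \<one>\<^bsub>A\<^esub>) = \<iota> k" for k unfolding smult[OF A.one_closed] one by simp
  define v where "v = the_inv_into (carrier A) \<rho>"
  have v: "v (\<rho> x) = x" if "x \<in> carrier A" for x unfolding v_def by (rule the_inv_into_f_f[OF inj that])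
  define s' where "s' z = \<rho> (s (v z))" for z
  define c' where "c' z = c (v z)" for z
  have s': "s' (\<rho> x) = \<rho> (s x)" if "x \<in> carrier A" for x unfolding s'_def v[OF that] ..
  have c': "c' (\<rho> x) = c x" if "x \<in> carrier A" for x unfolding c'_def v[OF that] ..
  have comb: "\<rho> (A.comb e G k) = (\<Sum>g\<in>G. \<iota> (k g) * \<rho> (e g))" for k
    using A.hom_comb[OF finite_G e_funcset add \<rho>0, of k] smult[OF e_in] by simp
  let ?S = "\<rho> ` carrier A"
  interpret D: diagonal_trace_algebra ?S \<iota> s' \<tau> G "\<lambda>g. \<rho> (e g)" "\<lambda>g. E g * W g" c' ?n
  proof (unfold_locales)
    show "\<iota> (a + b) = \<iota> a + \<iota> b" "\<iota> (a * b) = \<iota> a * \<iota> b" "\<iota> 1 = 1" for a b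
      by (simp_all add: \<iota>_def rfm_scalar_simps rfm_scalar_mult)
    show "\<iota> a * x = x * \<iota> a" for a x unfolding \<iota>_def by (rule rfm_scalar_commute)
    show "\<iota> a \<in> ?S" for a unfolding scal[symmetric] by (intro imageI A.smult_simps(1) A.one_closed)
    show "x + y \<in> ?S" if xy: "x \<in> ?S" "y \<in> ?S" for x y
    proof -
      obtain x' y' where "x' \<in> carrier A" "y' \<in> carrier A" "x = \<rho> x'" "y = \<rho> y'" using xy by blast
      then show ?thesis using imageI[OF A.a_closed[of x' y'], of \<rho>] add by simp
    qed
    show "x * y \<in> ?S" if xy: "x \<in> ?S" "y \<in> ?S" for x y
    proof -
      obtain x' y' where "x' \<in> carrier A" "y' \<in> carrier A" "x = \<rho> x'" "y = \<rho> y'" using xy by blast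
      then show ?thesis using imageI[OF A.m_closed[of x' y'], of \<rho>] mult by simp
    qed
    show "(2 :: 'k) \<noteq> 0" by (rule two)
    show "s' x \<in> ?S" "s' (s' x) = x" if x: "x \<in> ?S" for x
    proof -
      obtain x' where x': "x' \<in> carrier A" "x = \<rho> x'" using x by blast
      show "s' x \<in> ?S" unfolding x'(2) s'[OF x'(1)] by (intro imageI s_simps(1) x'(1))
      show "s' (s' x) = x" unfolding x'(2) s'[OF x'(1)] s'[OF s_simps(1)[OF x'(1)]] s_simps(2)[OF x'(1)] ..
    qed
    show "s' (x + y) = s' x + s' y" "s' (x * y) = s' y * s' x" "c' (x + y) = c' x + c' y" if xy: "x \<in> ?S" "y \<in> ?S" for x y
    proof -
      obtain x' y' where x': "x' \<in> carrier A" "x = \<rho> x'" and y': "y' \<in> carrier A" "y = \<rho> y'" using xy by blast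
      note a = A.a_closed[OF x'(1) y'(1)] and m = A.m_closed[OF x'(1) y'(1)]
      show "s' (x + y) = s' x + s' y"
        unfolding x'(2) y'(2) add[OF x'(1) y'(1), symmetric] s'[OF a] s'[OF x'(1)] s'[OF y'(1)] s_simps(3)[OF x'(1) y'(1)]
        by (rule add[OF s_simps(1)[OF x'(1)] s_simps(1)[OF y'(1)]])
      show "s' (x * y) = s' y * s' x"
        unfolding x'(2) y'(2) mult[OF x'(1) y'(1), symmetric] s'[OF m] s'[OF x'(1)] s'[OF y'(1)] s_simps(4)[OF x'(1) y'(1)]
        by (rule mult[OF s_simps(1)[OF y'(1)] s_simps(1)[OF x'(1)]])
      show "c' (x + y) = c' x + c' y"
        unfolding x'(2) y'(2) add[OF x'(1) y'(1), symmetric] c'[OF a] c'[OF x'(1)] c'[OF y'(1)]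
        by (rule c_simps(1)[OF x'(1) y'(1)])
    qed
    show "s' (\<iota> k) = \<iota> (\<tau> k)" for k
      unfolding scal[symmetric] s'[OF A.smult_simps(1)[OF A.one_closed]] s_scalar ..
    show "finite G" by (rule finite_G)
    show "of_nat (card G) \<noteq> (0 :: 'k)" unfolding card_G by (rule power_two_neq_0(2))
    show "of_nat ?n \<noteq> (0 :: 'k)" by (rule power_two_neq_0(1))
    fix g assume g: "g \<in> G"
    show "\<rho> (e g) \<in> ?S" by (intro imageI e_in g)
    show "E g * W g \<noteq> 0" using W_simps(1)[OF g] E_simps(1)[OF g] by simp
    show "\<tau> (E g * W g) = E g * W g" unfolding \<tau>_simps(2) W_simps(2)[OF g] E_simps(2)[OF g] ..
    \<comment> \<open>\<open>s (e g)\<close> is a sign times \<open>e g\<close>, so both similitude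
      identities reduce to the scalar square of \<open>e g\<close>.\<close>
    have "\<iota> (E g) * (\<rho> (e g) * \<rho> (e g)) = \<iota> (E g * W g)"
      unfolding mult[OF e_in[OF g] e_in[OF g], symmetric] e_sq[OF g] scal by (simp add: \<iota>_def rfm_scalar_mult)
    moreover have "s' (\<rho> (e g)) = \<iota> (E g) * \<rho> (e g)" unfolding s'[OF e_in[OF g]] s_e[OF g] by (rule smult[OF e_in[OF g]])
    moreover have "\<rho> (e g) * (\<iota> (E g) * \<rho> (e g)) = \<iota> (E g) * (\<rho> (e g) * \<rho> (e g))"
      unfolding \<iota>_def mult.assoc[of "rfm_scalar (to_ac (E g))" "\<rho> (e g)" "\<rho> (e g)", symmetric] rfm_scalar_commute
      by (rule mult.assoc[symmetric])
    ultimately show "s' (\<rho> (e g)) * \<rho> (e g) = \<iota> (E g * W g)" "\<rho> (e g) * s' (\<rho> (e g)) = \<iota> (E g * W g)"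
      by (simp_all only: mult.assoc)
    show "c' (s' (\<rho> (e g)) * \<rho> (e h)) = (if g = h then of_nat ?n * (E g * W g) else 0)" if h: "h \<in> G" for h
      unfolding s'[OF e_in[OF g]] mult[OF s_simps(1)[OF e_in[OF g]] e_in[OF h], symmetric]
        c'[OF A.m_closed[OF s_simps(1)[OF e_in[OF g]] e_in[OF h]]] by (rule c_s_e[OF g h])
  next
    fix y assume "y \<in> ?S"
    then obtain y' where y': "y' \<in> carrier A" "y = \<rho> y'" by blast
    obtain k where k: "y' = A.comb e G k" using ex_comb[OF y'(1)] .
    show "\<exists>k. y = (\<Sum>g\<in>G. \<iota> (k g) * \<rho> (e g))" unfolding y'(2) k comb by blast
    show "c' (\<iota> k * y) = k * c' y" for k
      unfolding y'(2) smult[OF y'(1), symmetric] c'[OF y'(1)] c'[OF A.smult_simps(1)[OF y'(1)]] by (rule c_simps(2)[OF y'(1)])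
    show "c' (s' y) = \<tau> (c' y)"
      unfolding y'(2) s'[OF y'(1)] c'[OF y'(1)] c'[OF s_simps(1)[OF y'(1)]] by (rule c_s[OF y'(1)])
  qed
  have fixed: "D.fixed = fixed_field A s" unfolding D.fixed_def fixed_field_A ..
  \<comment> \<open>Elements of the inductive cone are carried back to indexed sums, one hermitian
    square at a time.\<close>
  have sos: "\<exists>y. z = \<rho> y \<and> y \<in> carrier A \<and> sum_of_hermitian_squares A s y" if "z \<in> D.HS" for z
    using that
  proof (induction rule: D.HS.induct)
    case zero
    show ?case
      by (intro exI[of _ "\<zero>\<^bsub>A\<^esub>"] conjI \<rho>0[symmetric] sum_of_hermitian_squares_zero[OF ring_A] A.zero_closed)
  next
    case (add_square z x)
    then obtain y where y: "z = \<rho> y" "y \<in> carrier A" "sum_of_hermitian_squares A s y" by blast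
    obtain x' where x': "x' \<in> carrier A" "x = \<rho> x'" using add_square.hyps(2) by blast
    have m: "s x' \<otimes>\<^bsub>A\<^esub> x' \<in> carrier A" by (rule A.m_closed[OF s_simps(1)[OF x'(1)] x'(1)])
    have "z + s' x * x = \<rho> (y \<oplus>\<^bsub>A\<^esub> s x' \<otimes>\<^bsub>A\<^esub> x')"
      unfolding y(1) x'(2) s'[OF x'(1)] add[OF y(2) m] mult[OF s_simps(1)[OF x'(1)] x'(1)] ..
    moreover have "y \<oplus>\<^bsub>A\<^esub> s x' \<otimes>\<^bsub>A\<^esub> x' \<in> carrier A" by (rule A.a_closed[OF y(2) m])
    moreover have "sum_of_hermitian_squares A s (y \<oplus>\<^bsub>A\<^esub> s x' \<otimes>\<^bsub>A\<^esub> x')"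
      by (rule sum_of_hermitian_squares_add_square[OF ring_A s_simps(1) y(3) x'(1)])
    ultimately show ?case by blast
  qed
  show ?thesis
    unfolding PS_conjecture_holds_def
  proof (intro allI impI)
    fix a assume a: "totally_sigma_positive A s a"
    have ac: "a \<in> carrier A" "s a = a" using a by (auto simp: totally_sigma_positive_def Sym_def)
    have "\<rho> a \<in> D.HS"
    proof (rule D.positive_in_HS)
      show "\<rho> a \<in> ?S" by (rule imageI[OF ac(1)])
      show "s' (\<rho> a) = \<rho> a" unfolding s'[OF ac(1)] ac(2) ..
      fix Z z assume P: "field_ordering D.fixed Z" and pos: "\<And>x. x \<in> ?S \<Longrightarrow> c' (s' x * x) \<in> Z" and "z \<in> ?S"
      then obtain x where x: "x \<in> carrier A" "z = \<rho> x" by blast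
      note P' = P[unfolded fixed]
      \<comment> \<open>The side condition supplied with \<open>Z\<close> says that the trace form
        is nonnegative, which by \<open>Trd_ordering\<close> makes \<open>Z\<close> a
        \<sigma>-ordering.\<close>
      have "sigma_ordering A s Z"
        unfolding sigma_ordering_def
      proof (intro conjI P' ballI)
        fix y assume y: "y \<in> carrier A"
        note sy = s_simps(1)[OF y]
        have m: "s y \<otimes>\<^bsub>A\<^esub> y \<in> carrier A" by (rule A.m_closed[OF sy y])
        have sm: "s (s y \<otimes>\<^bsub>A\<^esub> y) = s y \<otimes>\<^bsub>A\<^esub> y" unfolding s_simps(4)[OF sy y] s_simps(2)[OF y] ..
        have "c (s y \<otimes>\<^bsub>A\<^esub> y) \<in> Z"
          using pos[OF imageI[OF y]] unfolding s'[OF y] mult[OF sy y, symmetric] c'[OF m] .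
        then show "0 \<le>\<^bsub>Z\<^esub> Trd A s (s y \<otimes>\<^bsub>A\<^esub> y)" unfolding Trd_ordering[OF m sm P'] .
      qed
      then have "sigma_positive A s Z a" using a by (auto simp: totally_sigma_positive_def)
      then have T: "0 \<le>\<^bsub>Z\<^esub> Trd A s (s x \<otimes>\<^bsub>A\<^esub> a \<otimes>\<^bsub>A\<^esub> x)" using x(1) by (simp only: sigma_positive_def)
      note sx = s_simps(1)[OF x(1)]
      have sa: "s x \<otimes>\<^bsub>A\<^esub> a \<in> carrier A" by (rule A.m_closed[OF sx ac(1)])
      have m: "s x \<otimes>\<^bsub>A\<^esub> a \<otimes>\<^bsub>A\<^esub> x \<in> carrier A" by (rule A.m_closed[OF sa x(1)])
      have sm: "s (s x \<otimes>\<^bsub>A\<^esub> a \<otimes>\<^bsub>A\<^esub> x) = s x \<otimes>\<^bsub>A\<^esub> a \<otimes>\<^bsub>A\<^esub> x"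
        unfolding s_simps(4)[OF sa x(1)] s_simps(4)[OF sx ac(1)] s_simps(2)[OF x(1)] ac(2)
        by (rule A.m_assoc[OF sx ac(1) x(1), symmetric])
      show "c' (s' z * \<rho> a * z) \<in> Z"
        using T unfolding Trd_ordering[OF m sm P'] x(2) s'[OF x(1)] mult[OF sx ac(1), symmetric] mult[OF sa x(1), symmetric] c'[OF m] .
    qed
    then obtain y where "\<rho> a = \<rho> y" "y \<in> carrier A" "sum_of_hermitian_squares A s y" using sos by blast
    then show "sum_of_hermitian_squares A s a" using inj_onD[OF inj _ ac(1)] by blast
  qed
qed

end

theorem corollary4p3:
  fixes l :: nat
    and Q :: "nat \<Rightarrow> ('k::field, 'q) module"
    and \<sigma> :: "nat \<Rightarrow> 'q \<Rightarrow> 'q"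
    and F :: "'k set"
  assumes "1 \<le> l"
    and "\<And>i. i \<in> {1..l} \<Longrightarrow> quaternion_algebra (Q i)"
    and "\<And>i. i \<in> {1..l} \<Longrightarrow> involution (Q i) (\<sigma> i)"
    and "\<And>i. i \<in> {1..l} \<Longrightarrow> fixed_field (Q i) (\<sigma> i) = F"
    and "formally_real F"
  shows "PS_conjecture_holds (tensor_algebra {1..l} Q) (tensor_involution {1..l} Q \<sigma>)"
proof -
  have l: "1 \<in> {1..l}" using assms(1) by simp
  have "kalg (Q 1)"
    using assms(2)[OF l] by (intro k_algebra_kalg) (simp add: quaternion_algebra_def central_simple_algebra_def)
  then interpret Q1: kalg "Q 1" .
  have "\<sigma> 1 \<one>\<^bsub>Q 1\<^esub> = \<one>\<^bsub>Q 1\<^esub>" using assms(3)[OF l] by (simp only: involution_def)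
  \<comment> \<open>\<open>F\<close> is given as a fixed field; a factor is needed to know that it
    contains \<open>1\<close>, and \<open>1 \<le> l\<close> provides one.\<close>
  then have "1 \<in> F" using assms(4)[OF l] Q1.smult_simps(5)[OF Q1.one_closed] by (auto simp: fixed_field_def)
  then have two: "(2 :: 'k) \<noteq> 0" by (rule formally_real_two_neq_0[OF assms(5)])
  have "\<exists>b w \<epsilon> \<phi>. adapted_basis (Q i) (\<sigma> i) b w \<epsilon> \<phi>" if "i \<in> {1..l}" for i
    by (rule ex_adapted_basis[OF assms(2)[OF that] assms(3)[OF that] two]) (intro exI)
  \<comment> \<open>The four data of a factor are packed into one tuple, so that a single
    application of choice selects them for all indices.\<close>
  then have "\<forall>i. \<exists>d. i \<in> {1..l} \<longrightarrow> (case d of (b, w, \<epsilon>, \<phi>) \<Rightarrow> adapted_basis (Q i) (\<sigma> i) b w \<epsilon> \<phi>)"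
    by (simp only: split_paired_Ex prod.case ex_simps) simp
  then obtain d where "\<And>i. i \<in> {1..l} \<Longrightarrow> (case d i of (b, w, \<epsilon>, \<phi>) \<Rightarrow> adapted_basis (Q i) (\<sigma> i) b w \<epsilon> \<phi>)"
    unfolding choice_iff by blast
  then have d: "adapted_basis (Q i) (\<sigma> i) (fst (d i)) (fst (snd (d i))) (fst (snd (snd (d i)))) (snd (snd (snd (d i))))"
    if "i \<in> {1..l}" for i
    using that by (simp only: split_def)
  interpret quaternion_tensor_data "{1..l}" Q \<sigma> F "\<lambda>i. fst (d i)" "\<lambda>i. fst (snd (d i))"
      "\<lambda>i. fst (snd (snd (d i)))" "\<lambda>i. snd (snd (snd (d i)))"
    by unfold_locales (use assms two d in auto)
  show ?thesis by (rule PS_conjecture)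
qed

end
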